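(* Let $G$ be a finite non-nilpotent group with $\lambda(G)=6$. Then $G$ is isomorphic to one of the following groups, for some positive integer $n$: (a) $\langle a,b \mid a^5=1=b^n,\ a^b=a^4\rangle$, where $4^n\equiv 1 \pmod 5$ and $5\nmid n$; (b) $\langle a,b \mid a^5=1=b^n,\ a^b=a^2\rangle$, where $2^n\equiv 1 \pmod 5$, $5\nmid n$ and $4\mid n$; (c) $\langle a,b \mid a^5=1=b^n,\ a^b=a^3\rangle$, where $3^n\equiv 1 \pmod 5$, $5\nmid n$ and $4\mid n$; (d) $\langle a,b \mid a^{3n}=1=b^{6n},\ a^b=a^{n+1},\ a^3=b^6\rangle$, where $3\mid n$ or $3\mid (n+2)$; (e) $\langle a,b \mid a^{3n}=1=b^{6n},\ a^b=a^{2n+1},\ a^3=b^6\rangle$, where $3\mid n$ or $3\mid (n+1)$; (f) $\langle a,b \mid a^{3n}=1=b^{6n},\ a^3=b^6,\ a^b=a^{n+1}\rangle$, where $2\mid n$ and ($3\mid n$ or $3\mid (n+2)$); (g) $\langle a,b \mid a^{3n}=1=b^{6n},\ a^3=b^6,\ a^b=a^{2n+1}\rangle$, where $2\mid n$ and $3\nmid (n+2)$.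
   Context: A covering of a finite group $G$ is a family of subgroups $X_1,\dots,X_n$ ($n\geq 2$) with $\bigcup_{i=1}^n X_i = G$. It is irredundant if $X_i \nsubseteq \bigcup_{j\neq i} X_j$ for every $i$. For a non-cyclic finite group $G$, $\lambda(G)$ denotes the maximum number of subgroups in an irredundant covering of $G$; for cyclic $G$ the convention is $\lambda(G)=1$. Here $a^b=b^{-1}ab$. *)

theory Defs
  imports "HOL-Algebra.Elementary_Groups" "HOL-Number_Theory.Cong"
begin

section \<open>Irredundant coverings\<close>

definition irredundant_covering :: "('a, 'b) monoid_scheme \<Rightarrow> nat \<Rightarrow> (nat \<Rightarrow> 'a set) \<Rightarrow> bool" where
  "irredundant_covering G n X \<longleftrightarrow>
     2 \<le> n \<and>
     (\<forall>i\<in>{1..n}. subgroup (X i) G) \<and>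
     (\<Union>i\<in>{1..n}. X i) = carrier G \<and>
     (\<forall>i\<in>{1..n}. \<not> X i \<subseteq> (\<Union>j\<in>{1..n} - {i}. X j))"

text \<open>Meaningful for finite groups only; the lemmas below show that the maximum is then taken over
  a finite nonempty set.\<close>
definition covering_number :: "('a, 'b) monoid_scheme \<Rightarrow> nat" where
  "covering_number G =
     (if cyclic_group G then 1 else Max {n. \<exists>X. irredundant_covering G n X})"

lemma irredundant_covering_le_card:
  assumes "finite (carrier G)" and cov: "irredundant_covering G n X"
  shows "n \<le> card (carrier G)"
proof -
  have "\<forall>i\<in>{1..n}. \<exists>x. x \<in> X i \<and> x \<notin> (\<Union>j\<in>{1..n} - {i}. X j)"
    using cov unfolding irredundant_covering_def by blast
  then obtain f where f: "\<And>i. i \<in> {1..n} \<Longrightarrow> f i \<in> X i \<and> f i \<notin> (\<Union>j\<in>{1..n} - {i}. X j)"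
    by metis
  have "inj_on f {1..n}"
  proof (rule inj_onI)
    fix i j assume "i \<in> {1..n}" "j \<in> {1..n}" "f i = f j"
    then show "i = j" using f[of i] f[of j] by auto
  qed
  moreover have "f ` {1..n} \<subseteq> carrier G"
    using f cov unfolding irredundant_covering_def by blast
  ultimately show ?thesis
    using card_inj_on_le[of f "{1..n}" "carrier G"] assms(1) by simp
qed

lemma finite_irredundant_coverings:
  "finite (carrier G) \<Longrightarrow> finite {n. \<exists>X. irredundant_covering G n X}"
  by (rule finite_subset[of _ "{..card (carrier G)}"]) (auto dest: irredundant_covering_le_card)

lemma (in group) ex_irredundant_covering:
  assumes fin: "finite (carrier G)" and nc: "\<not> cyclic_group G"
  shows "\<exists>n X. irredundant_covering G n X"
proof -
  define P where "P S \<longleftrightarrow> S \<subseteq> carrier G \<and> (\<Union>x\<in>S. generate G {x}) = carrier G" for S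
  have gen: "x \<in> generate G {x}" "x \<in> carrier G \<Longrightarrow> generate G {x} \<subseteq> carrier G" for x
    by (auto intro: generate.incl dest: generate_in_carrier[rotated])
  have "P (carrier G)"
    unfolding P_def using gen by blast
  then obtain S where S: "P S" and min: "\<And>T. P T \<Longrightarrow> card S \<le> card T"
    by (metis ex_has_least_nat[of P])
  have finS: "finite S" and SC: "S \<subseteq> carrier G"
    using S fin finite_subset unfolding P_def by auto
  obtain h where h: "bij_betw h {1..card S} S"
    using ex_bij_betw_nat_finite_1[OF finS] by blast
  have hS: "h ` {1..card S} = S" and hinj: "inj_on h {1..card S}"
    using h by (auto simp: bij_betw_def)
  have minimal: "\<not> generate G {x} \<subseteq> (\<Union>y\<in>S - {x}. generate G {y})" if "x \<in> S" for x
  proof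
    assume "generate G {x} \<subseteq> (\<Union>y\<in>S - {x}. generate G {y})"
    then have "P (S - {x})"
      using S that unfolding P_def by blast
    then show False
      using min[of "S - {x}"] card_Diff1_less[OF finS that] by linarith
  qed
  have "2 \<le> card S"
  proof (rule ccontr)
    assume "\<not> 2 \<le> card S"
    moreover have "S \<noteq> {}"
      using S one_closed unfolding P_def by auto
    ultimately have "card S = 1"
      using finS by (metis One_nat_def Suc_1 card_eq_0_iff less_2_cases not_le)
    then obtain x where x: "S = {x}"
      using card_1_singletonE by blast
    with S have "x \<in> carrier G" "generate G {x} = carrier G"
      unfolding P_def by auto
    then have "subgroup_generated G {x} = G"
      by (simp add: subgroup_generated_def)
    with \<open>x \<in> carrier G\<close> nc show False
      unfolding cyclic_group_def by blast
  qed
  moreover have "subgroup (generate G {h i}) G" if "i \<in> {1..card S}" for i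
    using that hS SC by (intro generate_is_subgroup) auto
  moreover have "(\<Union>i\<in>{1..card S}. generate G {h i}) = carrier G"
  proof -
    have "(\<Union>i\<in>{1..card S}. generate G {h i}) = (\<Union>x\<in>h ` {1..card S}. generate G {x})"
      by simp
    then show ?thesis
      using S unfolding hS P_def by simp
  qed
  moreover have "\<not> generate G {h i} \<subseteq> (\<Union>j\<in>{1..card S} - {i}. generate G {h j})"
    if i: "i \<in> {1..card S}" for i
  proof -
    have img: "h ` ({1..card S} - {i}) = S - {h i}"
      using hS hinj i inj_on_image_set_diff[of h "{1..card S}" "{1..card S}" "{i}"] by auto
    have "(\<Union>j\<in>{1..card S} - {i}. generate G {h j}) = (\<Union>y\<in>S - {h i}. generate G {y})"
      unfolding img[symmetric] by blast
    moreover have "h i \<in> S"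
      using i hS by blast
    ultimately show ?thesis
      using minimal[of "h i"] by simp
  qed
  ultimately have "irredundant_covering G (card S) (\<lambda>i. generate G {h i})"
    unfolding irredundant_covering_def by blast
  then show ?thesis by blast
qed

section \<open>Nilpotent groups\<close>

fun lower_central :: "('a, 'b) monoid_scheme \<Rightarrow> nat \<Rightarrow> 'a set" where
  "lower_central G 0 = carrier G"
| "lower_central G (Suc k) =
     generate G (\<Union>x\<in>lower_central G k. \<Union>y\<in>carrier G.
       {x \<otimes>\<^bsub>G\<^esub> y \<otimes>\<^bsub>G\<^esub> inv\<^bsub>G\<^esub> x \<otimes>\<^bsub>G\<^esub> inv\<^bsub>G\<^esub> y})"

definition nilpotent_group :: "('a, 'b) monoid_scheme \<Rightarrow> bool" where
  "nilpotent_group G \<longleftrightarrow> group G \<and> (\<exists>k. lower_central G k = {\<one>\<^bsub>G\<^esub>})"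

section \<open>Groups given by generators and relations\<close>

text \<open>The letter \<open>(x, False)\<close> is the generator \<open>x\<close>, the letter \<open>(x, True)\<close> its formal inverse.\<close>
type_synonym 'g gword = "('g \<times> bool) list"

definition gword_inv :: "'g gword \<Rightarrow> 'g gword" where
  "gword_inv w = rev (map (\<lambda>(x, s). (x, \<not> s)) w)"

definition gword_pow :: "'g gword \<Rightarrow> nat \<Rightarrow> 'g gword"  (infixr \<open>\<up>\<close> 80) where
  "w \<up> n = concat (replicate n w)"

definition gword_conj :: "'g gword \<Rightarrow> 'g gword \<Rightarrow> 'g gword" where
  "gword_conj u v = gword_inv v @ u @ v"

text \<open>A pair \<open>(u, v) \<in> R\<close> stands for the relation \<open>u = v\<close>. Two words are equivalent iff
  they represent the same element of the group presented by \<open>R\<close>.\<close>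
inductive gword_equiv :: "('g gword \<times> 'g gword) set \<Rightarrow> 'g gword \<Rightarrow> 'g gword \<Rightarrow> bool"
  for R where
  refl: "gword_equiv R w w"
| sym: "gword_equiv R u v \<Longrightarrow> gword_equiv R v u"
| trans: "gword_equiv R u v \<Longrightarrow> gword_equiv R v w \<Longrightarrow> gword_equiv R u w"
| cancel: "gword_equiv R (p @ [(x, s), (x, \<not> s)] @ q) (p @ q)"
| rel: "(u, v) \<in> R \<Longrightarrow> gword_equiv R (p @ u @ q) (p @ v @ q)"

definition gword_class :: "('g gword \<times> 'g gword) set \<Rightarrow> 'g gword \<Rightarrow> 'g gword set" where
  "gword_class R w = {v. gword_equiv R w v}"

definition presented_group :: "('g gword \<times> 'g gword) set \<Rightarrow> 'g gword set monoid" where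
  "presented_group R =
     \<lparr>carrier = range (gword_class R),
      monoid.mult = (\<lambda>A B. \<Union>u\<in>A. \<Union>v\<in>B. gword_class R (u @ v)),
      one = gword_class R []\<rparr>"

lemma gword_class_eq_iff: "gword_class R u = gword_class R v \<longleftrightarrow> gword_equiv R u v"
  unfolding gword_class_def by (blast intro: gword_equiv.intros)

lemma gword_equiv_append:
  assumes "gword_equiv R u u'" "gword_equiv R v v'"
  shows "gword_equiv R (u @ v) (u' @ v')"
proof -
  have ctxt: "gword_equiv R (p @ w @ q) (p @ w' @ q)" if "gword_equiv R w w'" for p q w w'
    using that
  proof (induction arbitrary: p q rule: gword_equiv.induct)
    case (cancel p' x s q')
    show ?case using gword_equiv.cancel[of R "p @ p'" x s "q' @ q"] by simp
  next
    case (rel u v p' q')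
    then show ?case using gword_equiv.rel[of u v R "p @ p'" "q' @ q"] by simp
  qed (blast intro: gword_equiv.intros)+
  show ?thesis
    using ctxt[OF assms(1), of "[]" v] ctxt[OF assms(2), of u' "[]"]
    by (auto intro: gword_equiv.trans)
qed

lemma gword_equiv_inv_left: "gword_equiv R (gword_inv w @ w) []"
proof (induction w)
  case Nil
  show ?case by (simp add: gword_inv_def gword_equiv.refl)
next
  case (Cons l w)
  obtain x s where l: "l = (x, s)" by (cases l)
  have "gword_equiv R (gword_inv w @ [(x, \<not> s), (x, \<not> \<not> s)] @ w) (gword_inv w @ w)"
    by (rule gword_equiv.cancel)
  with Cons.IH show ?case
    by (auto simp: l gword_inv_def intro: gword_equiv.trans)
qed

lemma presented_group_simps:
  shows presented_group_carrier: "carrier (presented_group R) = range (gword_class R)"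
    and presented_group_one: "\<one>\<^bsub>presented_group R\<^esub> = gword_class R []"
    and presented_group_mult:
      "gword_class R u \<otimes>\<^bsub>presented_group R\<^esub> gword_class R v = gword_class R (u @ v)"
proof -
  have "gword_class R (u' @ v') = gword_class R (u @ v)"
    if "u' \<in> gword_class R u" "v' \<in> gword_class R v" for u' v'
  proof -
    have "gword_equiv R u u'" "gword_equiv R v v'"
      using that by (simp_all add: gword_class_def)
    then show ?thesis
      by (metis gword_class_eq_iff gword_equiv_append)
  qed
  moreover have "u \<in> gword_class R u" "v \<in> gword_class R v"
    by (simp_all add: gword_class_def gword_equiv.refl)
  ultimately have
    "(\<Union>u'\<in>gword_class R u. \<Union>v'\<in>gword_class R v. gword_class R (u' @ v')) = gword_class R (u @ v)"
    by blast
  then show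
    "gword_class R u \<otimes>\<^bsub>presented_group R\<^esub> gword_class R v = gword_class R (u @ v)"
    by (simp add: presented_group_def)
qed (simp_all add: presented_group_def)

lemma group_presented_group: "group (presented_group R)"
proof (rule groupI)
  fix A assume "A \<in> carrier (presented_group R)"
  then obtain w where "A = gword_class R w"
    by (auto simp: presented_group_carrier)
  then show "\<exists>B\<in>carrier (presented_group R). B \<otimes>\<^bsub>presented_group R\<^esub> A = \<one>\<^bsub>presented_group R\<^esub>"
    by (auto simp: presented_group_simps gword_class_eq_iff
        intro!: bexI[of _ "gword_class R (gword_inv w)"] gword_equiv_inv_left)
qed (auto simp: presented_group_simps)

lemma presented_group_relation: "(u, v) \<in> R \<Longrightarrow> gword_class R u = gword_class R v"
  using gword_equiv.rel[of u v R "[]" "[]"] by (simp add: gword_class_eq_iff)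

fun gword_eval :: "('a, 'b) monoid_scheme \<Rightarrow> ('g \<Rightarrow> 'a) \<Rightarrow> 'g gword \<Rightarrow> 'a" where
  "gword_eval H f [] = \<one>\<^bsub>H\<^esub>"
| "gword_eval H f ((x, s) # w) = (if s then inv\<^bsub>H\<^esub> f x else f x) \<otimes>\<^bsub>H\<^esub> gword_eval H f w"

lemma (in group) gword_eval_closed:
  "range f \<subseteq> carrier G \<Longrightarrow> gword_eval G f w \<in> carrier G"
  by (induction w) (auto simp: image_subset_iff)

lemma (in group) gword_eval_append:
  "range f \<subseteq> carrier G \<Longrightarrow> gword_eval G f (u @ v) = gword_eval G f u \<otimes> gword_eval G f v"
  by (induction u) (auto simp: gword_eval_closed m_assoc image_subset_iff)

text \<open>Universal property of a presentation (von Dyck).\<close>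
lemma (in group) presented_group_universal:
  fixes f :: "'g \<Rightarrow> 'a"
  assumes f: "range f \<subseteq> carrier G"
    and rels: "\<And>u v. (u, v) \<in> R \<Longrightarrow> gword_eval G f u = gword_eval G f v"
  shows "\<exists>h\<in>hom (presented_group R) G. \<forall>w. h (gword_class R w) = gword_eval G f w"
proof -
  note ev = gword_eval_append[OF f] gword_eval_closed[OF f]
  have eq: "gword_eval G f u = gword_eval G f v" if "gword_equiv R u v" for u v
    using that
  proof induction
    case (cancel p x s q)
    have "f x \<in> carrier G" using f by auto
    then have "gword_eval G f ([(x, s), (x, \<not> s)] @ q) = gword_eval G f q"
      using ev(2)[of q] by (cases s) (simp_all add: m_assoc[symmetric])
    then show ?case by (simp add: ev)
  qed (simp_all add: ev rels)
  define h where "h A = gword_eval G f (SOME w. w \<in> A)" for A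
  have h: "h (gword_class R w) = gword_eval G f w" for w
  proof -
    have "w \<in> gword_class R w" by (simp add: gword_class_def gword_equiv.refl)
    then have "(SOME v. v \<in> gword_class R w) \<in> gword_class R w" by (rule someI)
    then show ?thesis unfolding h_def using eq by (metis gword_class_def mem_Collect_eq)
  qed
  then have "h \<in> hom (presented_group R) G"
    by (auto simp: hom_def presented_group_simps ev)
  with h show ?thesis by blast
qed

datatype gens_ab = Gen_a | Gen_b

definition wa :: "gens_ab gword" where "wa = [(Gen_a, False)]"
definition wb :: "gens_ab gword" where "wb = [(Gen_b, False)]"

end

theory Submission
  imports Defs "HOL-Algebra.Sylow" "HOL-Algebra.Multiplicative_Group"
begin

text \<open>
  For non-cyclic \<open>G\<close> the covering number counts the maximal cyclic subgroups, so \<open>G\<close> acts by conjugation on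
  a set of six points, and every element fixes a point containing it. The elements acting trivially normalise
  every cyclic subgroup, hence commute with all elements of coprime order. As \<open>G\<close> is not nilpotent, some
  element of odd prime power order moves a point; fixed point arguments leave only an orbit of prime size
  \<open>p \<in> {3, 5}\<close> with all other orbits of size at most 2. On this orbit \<open>G\<close> acts as a Frobenius group whose
  point stabilisers are the points themselves and whose kernel is central. This gives
  \<open>G = \<langle>a\<rangle>\<langle>b\<rangle>\<close> with \<open>a\<close> of order \<open>p\<close>, \<open>\<langle>a\<rangle>\<close> normal and \<open>\<langle>b\<rangle>\<close> a point of the orbit. Counting the
  \<open>6 - p\<close> remaining maximal cyclic subgroups restricts the power of \<open>p\<close> dividing the order of \<open>b\<close>: for
  \<open>p = 5\<close> it is \<open>1\<close>, and for \<open>p = 3\<close> it is \<open>3\<close>.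
\<close>

section \<open>Finite group actions\<close>

text \<open>The Frobenius action is a matter of arithmetic: numbering the orbit by the powers of a
  rotating element \<open>y\<close> turns it into the residues modulo \<open>p\<close>, point
  stabilisers become multiplications, and a map \<open>k \<mapsto> r k + n\<close> with
  \<open>r\<close> not congruent to 1 always has a fixed point. The kernel is central because its
  elements lie in every point of the orbit, hence commute with each of these cyclic subgroups, and
  these together generate \<open>G\<close>.

  The conjugate of \<open>y\<close> by \<open>b\<close> is a power of \<open>y\<close> only up to a
  central factor, which need not vanish. The generator \<open>a\<close> is therefore not
  \<open>y\<close> but a power of the commutator of \<open>y\<close> and \<open>b\<close>, which
  absorbs that factor.

  For \<open>p = 3\<close> the order of \<open>b\<close> is \<open>6 n\<close> with 3 not dividing
  \<open>n\<close>. This allows a \<open>k\<close> divisible by 3 and congruent to 1 modulo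
  \<open>n\<close>, and with it the change of generators from \<open>a^3 = 1\<close> to
  \<open>a^3 = b^6\<close>; the residue of \<open>n\<close> modulo 3 then selects the exponent
  \<open>n + 1\<close> or \<open>2 n + 1\<close>.\<close>

locale finite_action = group G for G (structure) +
  fixes act :: "'a \<Rightarrow> 'x \<Rightarrow> 'x" and E :: "'x set"
  assumes finite_carrier: "finite (carrier G)"
    and finite_E: "finite E"
    and act_closed [simp]: "g \<in> carrier G \<Longrightarrow> x \<in> E \<Longrightarrow> act g x \<in> E"
    and act_one [simp]: "x \<in> E \<Longrightarrow> act \<one> x = x"
    and act_mult: "g \<in> carrier G \<Longrightarrow> h \<in> carrier G \<Longrightarrow> x \<in> E \<Longrightarrow> act (g \<otimes> h) x = act g (act h x)"
begin

definition orb :: "'x \<Rightarrow> 'x set" where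
  "orb x = (\<lambda>g. act g x) ` carrier G"

definition stab :: "'x \<Rightarrow> 'a set" where
  "stab x = {g \<in> carrier G. act g x = x}"

lemma act_inv [simp]:
  assumes "g \<in> carrier G" "x \<in> E"
  shows "act (inv g) (act g x) = x" "act g (act (inv g) x) = x"
  using assms act_mult[of "inv g" g x] act_mult[of g "inv g" x] by auto

lemma act_inj: "g \<in> carrier G \<Longrightarrow> x \<in> E \<Longrightarrow> y \<in> E \<Longrightarrow> act g x = act g y \<longleftrightarrow> x = y"
  by (metis act_inv(1))

lemma orb_subset: "x \<in> E \<Longrightarrow> orb x \<subseteq> E"
  by (auto simp: orb_def)

lemma finite_orb [simp]: "finite (orb x)"
  using finite_carrier by (simp add: orb_def)

lemma orb_refl [simp]: "x \<in> E \<Longrightarrow> x \<in> orb x"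
  unfolding orb_def by (metis act_one image_eqI one_closed)

lemma orb_act: "x \<in> E \<Longrightarrow> g \<in> carrier G \<Longrightarrow> z \<in> orb x \<Longrightarrow> act g z \<in> orb x"
  unfolding orb_def by (auto simp: act_mult[symmetric])

lemma orb_eq:
  assumes "x \<in> E" "z \<in> orb x"
  shows "orb z = orb x"
proof -
  obtain g where g: "g \<in> carrier G" "z = act g x"
    using assms by (auto simp: orb_def)
  then have "x = act (inv g) z" using assms by simp
  moreover have "z \<in> E" using g assms by simp
  moreover have "x \<in> orb z" using calculation orb_act[of z "inv g" z] g by simp
  ultimately show ?thesis
    using assms unfolding orb_def by (auto simp: act_mult[symmetric] image_iff; metis act_mult m_closed)
qed

lemma orb_disjoint: "x \<in> E \<Longrightarrow> y \<in> E \<Longrightarrow> orb x \<noteq> orb y \<Longrightarrow> orb x \<inter> orb y = {}"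
  using orb_eq by blast

lemma stab_subgroup: "x \<in> E \<Longrightarrow> subgroup (stab x) G"
  by (rule subgroupI) (auto simp: stab_def act_mult intro: exI[of _ \<one>], metis act_inv(1))

lemma orb_stab:
  assumes x: "x \<in> E"
  shows "card (orb x) * card (stab x) = card (carrier G)"
proof -
  have "card {g \<in> carrier G. act g x = y} = card (stab x)" if "y \<in> orb x" for y
  proof -
    obtain h where h: "h \<in> carrier G" "y = act h x"
      using \<open>y \<in> orb x\<close> unfolding orb_def by blast
    have "{g \<in> carrier G. act g x = y} = (\<lambda>s. h \<otimes> s) ` stab x"
    proof (intro Set.set_eqI iffI)
      fix g assume "g \<in> {g \<in> carrier G. act g x = y}"
      then have "g \<in> carrier G" "act g x = act h x" using h by auto
      then have "inv h \<otimes> g \<in> stab x" "g = h \<otimes> (inv h \<otimes> g)"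
        using h x by (auto simp: stab_def act_mult m_assoc[symmetric])
      then show "g \<in> (\<lambda>s. h \<otimes> s) ` stab x" by blast
    qed (use h x in \<open>auto simp: stab_def act_mult\<close>)
    moreover have "inj_on (\<lambda>s. h \<otimes> s) (stab x)"
      using h by (auto simp: inj_on_def stab_def)
    ultimately show ?thesis by (simp add: card_image)
  qed
  then have "(\<Sum>y\<in>orb x. card {g \<in> carrier G. act g x = y}) = card (orb x) * card (stab x)"
    by simp
  moreover have "card (carrier G) = (\<Sum>y\<in>orb x. card {g \<in> carrier G. act g x = y})"
    using sum.image_gen[OF finite_carrier, of "\<lambda>_. 1::nat" "\<lambda>g. act g x"]
    by (simp add: orb_def)
  ultimately show ?thesis by simp
qed

text \<open>Jordan's counting argument: the stabilisers of the points of an orbit have equal order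
  and share \<open>\<one>\<close>, so for an orbit of length k they contain at most
  \<open>|G| - k\<close> non-trivial elements, fewer than the \<open>|G| - 1\<close> that exist once
  k is at least 2.\<close>

lemma ex_fixed_point_free:
  assumes x: "x \<in> E" and two: "2 \<le> card (orb x)"
  shows "\<exists>g\<in>carrier G. \<forall>z\<in>orb x. act g z \<noteq> z"
proof (rule ccontr)
  assume "\<not> ?thesis"
  then have cov: "carrier G - {\<one>} \<subseteq> (\<Union>z\<in>orb x. stab z - {\<one>})"
    by (auto simp: stab_def)
  let ?k = "card (orb x)" and ?s = "card (stab x)"
  have st: "card (stab z) = ?s" if "z \<in> orb x" for z
  proof -
    have z: "z \<in> E" using orb_subset[OF x] that by blast
    have "?k * card (stab z) = ?k * ?s"
      using orb_stab[OF z] orb_stab[OF x] orb_eq[OF x that] by simp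
    then show ?thesis using two by (cases "orb x = {}") auto
  qed
  have fins: "finite (stab z)" for z
    using finite_carrier by (simp add: stab_def)
  have one: "\<one> \<in> stab z" if "z \<in> orb x" for z
    using that orb_subset[OF x] by (auto simp: stab_def)
  have "card (carrier G) - 1 = card (carrier G - {\<one>})"
    using finite_carrier by simp
  also have "\<dots> \<le> card (\<Union>z\<in>orb x. stab z - {\<one>})"
    using cov fins by (intro card_mono) auto
  also have "\<dots> \<le> (\<Sum>z\<in>orb x. card (stab z - {\<one>}))"
    by (rule card_UN_le) simp
  also have "\<dots> = ?k * (?s - 1)"
    using st one fins by simp
  finally have "?k * ?s - 1 \<le> ?k * ?s - ?k"
    using orb_stab[OF x] by (simp add: diff_mult_distrib2)
  moreover have "?s \<ge> 1"
    using one[of x] x fins[of x] by (metis One_nat_def Suc_leI card_gt_0_iff empty_iff orb_refl)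
  then have "?k * ?s \<ge> ?k" by simp
  ultimately show False using two by linarith
qed

text \<open>Here \<open>d\<close> is the length of the cycle of \<open>x\<close> under
  \<open>g\<close>. The formulation by residues of exponents lets later proofs decide equality of
  points by arithmetic.\<close>

lemma period:
  assumes g: "g \<in> carrier G" and x: "x \<in> E"
  obtains d :: nat where "0 < d" "\<And>i j. act (g [^] i) x = act (g [^] j) x \<longleftrightarrow> i mod d = j mod d"
    "card ((\<lambda>i::nat. act (g [^] i) x) ` UNIV) = d" "d dvd ord g"
proof -
  define f where "f n = act (g [^] (n::nat)) x" for n
  have f_add: "f (i + n) = act (g [^] i) (f n)" for i n
    using g x by (simp add: f_def act_mult[symmetric] nat_pow_mult)
  have fE: "f n \<in> E" for n using g x by (simp add: f_def)
  have f0: "f 0 = x" using x by (simp add: f_def)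
  have ex: "\<exists>d>0. f d = x"
    using g x finite_carrier pow_ord_eq_1[OF g] ord_ge_1[OF finite_carrier g] by (intro exI[of _ "ord g"]) (auto simp: f_def)
  define d where "d = (LEAST d. 0 < d \<and> f d = x)"
  have d: "0 < d" "f d = x"
    using LeastI_ex[OF ex] by (simp_all add: d_def)
  have least: "d \<le> e" if "0 < e" "f e = x" for e
    unfolding d_def by (rule Least_le) (use that in simp)
  have per: "f (i + d) = f i" for i
    using f_add[of i d] d f0 f_add[of i 0] by simp
  have per': "f (i + d * k) = f i" for i k
  proof (induction k)
    case (Suc k)
    then show ?case using per[of "i + d * k"] by (simp add: ac_simps)
  qed simp
  have fmod: "f i = f (i mod d)" for i
    using per'[of "i mod d" "i div d"] by simp
  have inj: "i = j" if "f i = f j" "i \<le> j" "j < d" for i j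
  proof (rule ccontr)
    assume "i \<noteq> j"
    have "act (g [^] i) (f (j - i)) = act (g [^] i) (f 0)"
      using f_add[of i "j - i"] f_add[of i 0] that by simp
    then have "f (j - i) = x"
      using act_inj[of "g [^] i" "f (j - i)" "f 0"] fE f0 g x by simp
    then show False using least[of "j - i"] that \<open>i \<noteq> j\<close> by linarith
  qed
  have eq: "f i = f j \<longleftrightarrow> i mod d = j mod d" for i j
  proof
    assume "f i = f j"
    then have "f (i mod d) = f (j mod d)" using fmod by metis
    then show "i mod d = j mod d"
      using inj[of "i mod d" "j mod d"] inj[of "j mod d" "i mod d"] d
      by (metis mod_less_divisor nat_le_linear)
  qed (metis fmod)
  have "f ` UNIV = f ` {..<d}"
    using d fmod by (auto simp: image_iff) (metis lessThan_iff mod_less_divisor)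
  moreover have "inj_on f {..<d}"
    using eq by (auto simp: inj_on_def)
  ultimately have "card (f ` UNIV) = d" by (simp add: card_image)
  moreover have "d dvd ord g"
    using eq[of "ord g" 0] f0 g x by (auto simp: f_def)
  ultimately show ?thesis
    using that[of d] d eq unfolding f_def by blast
qed

text \<open>The cycle of \<open>x\<close> has a power of \<open>p\<close> as its length and fits
  into \<open>X\<close>, which has fewer than \<open>p\<close> points.\<close>

lemma prime_power_elt_fixes_small:
  fixes p :: nat
  assumes g: "g \<in> carrier G" "prime p" "g [^] (p ^ e) = \<one>"
    and X: "X \<subseteq> E" "\<And>z. z \<in> X \<Longrightarrow> act g z \<in> X" "card X < p" "x \<in> X"
  shows "act g x = x"
proof -
  have xE: "x \<in> E" using X by blast
  obtain d :: nat where d: "0 < d" "\<And>i j. act (g [^] i) x = act (g [^] j) x \<longleftrightarrow> i mod d = j mod d"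
    "card ((\<lambda>i::nat. act (g [^] i) x) ` UNIV) = d" "d dvd ord g"
    by (rule period[OF g(1) xE]) (rule that)
  have inX: "act (g [^] i) x \<in> X" for i :: nat
  proof (induction i)
    case (Suc i)
    have "act (g [^] Suc i) x = act g (act (g [^] i) x)"
      using g xE act_mult[of g "g [^] i" x] nat_pow_Suc2[OF g(1), of i] by simp
    then show ?case using Suc X(2) by simp
  qed (use xE X in simp)
  have "d \<le> card X"
    unfolding d(3)[symmetric]
    by (rule card_mono) (use inX X(1) finite_E finite_subset in auto)
  have "d dvd p ^ e"
    using d(4) pow_eq_id[OF g(1), of "p ^ e"] g(3) dvd_trans by blast
  then obtain j where j: "d = p ^ j"
    using divides_primepow_nat[OF g(2)] by blast
  have "j = 0"
  proof (rule ccontr)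
    assume "j \<noteq> 0"
    then have "p \<le> d" using j d(1) by (simp add: dvd_imp_le)
    with \<open>d \<le> card X\<close> X(3) show False by simp
  qed
  then have "d = 1" using j by simp
  then show ?thesis using d(2)[of 1 0] g xE by simp
qed

text \<open>Orbits of non-fixed points have length divisible by \<open>p\<close>, hence so does the
  set of fixed points; since it contains \<open>x\<close>, it has at least \<open>p\<close>
  elements.\<close>

lemma p_group_second_fixed_point:
  fixes p :: nat
  assumes p: "prime p" "card (carrier G) = p ^ e"
    and dv: "p dvd card E" and x: "x \<in> E" "\<And>g. g \<in> carrier G \<Longrightarrow> act g x = x"
  obtains y where "y \<in> E" "y \<noteq> x" "\<And>g. g \<in> carrier G \<Longrightarrow> act g y = y"
proof -
  define F where "F = {y \<in> E. \<forall>g\<in>carrier G. act g y = y}"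
  have "p dvd card (\<Union> (orb ` (E - F)))"
  proof (rule dvd_partition)
    show "finite (\<Union> (orb ` (E - F)))" using finite_E by auto
    show "\<forall>c\<in>orb ` (E - F). p dvd card c"
    proof
      fix c assume "c \<in> orb ` (E - F)"
      then obtain y where y: "y \<in> E" "y \<notin> F" "c = orb y" by auto
      have "card c dvd p ^ e"
        using orb_stab[OF y(1)] p y by (metis dvd_triv_left)
      moreover have "card c \<noteq> 1"
      proof
        assume "card c = 1"
        then have "orb y = {y}" using y orb_refl[OF y(1)] by (metis card_1_singletonE singletonD)
        then have "y \<in> F" using y(1) by (auto simp: F_def orb_def)
        with y show False by simp
      qed
      ultimately show "p dvd card c"
        using divides_primepow_nat[OF p(1)] by (metis dvd_power gr0I power_0)
    qed
    show "\<forall>c1\<in>orb ` (E - F). \<forall>c2\<in>orb ` (E - F). c1 \<noteq> c2 \<longrightarrow> c1 \<inter> c2 = {}"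
      using orb_disjoint by auto
  qed
  moreover have "\<Union> (orb ` (E - F)) = E - F"
  proof
    show "\<Union> (orb ` (E - F)) \<subseteq> E - F"
    proof
      fix z assume "z \<in> \<Union> (orb ` (E - F))"
      then obtain y where y: "y \<in> E" "y \<notin> F" "z \<in> orb y" by auto
      then have "z \<in> E" "orb z = orb y" using orb_subset[OF y(1)] orb_eq[OF y(1) y(3)] by auto
      moreover have "z \<notin> F"
      proof
        assume "z \<in> F"
        then have "orb z = {z}" by (auto simp: F_def orb_def)
        then have "y = z" using calculation orb_refl[OF y(1)] by simp
        with \<open>z \<in> F\<close> y show False by simp
      qed
      ultimately show "z \<in> E - F" by simp
    qed
  qed auto
  ultimately have "p dvd card (E - F)" by simp
  moreover have "card E = card F + card (E - F)"
    using finite_E card_Int_Diff[of E F] by (simp add: F_def Int_def conj_ac)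
  ultimately have "p dvd card F"
    using dv by (metis dvd_add_left_iff)
  moreover have "finite F" "x \<in> F" using x finite_E by (auto simp: F_def)
  ultimately have "card F \<noteq> 1" "card F \<noteq> 0"
    using p(1) not_prime_unit by (auto simp: card_gt_0_iff)
  then have "F \<noteq> {x}" by auto
  then obtain y where "y \<in> F" "y \<noteq> x" using \<open>x \<in> F\<close> by blast
  then show ?thesis using that unfolding F_def by blast
qed

end

section \<open>A criterion for nilpotency\<close>

text \<open>Conjugation is written as \<open>g h (inv g)\<close>, opposite to the convention for
  \<open>a^b\<close>, so that it is a left action. The relation of the presentations therefore
  appears below as conjugation by \<open>inv b\<close>.\<close>

definition conj_set :: "('a, 'b) monoid_scheme \<Rightarrow> 'a \<Rightarrow> 'a set \<Rightarrow> 'a set" where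
  "conj_set G g S = (\<lambda>h. g \<otimes>\<^bsub>G\<^esub> h \<otimes>\<^bsub>G\<^esub> inv\<^bsub>G\<^esub> g) ` S"

abbreviation commutator :: "('a, 'b) monoid_scheme \<Rightarrow> 'a \<Rightarrow> 'a \<Rightarrow> 'a" where
  "commutator G x y \<equiv> x \<otimes>\<^bsub>G\<^esub> y \<otimes>\<^bsub>G\<^esub> inv\<^bsub>G\<^esub> x \<otimes>\<^bsub>G\<^esub> inv\<^bsub>G\<^esub> y"

context group
begin

lemma conj_set_one: "S \<subseteq> carrier G \<Longrightarrow> conj_set G \<one> S = S"
  by (force simp: conj_set_def subset_iff image_iff)

lemma conj_set_mult:
  assumes "g \<in> carrier G" "h \<in> carrier G" "S \<subseteq> carrier G"
  shows "conj_set G (g \<otimes> h) S = conj_set G g (conj_set G h S)"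
  unfolding conj_set_def image_image
  by (rule image_cong) (use assms in \<open>auto simp: m_assoc inv_mult_group subset_iff\<close>)

lemma conj_cancel:
  assumes "g \<in> carrier G" "h \<in> carrier G"
  shows "inv g \<otimes> (g \<otimes> h \<otimes> inv g) \<otimes> g = h" "g \<otimes> (inv g \<otimes> h \<otimes> g) \<otimes> inv g = h"
  using assms by (simp_all add: m_assoc) (simp_all add: m_assoc[symmetric])

end

context group
begin

lemma inv_cancel:
  assumes "x \<in> carrier G" "y \<in> carrier G"
  shows "inv x \<otimes> (x \<otimes> y) = y" "x \<otimes> (inv x \<otimes> y) = y"
  using assms by (simp_all add: m_assoc[symmetric])

lemmas group_normalize = m_assoc inv_mult_group inv_cancel

lemma card_subgroup_dvd:
  assumes fin: "finite (carrier G)" and H: "subgroup H G" and P: "subgroup P G" "P \<subseteq> H"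
  shows "card P dvd card H"
proof -
  have "card (rcosets\<^bsub>G\<lparr>carrier := H\<rparr>\<^esub> P) * card P = order (G\<lparr>carrier := H\<rparr>)"
    by (rule group.lagrange[OF subgroup.subgroup_is_group[OF H is_group] subgroup_incl[OF P(1) H P(2)]])
  then show ?thesis by (simp add: order_def) (metis dvd_triv_right)
qed

text \<open>Each Sylow order divides \<open>card H\<close>, so comparing multiplicities prime by
  prime shows that \<open>card (carrier G)\<close> divides \<open>card H\<close>.\<close>

lemma subgroup_eq_carrier_if_sylow:
  assumes fin: "finite (carrier G)" and H: "subgroup H G"
    and sylow: "\<And>p a r :: nat. prime p \<Longrightarrow> card (carrier G) = p ^ a * r \<Longrightarrow> \<not> p dvd r
      \<Longrightarrow> \<exists>P. subgroup P G \<and> card P = p ^ a \<and> P \<subseteq> H"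
  shows "H = carrier G"
proof -
  have pos: "card (carrier G) \<noteq> 0"
    using fin by auto
  have finH: "finite H" "H \<subseteq> carrier G"
    using subgroup.subset[OF H] fin finite_subset by auto
  then have posH: "card H \<noteq> 0"
    using subgroup.one_closed[OF H] by auto
  have "card (carrier G) dvd card H"
  proof (rule multiplicity_le_imp_dvd[OF pos])
    fix p :: nat assume p: "prime p"
    then obtain r where r: "card (carrier G) = p ^ multiplicity p (card (carrier G)) * r" "\<not> p dvd r"
      using multiplicity_decompose'[OF pos, of p] not_prime_unit by blast
    then obtain P where P: "subgroup P G" "card P = p ^ multiplicity p (card (carrier G))" "P \<subseteq> H"
      using sylow[OF p r] by auto
    then have "card P dvd card H" using card_subgroup_dvd[OF fin H] by blast
    then show "multiplicity p (card (carrier G)) \<le> multiplicity p (card H)"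
      using P(2) p posH by (metis multiplicity_geI not_prime_unit prime_def)
  qed
  then have "card (carrier G) \<le> card H"
    using posH by (simp add: dvd_imp_le)
  then show ?thesis
    using card_seteq[OF fin finH(2)] by simp
qed

text \<open>This is the preimage of the centraliser of \<open>xN\<close> in \<open>G/N\<close>,
  described without forming the quotient. Closure comes from the identity
  \<open>[x, gh] = [x, g] (g [x, h] (inv g))\<close>.\<close>

lemma commutator_stable_subgroup:
  assumes N: "N \<lhd> G" and x: "x \<in> carrier G"
  shows "subgroup {g \<in> carrier G. commutator G x g \<in> N} G"
proof (rule subgroupI)
  interpret N: normal N G by fact
  show "{g \<in> carrier G. commutator G x g \<in> N} \<noteq> {}"
    using x by (auto intro!: exI[of _ \<one>])
  fix g assume g: "g \<in> {g \<in> carrier G. commutator G x g \<in> N}"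
  then have "inv g \<otimes> inv (commutator G x g) \<otimes> g \<in> N"
    using N.inv_op_closed1 by auto
  moreover have "inv g \<otimes> inv (commutator G x g) \<otimes> g = commutator G x (inv g)"
    using g x by (simp add: group_normalize)
  ultimately show "inv g \<in> {g \<in> carrier G. commutator G x g \<in> N}"
    using g by simp
  fix h assume h: "h \<in> {g \<in> carrier G. commutator G x g \<in> N}"
  then have "commutator G x g \<otimes> (g \<otimes> commutator G x h \<otimes> inv g) \<in> N"
    using N.inv_op_closed2 g by auto
  moreover have "commutator G x g \<otimes> (g \<otimes> commutator G x h \<otimes> inv g) = commutator G x (g \<otimes> h)"
    using g h x by (simp add: group_normalize)
  ultimately show "g \<otimes> h \<in> {g \<in> carrier G. commutator G x g \<in> N}"
    using g h by simp
qed auto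

lemma conj_set_lcoset:
  assumes N: "N \<lhd> G" and "g \<in> carrier G" "x \<in> carrier G"
  shows "conj_set G g (x <# N) = (g \<otimes> x \<otimes> inv g) <# N"
proof -
  interpret N: normal N G by fact
  show ?thesis
  proof
    show "conj_set G g (x <# N) \<subseteq> (g \<otimes> x \<otimes> inv g) <# N"
    proof
      fix y assume "y \<in> conj_set G g (x <# N)"
      then obtain n where n: "n \<in> N" "y = g \<otimes> (x \<otimes> n) \<otimes> inv g"
        by (auto simp: conj_set_def l_coset_def)
      then have "y = (g \<otimes> x \<otimes> inv g) \<otimes> (g \<otimes> n \<otimes> inv g)" "g \<otimes> n \<otimes> inv g \<in> N"
        using assms N.inv_op_closed2[of g n] by (simp_all add: group_normalize)
      then show "y \<in> (g \<otimes> x \<otimes> inv g) <# N"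
        unfolding l_coset_def by blast
    qed
    show "(g \<otimes> x \<otimes> inv g) <# N \<subseteq> conj_set G g (x <# N)"
    proof
      fix y assume "y \<in> (g \<otimes> x \<otimes> inv g) <# N"
      then obtain n where n: "n \<in> N" "y = (g \<otimes> x \<otimes> inv g) \<otimes> n"
        by (auto simp: l_coset_def)
      then have "y = g \<otimes> (x \<otimes> (inv g \<otimes> n \<otimes> g)) \<otimes> inv g" "inv g \<otimes> n \<otimes> g \<in> N"
        using assms N.inv_op_closed1[of g n] by (simp_all add: group_normalize)
      then show "y \<in> conj_set G g (x <# N)"
        unfolding conj_set_def l_coset_def by blast
    qed
  qed
qed

lemma lcoset_eq_iff:
  assumes N: "subgroup N G" and "x \<in> carrier G" "y \<in> carrier G"
  shows "x <# N = y <# N \<longleftrightarrow> inv x \<otimes> y \<in> N"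
proof
  interpret N: subgroup N G by fact
  assume "x <# N = y <# N"
  moreover have "y \<in> y <# N"
    using assms by (auto simp: l_coset_def intro!: bexI[of _ \<one>])
  ultimately obtain n where "n \<in> N" "y = x \<otimes> n" by (auto simp: l_coset_def)
  then show "inv x \<otimes> y \<in> N" using assms by (simp add: inv_cancel)
next
  interpret N: subgroup N G by fact
  assume n: "inv x \<otimes> y \<in> N"
  show "x <# N = y <# N"
  proof
    show "x <# N \<subseteq> y <# N"
    proof
      fix z assume "z \<in> x <# N"
      then obtain m where "m \<in> N" "z = x \<otimes> m" by (auto simp: l_coset_def)
      then have "z = y \<otimes> (inv (inv x \<otimes> y) \<otimes> m)" "inv (inv x \<otimes> y) \<otimes> m \<in> N"
        using assms n by (simp_all add: group_normalize del: inv_mult_group) (simp add: group_normalize)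
      then show "z \<in> y <# N" by (auto simp: l_coset_def)
    qed
    show "y <# N \<subseteq> x <# N"
    proof
      fix z assume "z \<in> y <# N"
      then obtain m where "m \<in> N" "z = y \<otimes> m" by (auto simp: l_coset_def)
      then have "z = x \<otimes> ((inv x \<otimes> y) \<otimes> m)" "(inv x \<otimes> y) \<otimes> m \<in> N"
        using assms n N.m_closed[OF n, of m] by (simp_all add: group_normalize)
      then show "z \<in> x <# N" by (auto simp: l_coset_def)
    qed
  qed
qed

text \<open>For finite groups this is equivalent to nilpotency; its failure is the form in which
  non-nilpotency is used below.\<close>

definition coprime_elements_commute :: bool where
  "coprime_elements_commute \<longleftrightarrow>
    (\<forall>p q a b. \<forall>x\<in>carrier G. \<forall>y\<in>carrier G. prime p \<longrightarrow> prime q \<longrightarrow> p \<noteq> q \<longrightarrow>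
      x [^] (p ^ a :: nat) = \<one> \<longrightarrow> y [^] (q ^ b :: nat) = \<one> \<longrightarrow> x \<otimes> y = y \<otimes> x)"

lemma subgroup_pow_card:
  assumes fin: "finite (carrier G)" and "subgroup P G" "x \<in> P"
  shows "x [^] card P = \<one>"
proof -
  have g: "group (G\<lparr>carrier := P\<rparr>)" using assms subgroup.subgroup_is_group is_group by blast
  have "finite P" using assms subgroup.subset finite_subset by metis
  then have "x [^]\<^bsub>G\<lparr>carrier := P\<rparr>\<^esub> card P = \<one>"
    using group.pow_order_eq_1[OF g, of x] assms by (simp add: order_def)
  then show ?thesis by (simp add: nat_pow_def)
qed

text \<open>A non-trivial central element of \<open>G/N\<close>. Take a prime \<open>p\<close> with
  a Sylow subgroup \<open>P\<close> not inside \<open>N\<close>. Acting by conjugation on the cosets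
  in \<open>PN/N\<close>, the \<open>p\<close>-group \<open>P\<close> fixes \<open>N\<close> and
  therefore a second coset \<open>xN\<close> with \<open>x\<close> in \<open>P\<close>. So
  \<open>x\<close> commutes with \<open>P\<close> modulo \<open>N\<close>, and with a Sylow subgroup
  for every other prime because it lies in \<open>P\<close>.\<close>

lemma ex_central_mod_normal:
  assumes fin: "finite (carrier G)" and comm: coprime_elements_commute
    and N: "N \<lhd> G" "N \<noteq> carrier G"
  shows "\<exists>x\<in>carrier G - N. \<forall>g\<in>carrier G. commutator G x g \<in> N"
proof -
  interpret N: normal N G by fact
  obtain p a r :: nat where p: "prime p" "card (carrier G) = p ^ a * r" "\<not> p dvd r"
    and no: "\<not> (\<exists>P. subgroup P G \<and> card P = p ^ a \<and> P \<subseteq> N)"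
    using subgroup_eq_carrier_if_sylow[OF fin N.is_subgroup] N(2) by blast
  obtain P where P: "subgroup P G" "card P = p ^ a"
    using sylow_thm[OF p(1) is_group _ fin] p(2) by (auto simp: order_def)
  interpret P: subgroup P G by fact
  have finP: "finite P" using P.subset fin finite_subset by blast
  have PG: "x \<in> P \<Longrightarrow> x \<in> carrier G" for x using P.subset by blast
  obtain x0 where x0: "x0 \<in> P" "x0 \<notin> N" using no P by blast
  define E where "E = (\<lambda>x. x <# N) ` P"
  have finE: "finite E" using finP by (simp add: E_def)
  have one_N: "\<one> <# N = N" using N.subset lcos_mult_one by blast
  have NE: "N \<in> E" unfolding E_def using one_N by (metis P.one_closed image_eqI)
  have grpP: "group (G\<lparr>carrier := P\<rparr>)"
    using P subgroup.subgroup_is_group is_group by blast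
  \<comment> \<open>Left multiplication is transitive on \<open>E\<close>; this action is there to
    show that \<open>card E\<close> is a power of \<open>p\<close>.\<close>
  interpret L: finite_action "G\<lparr>carrier := P\<rparr>" "l_coset G" E
  proof (intro finite_action.intro finite_action_axioms.intro grpP)
    show "g <# C \<in> E" if "g \<in> carrier (G\<lparr>carrier := P\<rparr>)" "C \<in> E" for g C
      using that PG N.subset by (auto simp: E_def lcos_m_assoc)
    show "\<one>\<^bsub>G\<lparr>carrier := P\<rparr>\<^esub> <# C = C" if "C \<in> E" for C
      using that PG N.subset by (auto simp: E_def lcos_m_assoc)
    show "(g \<otimes>\<^bsub>G\<lparr>carrier := P\<rparr>\<^esub> h) <# C = g <# (h <# C)"
      if "g \<in> carrier (G\<lparr>carrier := P\<rparr>)" "h \<in> carrier (G\<lparr>carrier := P\<rparr>)" "C \<in> E" for g h C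
      using that PG N.subset by (auto simp: E_def lcos_m_assoc m_assoc)
  qed (use finP finE in simp_all)
  have "L.orb N = E"
    by (simp add: L.orb_def E_def)
  then have "card E dvd p ^ a"
    using L.orb_stab[OF NE] P(2) by (metis dvd_triv_left partial_object.select_convs(1) partial_object.surjective partial_object.update_convs(1))
  moreover have "card E \<noteq> 1"
  proof
    assume "card E = 1"
    then have "x0 <# N = N" using NE x0(1) by (metis E_def card_1_singletonE imageI singletonD)
    then have "\<one> <# N = x0 <# N" using one_N by simp
    then have "inv \<one> \<otimes> x0 \<in> N"
      using lcoset_eq_iff[OF N.is_subgroup, of \<one> x0] PG[OF x0(1)] by simp
    then show False using x0 PG[OF x0(1)] by simp
  qed
  ultimately have "p dvd card E"
    using divides_primepow_nat[OF p(1), of "card E" a] by (metis dvd_power gr0I power_0)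
  \<comment> \<open>The same cosets under conjugation, where \<open>N\<close> is a fixed
    point.\<close>
  interpret C: finite_action "G\<lparr>carrier := P\<rparr>" "conj_set G" E
  proof (intro finite_action.intro finite_action_axioms.intro grpP)
    have sub: "C \<subseteq> carrier G" if "C \<in> E" for C
      using that PG l_coset_subset_G[OF N.subset] unfolding E_def by blast
    show "conj_set G g C \<in> E" if "g \<in> carrier (G\<lparr>carrier := P\<rparr>)" "C \<in> E" for g C
      using that PG by (auto simp: E_def conj_set_lcoset[OF N(1)])
    show "conj_set G \<one>\<^bsub>G\<lparr>carrier := P\<rparr>\<^esub> C = C" if "C \<in> E" for C
      using sub[OF that] by (simp add: conj_set_one)
    show "conj_set G (g \<otimes>\<^bsub>G\<lparr>carrier := P\<rparr>\<^esub> h) C = conj_set G g (conj_set G h C)"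
      if "g \<in> carrier (G\<lparr>carrier := P\<rparr>)" "h \<in> carrier (G\<lparr>carrier := P\<rparr>)" "C \<in> E" for g h C
      using that PG sub by (simp add: conj_set_mult)
  qed (use finP finE in simp_all)
  have fixN: "conj_set G g N = N" if "g \<in> carrier (G\<lparr>carrier := P\<rparr>)" for g
    using conj_set_lcoset[OF N(1), of g \<one>] that PG one_N by simp
  obtain D where D: "D \<in> E" "D \<noteq> N" "\<And>g. g \<in> P \<Longrightarrow> conj_set G g D = D"
    using C.p_group_second_fixed_point[OF p(1) _ \<open>p dvd card E\<close> NE fixN, of a] P(2) by auto
  then obtain x where x: "x \<in> P" "D = x <# N" by (auto simp: E_def)
  have xG: "x \<in> carrier G" using x PG by blast
  have "x \<notin> N"
    using D(2) x lcoset_eq_iff[OF N.is_subgroup, of x \<one>] one_N xG by auto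
  let ?C = "{g \<in> carrier G. commutator G x g \<in> N}"
  have "P \<subseteq> ?C"
  proof
    fix g assume g: "g \<in> P"
    then have gG: "g \<in> carrier G" by (rule PG)
    have "x <# N = (g \<otimes> x \<otimes> inv g) <# N"
      using D(3)[OF g] conj_set_lcoset[OF N(1) gG xG] x by simp
    then have "inv x \<otimes> (g \<otimes> x \<otimes> inv g) \<in> N"
      using lcoset_eq_iff[OF N.is_subgroup xG] gG xG by simp
    then have "x \<otimes> inv (inv x \<otimes> (g \<otimes> x \<otimes> inv g)) \<otimes> inv x \<in> N"
      using N.inv_op_closed2[OF xG] by auto
    moreover have "x \<otimes> inv (inv x \<otimes> (g \<otimes> x \<otimes> inv g)) \<otimes> inv x = commutator G x g"
      using xG gG by (simp add: group_normalize)
    ultimately show "g \<in> ?C" using gG by simp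
  qed
  have "?C = carrier G"
  proof (rule subgroup_eq_carrier_if_sylow[OF fin commutator_stable_subgroup[OF N(1) xG]])
    fix q b s :: nat assume q: "prime q" "card (carrier G) = q ^ b * s" "\<not> q dvd s"
    show "\<exists>Q. subgroup Q G \<and> card Q = q ^ b \<and> Q \<subseteq> ?C"
    proof (cases "q = p")
      case True
      have "multiplicity p (p ^ c * t) = c" if "\<not> p dvd t" for c t
        by (rule multiplicity_eqI) (use that p(1) in \<open>auto simp: prime_gt_0_nat\<close>)
      from this[OF p(3), of a] this[of s b] have "b = a"
        using p q True by simp
      then show ?thesis using P \<open>P \<subseteq> ?C\<close> True by blast
    next
      case False
      obtain Q where Q: "subgroup Q G" "card Q = q ^ b"
        using sylow_thm[OF q(1) is_group _ fin] q(2) by (auto simp: order_def)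
      have "Q \<subseteq> ?C"
      proof
        fix y assume y: "y \<in> Q"
        then have yG: "y \<in> carrier G" using subgroup.mem_carrier[OF Q(1)] by blast
        have "x \<otimes> y = y \<otimes> x"
          using comm[unfolded coprime_elements_commute_def, rule_format, OF xG yG p(1) q(1)] False
            subgroup_pow_card[OF fin P(1) x(1)] subgroup_pow_card[OF fin Q(1) y] P(2) Q(2) by auto
        then have "commutator G x y = \<one>" using xG yG by (simp add: group_normalize)
        then show "y \<in> ?C" using yG by simp
      qed
      then show ?thesis using Q by blast
    qed
  qed
  then show ?thesis using xG \<open>x \<notin> N\<close> by blast
qed

text \<open>Centrality modulo the previous term is phrased by commutators, so no quotient groups
  occur.\<close>

primrec upper_central :: "nat \<Rightarrow> 'a set" where
  "upper_central 0 = {\<one>}"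
| "upper_central (Suc k) = {x \<in> carrier G. \<forall>g\<in>carrier G. commutator G x g \<in> upper_central k}"

lemma upper_central_normal: "upper_central k \<lhd> G"
proof (induction k)
  case 0
  show ?case by (simp add: one_is_normal)
next
  case (Suc k)
  interpret N: normal "upper_central k" G by (rule Suc)
  show ?case
  proof (rule normal_invI)
    show "subgroup (upper_central (Suc k)) G"
    proof (rule subgroupI)
      show "upper_central (Suc k) \<noteq> {}"
        by (auto intro!: exI[of _ \<one>])
      fix x assume x: "x \<in> upper_central (Suc k)"
      have "commutator G (inv x) g \<in> upper_central k" if g: "g \<in> carrier G" for g
      proof -
        have "inv x \<otimes> inv (commutator G x g) \<otimes> x \<in> upper_central k"
          using N.inv_op_closed1 x g by auto
        moreover have "inv x \<otimes> inv (commutator G x g) \<otimes> x = commutator G (inv x) g"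
          using x g by (simp add: group_normalize)
        ultimately show ?thesis by simp
      qed
      then show "inv x \<in> upper_central (Suc k)" using x by simp
      fix y assume y: "y \<in> upper_central (Suc k)"
      have "commutator G (x \<otimes> y) g \<in> upper_central k" if g: "g \<in> carrier G" for g
      proof -
        have "(x \<otimes> commutator G y g \<otimes> inv x) \<otimes> commutator G x g \<in> upper_central k"
          using N.inv_op_closed2 x y g by auto
        moreover have "(x \<otimes> commutator G y g \<otimes> inv x) \<otimes> commutator G x g = commutator G (x \<otimes> y) g"
          using x y g by (simp add: group_normalize)
        ultimately show ?thesis by simp
      qed
      then show "x \<otimes> y \<in> upper_central (Suc k)" using x y by simp
    qed auto
    fix h x assume h: "h \<in> carrier G" and x: "x \<in> upper_central (Suc k)"
    have "commutator G (h \<otimes> x \<otimes> inv h) g \<in> upper_central k" if g: "g \<in> carrier G" for g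
    proof -
      have "h \<otimes> commutator G x (inv h \<otimes> g \<otimes> h) \<otimes> inv h \<in> upper_central k"
        using N.inv_op_closed2 x g h by auto
      moreover have "h \<otimes> commutator G x (inv h \<otimes> g \<otimes> h) \<otimes> inv h = commutator G (h \<otimes> x \<otimes> inv h) g"
        using x g h by (simp add: group_normalize)
      ultimately show ?thesis by simp
    qed
    then show "h \<otimes> x \<otimes> inv h \<in> upper_central (Suc k)" using x h by simp
  qed
qed

lemma upper_central_mono: "upper_central k \<subseteq> upper_central (Suc k)"
proof
  interpret N: normal "upper_central k" G by (rule upper_central_normal)
  fix x assume x: "x \<in> upper_central k"
  have "commutator G x g \<in> upper_central k" if g: "g \<in> carrier G" for g
  proof -
    have "x \<otimes> (g \<otimes> inv x \<otimes> inv g) \<in> upper_central k"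
      using N.inv_op_closed2 x g by auto
    then show ?thesis using x g N.mem_carrier by (simp add: group_normalize)
  qed
  then show "x \<in> upper_central (Suc k)" using x N.mem_carrier by simp
qed

lemma nilpotent_if_coprime_elements_commute:
  assumes fin: "finite (carrier G)" and comm: coprime_elements_commute
  shows "nilpotent_group G"
proof -
  have sub: "upper_central k \<subseteq> carrier G" for k
    using upper_central_normal normal_imp_subgroup subgroup.subset by blast
  \<comment> \<open>The series grows strictly until it reaches \<open>G\<close>, so its order
    exceeds the index; at \<open>k = card (carrier G)\<close> only the first alternative
    survives.\<close>
  have "upper_central k = carrier G \<or> k < card (upper_central k)" for k
  proof (induction k)
    case (Suc k)
    show ?case
    proof (cases "upper_central k = carrier G")
      case True
      then show ?thesis using upper_central_mono[of k] sub[of "Suc k"] by auto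
    next
      case False
      then obtain x where "x \<in> carrier G - upper_central k" "x \<in> upper_central (Suc k)"
        using ex_central_mod_normal[OF fin comm upper_central_normal False] by auto
      then have "upper_central k \<subset> upper_central (Suc k)" using upper_central_mono[of k] by blast
      then have "card (upper_central k) < card (upper_central (Suc k))"
        using sub[of "Suc k"] fin by (meson finite_subset psubset_card_mono)
      then show ?thesis using Suc False by linarith
    qed
  qed simp
  from this[of "card (carrier G)"] obtain c where c: "upper_central c = carrier G"
    using sub card_mono[OF fin] by (metis linorder_not_less)
  \<comment> \<open>The descending series stays below the ascending one read backwards from its top
    \<open>c\<close>.\<close>
  have "lower_central G i \<subseteq> upper_central (c - i)" if "i \<le> c" for i
    using that
  proof (induction i)
    case (Suc i)
    then have *: "c - i = Suc (c - Suc i)" "lower_central G i \<subseteq> upper_central (c - i)" by auto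
    show ?case
      unfolding lower_central.simps
      by (rule generate_subgroup_incl[OF _ normal_imp_subgroup[OF upper_central_normal]])
        (use * in auto)
  qed (simp add: c)
  from this[of c] have "lower_central G c \<subseteq> {\<one>}" by simp
  moreover have "\<one> \<in> lower_central G c"
    by (cases c) (auto intro: generate.one)
  ultimately show ?thesis
    unfolding nilpotent_group_def using is_group by blast
qed

end

section \<open>Elements normalising every cyclic subgroup\<close>

locale finite_group = group +
  assumes fin: "finite (carrier G)"
begin

lemma pow_coprime_eq_one:
  assumes "z \<in> carrier G" "z [^] (m::nat) = \<one>" "z [^] (n::nat) = \<one>" "coprime m n"
  shows "z = \<one>"
proof -
  have "ord z dvd m" "ord z dvd n"
    using assms pow_eq_id by auto
  then have "ord z = 1" using assms(4) coprime_common_divisor_nat by blast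
  then show ?thesis using assms(1) ord_eq_1 by blast
qed

lemma pow_mult_eq_one:
  assumes "x \<in> carrier G" "x [^] (m::nat) = \<one>"
  shows "x [^] (m * l) = \<one>" "x [^] (l * m) = \<one>"
  using assms nat_pow_pow[of x m l] by (simp_all add: mult.commute)

lemma pow_eq_iff_cong:
  assumes "x \<in> carrier G"
  shows "x [^] (i::nat) = x [^] (j::nat) \<longleftrightarrow> [i = j] (mod ord x)"
  using int_pow_eq[OF assms, of "int i" "int j"]
  by (simp add: int_pow_int cong_iff_dvd_diff flip: cong_int_iff) (simp add: dvd_diff_commute)

text \<open>Natural exponents suffice since the group is finite, and they turn membership into a
  concrete exponent for congruences.\<close>

definition cyc :: "'a \<Rightarrow> 'a set" where
  "cyc x = range (\<lambda>n::nat. x [^] n)"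

lemma cyc_pow [intro, simp]: "x [^] (n::nat) \<in> cyc x"
  by (auto simp: cyc_def)

lemma cycE: "y \<in> cyc x \<Longrightarrow> (\<And>n::nat. y = x [^] n \<Longrightarrow> thesis) \<Longrightarrow> thesis"
  by (auto simp: cyc_def)

lemma cyc_self [simp]: "x \<in> carrier G \<Longrightarrow> x \<in> cyc x"
  using cyc_pow[of x 1] by simp

lemma cyc_eq_generate: "x \<in> carrier G \<Longrightarrow> cyc x = generate G {x}"
  using generate_pow_on_finite_carrier[OF fin, of x] by (auto simp: cyc_def)

lemma cyc_subgroup: "x \<in> carrier G \<Longrightarrow> subgroup (cyc x) G"
  by (simp add: cyc_eq_generate generate_is_subgroup)

lemma cyc_in_carrier: "x \<in> carrier G \<Longrightarrow> cyc x \<subseteq> carrier G"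
  by (auto simp: cyc_def)

lemma cyc_closed: "x \<in> carrier G \<Longrightarrow> y \<in> cyc x \<Longrightarrow> y \<in> carrier G"
  by (auto simp: cyc_def)

lemma cyc_subset: "subgroup H G \<Longrightarrow> x \<in> H \<Longrightarrow> cyc x \<subseteq> H"
  by (metis cyc_eq_generate empty_subsetI generate_subgroup_incl insert_subset subgroup.mem_carrier)

lemma cyc_commute:
  assumes "x \<in> carrier G" "y \<in> cyc x" "z \<in> cyc x"
  shows "y \<otimes> z = z \<otimes> y"
  using assms by (auto simp: cyc_def nat_pow_mult add.commute)

lemma card_cyc: "x \<in> carrier G \<Longrightarrow> card (cyc x) = ord x"
  by (simp add: cyc_eq_generate generate_pow_card)

lemma conj_pow:
  "g \<in> carrier G \<Longrightarrow> h \<in> carrier G \<Longrightarrow> (g \<otimes> h \<otimes> inv g) [^] (n::nat) = g \<otimes> h [^] n \<otimes> inv g"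
  by (induction n) (simp_all add: group_normalize)

lemma commute_pow:
  assumes "x \<in> carrier G" "y \<in> carrier G" "x \<otimes> y = y \<otimes> x"
  shows "x \<otimes> y [^] (n::nat) = y [^] n \<otimes> x"
  using assms by (induction n) (simp_all add: m_assoc[symmetric], metis m_assoc nat_pow_closed)

text \<open>As \<open>z\<close> normalises \<open>cyc x\<close>, each new factor \<open>x\<close>
  can be moved to the left at the price of another exponent. Only the existence of \<open>i\<close>
  matters.\<close>

lemma mult_pow_normalising:
  assumes x: "x \<in> carrier G" and z: "z \<in> carrier G" and n: "z \<otimes> x \<otimes> inv z \<in> cyc x"
  shows "\<exists>i::nat. (x \<otimes> z) [^] (n::nat) = x [^] i \<otimes> z [^] n"
proof (induction n)
  case 0
  show ?case by (auto intro: exI[of _ 0])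
next
  case (Suc n)
  then obtain i :: nat where i: "(x \<otimes> z) [^] n = x [^] i \<otimes> z [^] n" by blast
  obtain j :: nat where j: "z \<otimes> x \<otimes> inv z = x [^] j" using n by (rule cycE)
  have "(x \<otimes> z) [^] Suc n = x \<otimes> (z \<otimes> x [^] i \<otimes> inv z) \<otimes> (z \<otimes> z [^] n)"
    unfolding nat_pow_Suc2[OF m_closed[OF x z]] i using x z by (simp add: group_normalize)
  also have "z \<otimes> x [^] i \<otimes> inv z = x [^] (j * i)"
    using x z by (simp add: conj_pow[symmetric] j nat_pow_pow)
  also have "x \<otimes> x [^] (j * i) \<otimes> (z \<otimes> z [^] n) = x [^] Suc (j * i) \<otimes> z [^] Suc n"
    using nat_pow_Suc2[OF x, of "j * i"] nat_pow_Suc2[OF z, of n] by simp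
  finally show ?case by blast
qed

text \<open>Baer's norm: the intersection of the normalisers of all cyclic, hence of all, subgroups.
  In a finite group containment in \<open>cyc y\<close> is enough for normalising it.\<close>

definition norm :: "'a set" where
  "norm = {k \<in> carrier G. \<forall>y\<in>carrier G. k \<otimes> y \<otimes> inv k \<in> cyc y}"

lemma norm_closed: "k \<in> norm \<Longrightarrow> k \<in> carrier G"
  by (simp add: norm_def)

lemma normE:
  assumes "k \<in> norm" "y \<in> carrier G"
  obtains i :: nat where "k \<otimes> y \<otimes> inv k = y [^] i"
proof -
  have "k \<otimes> y \<otimes> inv k \<in> cyc y" using assms by (simp add: norm_def)
  then show ?thesis by (rule cycE) (rule that)
qed

lemma norm_pow:
  assumes "k \<in> norm"
  shows "k [^] (n::nat) \<in> norm"
proof (induction n)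
  case 0
  show ?case by (simp add: norm_def)
next
  case (Suc n)
  have k: "k \<in> carrier G" using assms norm_closed by blast
  have "k [^] Suc n \<otimes> y \<otimes> inv (k [^] Suc n) \<in> cyc y" if y: "y \<in> carrier G" for y
  proof -
    obtain i :: nat where i: "k [^] n \<otimes> y \<otimes> inv (k [^] n) = y [^] i"
      using normE[OF Suc y] .
    obtain j :: nat where j: "k \<otimes> y \<otimes> inv k = y [^] j"
      using normE[OF assms y] .
    have "k [^] Suc n \<otimes> y \<otimes> inv (k [^] Suc n) = k \<otimes> (k [^] n \<otimes> y \<otimes> inv (k [^] n)) \<otimes> inv k"
      using nat_pow_Suc2[OF k, of n] k y by (simp add: group_normalize)
    also have "\<dots> = y [^] (j * i)"
      using k y by (simp add: i conj_pow[symmetric] j nat_pow_pow)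
    finally show ?thesis by simp
  qed
  then show ?case using k by (simp add: norm_def)
qed

lemma norm_inv:
  assumes "k \<in> norm"
  shows "inv k \<in> norm"
proof -
  have k: "k \<in> carrier G" using assms norm_closed by blast
  have "k [^] (ord k - 1) \<otimes> k = \<one>"
    using ord_ge_1[OF fin k] pow_ord_eq_1[OF k] by (simp flip: nat_pow_Suc)
  then have "inv k = k [^] (ord k - 1)" using k inv_equality by simp
  then show ?thesis using norm_pow[OF assms] by simp
qed

lemma norm_conj:
  assumes "k \<in> norm" and g: "g \<in> carrier G"
  shows "g \<otimes> k \<otimes> inv g \<in> norm"
proof -
  have k: "k \<in> carrier G" using assms norm_closed by blast
  have "(g \<otimes> k \<otimes> inv g) \<otimes> y \<otimes> inv (g \<otimes> k \<otimes> inv g) \<in> cyc y" if y: "y \<in> carrier G" for y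
  proof -
    obtain i :: nat where i: "k \<otimes> (inv g \<otimes> y \<otimes> g) \<otimes> inv k = (inv g \<otimes> y \<otimes> g) [^] i"
      by (rule normE[OF assms(1), of "inv g \<otimes> y \<otimes> g"]) (use g y in auto)
    have "(g \<otimes> k \<otimes> inv g) \<otimes> y \<otimes> inv (g \<otimes> k \<otimes> inv g)
        = g \<otimes> (k \<otimes> (inv g \<otimes> y \<otimes> g) \<otimes> inv k) \<otimes> inv g"
      using k g y by (simp add: group_normalize)
    also have "\<dots> = (g \<otimes> (inv g \<otimes> y \<otimes> g) \<otimes> inv g) [^] i"
      unfolding i using g y by (simp add: conj_pow)
    also have "g \<otimes> (inv g \<otimes> y \<otimes> g) \<otimes> inv g = y"
      using g y by (simp add: conj_cancel)
    finally show ?thesis by simp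
  qed
  then show ?thesis using k g by (simp add: norm_def)
qed

text \<open>The commutator of \<open>x\<close> and \<open>y\<close> lies in the cyclic group of \<open>y\<close>, and it is the product of \<open>x\<close>
  with a conjugate of its inverse, which normalises the cyclic group of \<open>x\<close>.\<close>
lemma norm_commutes_if_coprime:
  assumes x: "x \<in> norm" and y: "y \<in> carrier G"
    and m: "x [^] (m::nat) = \<one>" and n: "y [^] (n::nat) = \<one>" and cop: "coprime m n"
  shows "x \<otimes> y = y \<otimes> x"
proof -
  have xG: "x \<in> carrier G" using x norm_closed by blast
  define z where "z = y \<otimes> inv x \<otimes> inv y"
  have z: "z \<in> norm" "z \<in> carrier G"
    using norm_conj[OF norm_inv[OF x] y] xG y by (simp_all add: z_def)
  obtain j :: nat where j: "x \<otimes> y \<otimes> inv x = y [^] j"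
    using normE[OF x y] .
  have c: "x \<otimes> z = y [^] j \<otimes> inv y"
    using xG y by (simp add: z_def j[symmetric] group_normalize)
  have "(x \<otimes> z) [^] n = (y [^] j) [^] n \<otimes> (inv y) [^] n"
    unfolding c by (rule pow_mult_distrib) (use y in \<open>auto simp: inv_comm\<close>,
      metis commute_pow inv_closed l_inv r_inv)
  also have "\<dots> = \<one>"
    using y n pow_mult_eq_one[OF y n] by (simp add: nat_pow_pow nat_pow_inv)
  finally have 1: "(x \<otimes> z) [^] n = \<one>" .
  obtain i :: nat where i: "(x \<otimes> z) [^] m = x [^] i \<otimes> z [^] m"
    using mult_pow_normalising[OF xG z(2)] z(1) xG unfolding norm_def by blast
  have "z [^] m = \<one>"
    using xG y m by (simp add: z_def conj_pow nat_pow_inv)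
  \<comment> \<open>The exponent \<open>m\<close> is applied twice: first to kill \<open>z\<close>,
    then to kill the power of \<open>x\<close> that remains. So the order of the commutator divides
    both \<open>m * m\<close> and \<open>n\<close>.\<close>
  have "(x \<otimes> z) [^] (m * m) = ((x \<otimes> z) [^] m) [^] m"
    using xG z by (simp add: nat_pow_pow)
  also have "\<dots> = \<one>"
    using i \<open>z [^] m = \<one>\<close> xG pow_mult_eq_one[OF xG m] by (simp add: nat_pow_pow)
  finally have "x \<otimes> z = \<one>"
    using pow_coprime_eq_one[of "x \<otimes> z" "m * m" n] 1 xG z cop by simp
  then have "y [^] j = y" using c y by (metis inv_equality inv_inv inv_closed nat_pow_closed)
  then have "x \<otimes> y \<otimes> inv x = y" using j by simp
  then show ?thesis using xG y by (metis inv_solve_right' m_closed)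
qed

text \<open>The \<open>p\<close>-part and the \<open>p'\<close>-part come from the Chinese remainder
  theorem on the order. As powers of \<open>k\<close> they commute with each other and inherit
  membership in \<open>norm\<close>.\<close>

lemma prime_part_decomposition:
  assumes k: "k \<in> carrier G" and p: "prime (p::nat)"
  obtains i j e r :: nat where "k = k [^] i \<otimes> k [^] j" "(k [^] i) [^] (p ^ e) = \<one>"
    "(k [^] j) [^] r = \<one>" "coprime p r"
proof -
  define e where "e = multiplicity p (ord k)"
  have "ord k \<noteq> 0" using ord_ge_1[OF fin k] by simp
  then obtain r where r: "ord k = p ^ e * r" "\<not> p dvd r"
    using multiplicity_decompose'[of "ord k" p] p not_prime_unit unfolding e_def by metis
  have cop: "coprime p r" using p r(2) by (simp add: prime_imp_coprime)
  then have cop': "coprime (p ^ e) r" by simp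
  obtain i where i: "[i = 1] (mod p ^ e)" "[i = 0] (mod r)"
    using binary_chinese_remainder_nat[OF cop', of 1 0] by blast
  obtain j where j: "[j = 0] (mod p ^ e)" "[j = 1] (mod r)"
    using binary_chinese_remainder_nat[OF cop', of 0 1] by blast
  have "[i + j = 1] (mod p ^ e)" "[i + j = 1] (mod r)"
    using cong_add[OF i(1) j(1)] cong_add[OF i(2) j(2)] by auto
  then have "[i + j = 1] (mod ord k)"
    unfolding r(1) using coprime_cong_mult_nat cop' by blast
  then have "k [^] (i + j) = k [^] (1::nat)"
    using k pow_eq_iff_cong by blast
  then have "k = k [^] i \<otimes> k [^] j" using k by (simp add: nat_pow_mult)
  moreover have "(k [^] i) [^] (p ^ e) = \<one>"
    using i(2) k r(1) by (simp add: nat_pow_pow pow_eq_id cong_0_iff mult.commute)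
  moreover have "(k [^] j) [^] r = \<one>"
    using j(1) k r(1) by (simp add: nat_pow_pow pow_eq_id cong_0_iff)
  ultimately show ?thesis using that cop by blast
qed

text \<open>Write \<open>x y (inv x) = y k\<close> and split \<open>k = u v\<close> into
  \<open>p\<close>-part and \<open>p'\<close>-part. By \<open>norm_commutes_if_coprime\<close>,
  \<open>u\<close> commutes with \<open>y\<close> and \<open>v\<close> with \<open>x\<close>.
  Comparing powers of \<open>x y (inv x) = (y v) u\<close> annihilates \<open>u\<close> by an
  exponent prime to \<open>p\<close>, so \<open>u\<close> is trivial; iterating conjugation by
  \<open>x\<close> then annihilates \<open>v\<close> by a power of \<open>p\<close>, so
  \<open>v\<close> is trivial.\<close>

lemma coprime_elements_commute_if_commutators_in_norm:
  assumes comm: "\<And>g h. g \<in> carrier G \<Longrightarrow> h \<in> carrier G \<Longrightarrow> commutator G g h \<in> norm"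
  shows coprime_elements_commute
  unfolding coprime_elements_commute_def
proof (intro allI ballI impI)
  fix p q a b :: nat and x y
  assume x: "x \<in> carrier G" and y: "y \<in> carrier G" and pq: "prime p" "prime q" "p \<noteq> q"
    and xp: "x [^] (p ^ a) = \<one>" and yq: "y [^] (q ^ b) = \<one>"
  have cpq: "coprime p q" using pq primes_coprime by blast
  define k where "k = commutator G (inv y) x"
  have kN: "k \<in> norm" and k: "k \<in> carrier G"
    using comm[of "inv y" x] x y by (simp_all add: k_def)
  have xyk: "x \<otimes> y \<otimes> inv x = y \<otimes> k"
    using x y by (simp add: k_def group_normalize)
  obtain i j e r :: nat where dec: "k = k [^] i \<otimes> k [^] j" "(k [^] i) [^] (p ^ e) = \<one>"
    "(k [^] j) [^] r = \<one>" "coprime p r"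
    by (rule prime_part_decomposition[OF k pq(1)])
  define u v where "u = k [^] i" and "v = k [^] j"
  have uv: "u \<in> carrier G" "v \<in> carrier G" "u \<in> norm" "v \<in> norm" "k = u \<otimes> v" "u \<otimes> v = v \<otimes> u"
    using k kN norm_pow dec(1) by (simp_all add: u_def v_def nat_pow_mult add.commute)
  have uy: "u \<otimes> y = y \<otimes> u"
    using norm_commutes_if_coprime[OF uv(3) y, of "p ^ e" "q ^ b"] dec(2) yq cpq by (simp add: u_def)
  have vx: "v \<otimes> x = x \<otimes> v"
    using norm_commutes_if_coprime[OF uv(4) x, of r "p ^ a"] dec(3,4) xp
    by (simp add: v_def coprime_commute)
  \<comment> \<open>\<open>v\<close> need not commute with \<open>y\<close>, but it normalises
    \<open>cyc y\<close>. Since \<open>v [^] r\<close> is trivial, the \<open>r\<close>-th power of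
    \<open>y \<otimes> v\<close> lands in \<open>cyc y\<close>, where the exponent
    \<open>q ^ b\<close> annihilates it.\<close>
  obtain l :: nat where l: "(y \<otimes> v) [^] r = y [^] l \<otimes> v [^] r"
    using mult_pow_normalising[OF y uv(2)] uv(4) y unfolding norm_def by blast
  have vr: "v [^] r = \<one>" using dec(3) by (simp add: v_def)
  have "(y \<otimes> v) [^] (r * q ^ b) = ((y \<otimes> v) [^] r) [^] (q ^ b)"
    using y uv by (simp add: nat_pow_pow)
  also have "\<dots> = y [^] (l * q ^ b)"
    using y by (simp add: l vr nat_pow_pow)
  finally have yv: "(y \<otimes> v) [^] (r * q ^ b) = \<one>"
    using pow_mult_eq_one[OF y yq] by simp
  have eq: "x \<otimes> y \<otimes> inv x = (y \<otimes> v) \<otimes> u"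
    using xyk uv y by (simp add: m_assoc)
  have "(x \<otimes> y \<otimes> inv x) [^] (r * q ^ b) = x \<otimes> y [^] (q ^ b * r) \<otimes> inv x"
    using conj_pow[OF x y] by (simp add: mult.commute)
  also have "\<dots> = \<one>" using x pow_mult_eq_one[OF y yq] by simp
  finally have "((y \<otimes> v) \<otimes> u) [^] (r * q ^ b) = \<one>" using eq by simp
  moreover have "((y \<otimes> v) \<otimes> u) [^] (r * q ^ b) = (y \<otimes> v) [^] (r * q ^ b) \<otimes> u [^] (r * q ^ b)"
  proof (rule pow_mult_distrib)
    show "y \<otimes> v \<otimes> u = u \<otimes> (y \<otimes> v)"
      using uv y uy by (metis m_assoc)
  qed (use uv y in auto)
  ultimately have "u [^] (r * q ^ b) = \<one>" using yv uv by simp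
  then have "u = \<one>"
    using pow_coprime_eq_one[of u "r * q ^ b" "p ^ e"] uv(1) dec(2,4) cpq by (simp add: u_def coprime_commute)
  then have xyv: "x \<otimes> y \<otimes> inv x = y \<otimes> v" using eq uv y by simp
  have step: "x [^] n \<otimes> y \<otimes> inv (x [^] n) = y \<otimes> v [^] n" for n :: nat
  proof (induction n)
    case (Suc n)
    have "x [^] Suc n \<otimes> y \<otimes> inv (x [^] Suc n) = x \<otimes> (x [^] n \<otimes> y \<otimes> inv (x [^] n)) \<otimes> inv x"
      using nat_pow_Suc2[OF x, of n] x y by (simp add: group_normalize)
    also have "\<dots> = (x \<otimes> y \<otimes> inv x) \<otimes> (x \<otimes> v [^] n \<otimes> inv x)"
      unfolding Suc using x y uv by (simp add: group_normalize)
    also have "x \<otimes> v [^] n \<otimes> inv x = v [^] n"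
      using commute_pow[OF x uv(2), of n] vx x uv by (simp add: group_normalize)
    finally show ?case using xyv y uv nat_pow_Suc2[OF uv(2), of n] by (simp add: m_assoc)
  qed (use y in simp)
  have "v [^] (p ^ a) = \<one>"
    using step[of "p ^ a"] xp y uv by simp
  then have "v = \<one>"
    using pow_coprime_eq_one[of v "p ^ a" r] dec(3,4) uv(2) by (simp add: v_def)
  then have "x \<otimes> y \<otimes> inv x = y" using xyv y by simp
  then show "x \<otimes> y = y \<otimes> x" using x y by (metis inv_solve_right' m_closed)
qed

end

section \<open>Maximal cyclic subgroups\<close>

context finite_group
begin

definition max_cyclic :: "'a set set" where
  "max_cyclic = {C. \<exists>x\<in>carrier G. C = cyc x \<and> (\<forall>y\<in>carrier G. cyc x \<subseteq> cyc y \<longrightarrow> cyc y = cyc x)}"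

lemma max_cyclicE:
  assumes "C \<in> max_cyclic"
  obtains c where "c \<in> carrier G" "C = cyc c"
  using assms by (auto simp: max_cyclic_def)

lemma max_cyclic_subset: "C \<in> max_cyclic \<Longrightarrow> C \<subseteq> carrier G"
  by (auto elim!: max_cyclicE simp: cyc_closed)

lemma max_cyclic_subgroup: "C \<in> max_cyclic \<Longrightarrow> subgroup C G"
  by (auto elim!: max_cyclicE simp: cyc_subgroup)

lemma max_cyclic_maximal: "C \<in> max_cyclic \<Longrightarrow> y \<in> carrier G \<Longrightarrow> C \<subseteq> cyc y \<Longrightarrow> cyc y = C"
  by (auto simp: max_cyclic_def)

lemma max_cyclic_eq: "C \<in> max_cyclic \<Longrightarrow> D \<in> max_cyclic \<Longrightarrow> C \<subseteq> D \<Longrightarrow> C = D"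
  by (metis max_cyclicE max_cyclic_maximal)

lemma finite_max_cyclic: "finite max_cyclic"
proof -
  have "max_cyclic \<subseteq> Pow (carrier G)" by (rule subsetI, rule PowI, rule max_cyclic_subset)
  moreover have "finite (Pow (carrier G))" using fin by (rule finite_Pow_iff[THEN iffD2])
  ultimately show ?thesis by (rule finite_subset)
qed

lemma ex_max_cyclic:
  assumes "x \<in> carrier G"
  obtains C where "C \<in> max_cyclic" "x \<in> C"
proof -
  let ?P = "\<lambda>y. y \<in> carrier G \<and> x \<in> cyc y"
  have "\<exists>y. ?P y \<and> (\<forall>z. ?P z \<longrightarrow> card (cyc z) \<le> card (cyc y))"
  proof (rule ex_has_greatest_nat[of ?P x "\<lambda>y. card (cyc y)" "Suc (card (carrier G))"])
    show "\<forall>y. ?P y \<longrightarrow> card (cyc y) < Suc (card (carrier G))"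
      by (auto intro!: le_imp_less_Suc card_mono[OF fin] dest: cyc_closed)
  qed (use assms in simp)
  then obtain y where y: "y \<in> carrier G" "x \<in> cyc y"
    and max: "\<And>z. z \<in> carrier G \<Longrightarrow> x \<in> cyc z \<Longrightarrow> card (cyc z) \<le> card (cyc y)"
    by auto
  have "cyc z = cyc y" if z: "z \<in> carrier G" "cyc y \<subseteq> cyc z" for z
  proof -
    have "finite (cyc z)" using cyc_in_carrier[OF z(1)] fin finite_subset by blast
    then show ?thesis
      using card_seteq[of "cyc z" "cyc y"] z max[OF z(1)] y by auto
  qed
  then have "cyc y \<in> max_cyclic" using y by (auto simp: max_cyclic_def)
  then show ?thesis using that y by blast
qed

lemma two_le_card_max_cyclic:
  assumes "\<not> cyclic_group G"
  shows "2 \<le> card max_cyclic"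
proof (rule ccontr)
  assume "\<not> 2 \<le> card max_cyclic"
  moreover obtain C where C: "C \<in> max_cyclic" using ex_max_cyclic[OF one_closed] by blast
  ultimately have "card max_cyclic = 1"
    using finite_max_cyclic by (metis One_nat_def Suc_1 card_eq_0_iff empty_iff less_2_cases not_le)
  then have all: "max_cyclic = {C}" using C by (metis card_1_singletonE singletonD)
  then have "carrier G \<subseteq> C" using ex_max_cyclic by (metis singletonD subsetI)
  moreover obtain c where c: "c \<in> carrier G" "C = cyc c" using C by (rule max_cyclicE)
  ultimately have "generate G {c} = carrier G"
    using cyc_in_carrier[OF c(1)] by (auto simp: cyc_eq_generate)
  then have "subgroup_generated G {c} = G"
    using c(1) by (simp add: subgroup_generated_def)
  then show False using assms c(1) unfolding cyclic_group_def by blast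
qed

text \<open>The maximal cyclic subgroups form an irredundant covering; conversely the private elements of the
  members of an irredundant covering lie in distinct maximal cyclic subgroups.\<close>
lemma covering_number_eq_card_max_cyclic:
  assumes nc: "\<not> cyclic_group G"
  shows "covering_number G = card max_cyclic"
proof -
  let ?m = "card max_cyclic"
  obtain h where h: "bij_betw h {1..?m} max_cyclic"
    using ex_bij_betw_nat_finite_1[OF finite_max_cyclic] by blast
  then have him: "h ` {1..?m} = max_cyclic" and hinj: "inj_on h {1..?m}"
    by (auto simp: bij_betw_def)
  have "irredundant_covering G ?m h"
    unfolding irredundant_covering_def
  proof (intro conjI ballI)
    show "2 \<le> ?m" using two_le_card_max_cyclic[OF nc] .
    show "subgroup (h i) G" if "i \<in> {1..?m}" for i
      using max_cyclic_subgroup that him by blast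
    show "(\<Union>i\<in>{1..?m}. h i) = carrier G"
      unfolding him[THEN arg_cong[where f = Union]]
      using max_cyclic_subset by (auto elim: ex_max_cyclic)
    show "\<not> h i \<subseteq> (\<Union>j\<in>{1..?m} - {i}. h j)" if i: "i \<in> {1..?m}" for i
    proof
      assume sub: "h i \<subseteq> (\<Union>j\<in>{1..?m} - {i}. h j)"
      have hi: "h i \<in> max_cyclic" using i him by blast
      then obtain c where c: "c \<in> carrier G" "h i = cyc c" by (rule max_cyclicE)
      then obtain j where j: "j \<in> {1..?m}" "j \<noteq> i" "c \<in> h j" using sub cyc_self by blast
      have hj: "h j \<in> max_cyclic" using j him by blast
      have "h i \<subseteq> h j" using c j cyc_subset[OF max_cyclic_subgroup[OF hj]] by simp
      then have "h i = h j" using max_cyclic_eq[OF hi hj] by blast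
      then show False using inj_onD[OF hinj _ i j(1)] j(2) by simp
    qed
  qed
  moreover have "n \<le> ?m" if X: "irredundant_covering G n X" for n X
  proof -
    have "\<forall>i\<in>{1..n}. \<exists>x. x \<in> X i \<and> x \<notin> (\<Union>j\<in>{1..n} - {i}. X j)"
      using X unfolding irredundant_covering_def by blast
    then obtain f where f: "\<And>i. i \<in> {1..n} \<Longrightarrow> f i \<in> X i \<and> f i \<notin> (\<Union>j\<in>{1..n} - {i}. X j)"
      by metis
    have sub: "subgroup (X i) G" if "i \<in> {1..n}" for i
      using X that by (auto simp: irredundant_covering_def)
    have "\<exists>C\<in>max_cyclic. f i \<in> C" if i: "i \<in> {1..n}" for i
      using f[OF i] subgroup.mem_carrier[OF sub[OF i]] ex_max_cyclic by metis
    then obtain k where k: "\<And>i. i \<in> {1..n} \<Longrightarrow> k i \<in> max_cyclic \<and> f i \<in> k i"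
      by metis
    have "inj_on k {1..n}"
    proof (rule inj_onI)
      fix i j assume ij: "i \<in> {1..n}" "j \<in> {1..n}" "k i = k j"
      obtain c where c: "c \<in> carrier G" "k i = cyc c" using k[OF ij(1)] by (auto elim: max_cyclicE)
      then obtain l where l: "l \<in> {1..n}" "c \<in> X l"
        using X unfolding irredundant_covering_def by blast
      then have "k i \<subseteq> X l" using cyc_subset[OF sub] c by simp
      then have "f i \<in> X l" "f j \<in> X l" using k[OF ij(1)] k[OF ij(2)] ij(3) by auto
      then have "l = i" "l = j" using f[OF ij(1)] f[OF ij(2)] l by auto
      then show "i = j" by simp
    qed
    moreover have "k ` {1..n} \<subseteq> max_cyclic" using k by blast
    ultimately show ?thesis
      using card_inj_on_le[of k "{1..n}" max_cyclic] finite_max_cyclic by simp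
  qed
  ultimately have "Max {n. \<exists>X. irredundant_covering G n X} = ?m"
    using finite_irredundant_coverings[OF fin] by (intro Max_eqI) auto
  then show ?thesis using nc by (simp add: covering_number_def)
qed

lemma conj_set_cyc:
  assumes "g \<in> carrier G" "x \<in> carrier G"
  shows "conj_set G g (cyc x) = cyc (g \<otimes> x \<otimes> inv g)"
  using assms unfolding conj_set_def cyc_def image_image by (simp add: conj_pow)

lemma conj_set_mono: "A \<subseteq> B \<Longrightarrow> conj_set G g A \<subseteq> conj_set G g B"
  by (auto simp: conj_set_def)

lemma conj_set_max_cyclic:
  assumes g: "g \<in> carrier G" and C: "C \<in> max_cyclic"
  shows "conj_set G g C \<in> max_cyclic"
proof -
  obtain x where x: "x \<in> carrier G" "C = cyc x" using C by (rule max_cyclicE)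
  have "cyc y = cyc (g \<otimes> x \<otimes> inv g)"
    if y: "y \<in> carrier G" and sub: "cyc (g \<otimes> x \<otimes> inv g) \<subseteq> cyc y" for y
  proof -
    have "conj_set G (inv g) (conj_set G g C) \<subseteq> conj_set G (inv g) (cyc y)"
      unfolding x(2) conj_set_cyc[OF g x(1)] by (rule conj_set_mono[OF sub])
    moreover have "conj_set G (inv g) (conj_set G g C) = C"
      using conj_set_mult[of "inv g" g C] max_cyclic_subset[OF C] g by (simp add: conj_set_one)
    ultimately have "C \<subseteq> cyc (inv g \<otimes> y \<otimes> inv (inv g))"
      using conj_set_cyc[of "inv g" y] g y by simp
    then have "cyc (inv g \<otimes> y \<otimes> inv (inv g)) = C"
      using max_cyclic_maximal[OF C] g y by simp
    then have "conj_set G g (cyc (inv g \<otimes> y \<otimes> inv (inv g))) = cyc (g \<otimes> x \<otimes> inv g)"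
      using x g by (simp add: conj_set_cyc)
    then show ?thesis using g y by (simp add: conj_set_cyc conj_cancel)
  qed
  then show ?thesis using x g by (auto simp: max_cyclic_def conj_set_cyc)
qed

sublocale action: finite_action G "conj_set G" max_cyclic
proof (intro finite_action.intro finite_action_axioms.intro is_group)
  show "conj_set G \<one> C = C" if "C \<in> max_cyclic" for C
    using conj_set_one max_cyclic_subset that by blast
  show "conj_set G (g \<otimes> h) C = conj_set G g (conj_set G h C)"
    if "g \<in> carrier G" "h \<in> carrier G" "C \<in> max_cyclic" for g h C
    using conj_set_mult max_cyclic_subset that by blast
qed (use fin finite_max_cyclic conj_set_max_cyclic in auto)

lemma conj_set_self:
  assumes "C \<in> max_cyclic" "g \<in> C"
  shows "conj_set G g C = C"
proof -
  obtain c where c: "c \<in> carrier G" "C = cyc c" using assms(1) by (rule max_cyclicE)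
  then have g: "g \<in> carrier G" using assms cyc_closed by blast
  have "g \<otimes> c = c \<otimes> g" using cyc_commute[OF c(1)] c assms(2) by simp
  then have "g \<otimes> c \<otimes> inv g = c" using g c(1) by (simp add: m_assoc)
  then show ?thesis using conj_set_cyc[OF g c(1)] c by simp
qed

lemma max_cyclic_commute: "C \<in> max_cyclic \<Longrightarrow> x \<in> C \<Longrightarrow> y \<in> C \<Longrightarrow> x \<otimes> y = y \<otimes> x"
  using cyc_commute by (metis max_cyclicE)

text \<open>On a stable \<open>cyc c\<close> conjugation by \<open>g\<close> is a power map, and a
  power map preserves every subgroup of \<open>cyc c\<close>.\<close>

lemma norm_if_fixes_max_cyclic:
  assumes g: "g \<in> carrier G" and stable: "\<And>C. C \<in> max_cyclic \<Longrightarrow> conj_set G g C = C"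
  shows "g \<in> norm"
proof -
  have "g \<otimes> y \<otimes> inv g \<in> cyc y" if y: "y \<in> carrier G" for y
  proof -
    obtain C where C: "C \<in> max_cyclic" "y \<in> C" using y by (rule ex_max_cyclic)
    then obtain c where c: "c \<in> carrier G" "C = cyc c" using max_cyclicE by blast
    obtain l :: nat where l: "y = c [^] l" using C c by (auto elim: cycE)
    have "g \<otimes> c \<otimes> inv g \<in> cyc c"
      using stable[OF C(1)] c conj_set_cyc[OF g c(1)] g by (metis cyc_self inv_closed m_closed)
    then obtain m :: nat where m: "g \<otimes> c \<otimes> inv g = c [^] m" by (rule cycE)
    have "g \<otimes> y \<otimes> inv g = (c [^] m) [^] l"
      using l m g c conj_pow[of g c l] by simp
    also have "\<dots> = y [^] m" using l c by (simp add: nat_pow_pow mult.commute)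
    finally show ?thesis by simp
  qed
  then show ?thesis using g by (simp add: norm_def)
qed

end

section \<open>The orbits of maximal cyclic subgroups\<close>

text \<open>The second assumption is what non-nilpotency provides, by
  \<open>nilpotent_if_coprime_elements_commute\<close>.\<close>

locale six_max_cyclic = finite_group +
  assumes card_six: "card max_cyclic = 6"
    and not_commute: "\<not> coprime_elements_commute"
begin

abbreviation act where "act \<equiv> conj_set G"
abbreviation orb where "orb \<equiv> action.orb"

lemma fixes_some:
  assumes "g \<in> carrier G"
  obtains C where "C \<in> max_cyclic" "g \<in> C" "act g C = C"
  using ex_max_cyclic[OF assms] conj_set_self by metis

lemma card_disjoint_orbits:
  assumes "C \<in> max_cyclic" "D \<in> max_cyclic" "D \<notin> orb C"
  shows "card (orb C) + card (orb D) \<le> 6"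
proof -
  have "orb C \<inter> orb D = {}"
    using action.orb_disjoint[OF assms(1,2)] assms action.orb_refl by blast
  then have "card (orb C) + card (orb D) = card (orb C \<union> orb D)"
    by (simp add: card_Un_disjoint)
  also have "\<dots> \<le> 6"
    unfolding card_six[symmetric]
    by (rule card_mono) (use finite_max_cyclic action.orb_subset assms in auto)
  finally show ?thesis .
qed

text \<open>A transitive action on the six points would contain a fixed-point-free element, contrary
  to \<open>fixes_some\<close>.\<close>

lemma card_orb_le_5:
  assumes C: "C \<in> max_cyclic"
  shows "card (orb C) \<le> 5"
proof (rule ccontr)
  assume big: "\<not> ?thesis"
  then have "orb C = max_cyclic"
    using card_seteq[OF finite_max_cyclic action.orb_subset[OF C]] card_six by simp
  moreover obtain g where "g \<in> carrier G" "\<forall>z\<in>orb C. act g z \<noteq> z"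
    using action.ex_fixed_point_free[OF C] big by auto
  ultimately show False using fixes_some by metis
qed

lemma prime_power_elt_fixes_small_orb:
  assumes "g \<in> carrier G" "prime p" "g [^] (p ^ e :: nat) = \<one>" "C \<in> max_cyclic" "card (orb C) < p"
  shows "act g C = C"
  by (rule action.prime_power_elt_fixes_small[OF assms(1-3), of "orb C"])
    (use assms action.orb_subset action.orb_act in auto)

text \<open>Otherwise all elements of odd prime power order lie in the norm. Of two distinct primes
  at least one is odd, so all elements of coprime prime power orders would commute.\<close>

lemma ex_odd_moving:
  "\<exists>p e y C. prime (p::nat) \<and> p \<noteq> 2 \<and> y \<in> carrier G \<and> y [^] (p ^ e) = \<one> \<and>
    C \<in> max_cyclic \<and> act y C \<noteq> C"
proof (rule ccontr)
  assume contr: "\<not> ?thesis"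
  have norm: "y \<in> norm" if "prime (p::nat)" "p \<noteq> 2" "y \<in> carrier G" "y [^] (p ^ e) = \<one>" for p e y
    by (rule norm_if_fixes_max_cyclic) (use that contr in auto)
  have coprime_elements_commute
    unfolding coprime_elements_commute_def
  proof (intro allI ballI impI)
    fix p q a b :: nat and x y
    assume *: "x \<in> carrier G" "y \<in> carrier G" "prime p" "prime q" "p \<noteq> q"
      "x [^] (p ^ a) = \<one>" "y [^] (q ^ b) = \<one>"
    then have cop: "coprime (p ^ a) (q ^ b)" using primes_coprime[OF *(3-5)] by simp
    show "x \<otimes> y = y \<otimes> x"
    proof (cases "p = 2")
      case False
      then show ?thesis
        using norm_commutes_if_coprime[OF norm[OF *(3) False *(1,6)] *(2,6,7) cop] by simp
    next
      case True
      then have "q \<noteq> 2" using * by simp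
      then show ?thesis
        using norm_commutes_if_coprime[OF norm[OF *(4) _ *(2,7)] *(1,7,6)] cop
        by (simp add: coprime_commute)
    qed
  qed
  then show False using not_commute by simp
qed

end

section \<open>Elements of prime power order acting as p-cycles\<close>

context finite_action
begin

text \<open>A stabiliser of index \<open>p\<close> cannot contain a Sylow
  \<open>p\<close>-subgroup.\<close>

lemma ex_prime_power_moving:
  fixes p :: nat
  assumes x: "x \<in> E" and p: "prime p" "card (orb x) = p"
  shows "\<exists>y\<in>carrier G. \<exists>e. y [^] (p ^ e) = \<one> \<and> act y x \<noteq> x"
proof -
  have pos: "card (carrier G) \<noteq> 0" using finite_carrier by auto
  define a where "a = multiplicity p (card (carrier G))"
  obtain r where r: "card (carrier G) = p ^ a * r" "\<not> p dvd r"
    using multiplicity_decompose'[OF pos, of p] not_prime_unit p(1) unfolding a_def by blast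
  obtain P where P: "subgroup P G" "card P = p ^ a"
    using sylow_thm[OF p(1) is_group _ finite_carrier, of a r] r by (auto simp: order_def)
  have "\<not> P \<subseteq> stab x"
  proof
    assume "P \<subseteq> stab x"
    then obtain k where "card (stab x) = p ^ a * k"
      using card_subgroup_dvd[OF finite_carrier stab_subgroup[OF x] P(1)] P(2) by (auto elim: dvdE)
    then have "p ^ a * (p * k) = p ^ a * r"
      using orb_stab[OF x] p r by (simp add: ac_simps)
    then have "p * k = r" using p(1) by (simp add: prime_gt_0_nat)
    then show False using r(2) by auto
  qed
  then obtain y where y: "y \<in> P" "y \<notin> stab x" by blast
  then have "y \<in> carrier G" "y [^] (p ^ a) = \<one>"
    using subgroup.mem_carrier[OF P(1)] subgroup_pow_card[OF finite_carrier P(1)] P(2) by auto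
  then show ?thesis using y by (auto simp: stab_def)
qed

text \<open>The cycle length is a power of \<open>p\<close> different from 1 and below
  \<open>p * p\<close>. The generous bound covers a 3-cycle inside an orbit of four points, as met
  in \<open>card_orb_neq_4\<close>.\<close>

lemma prime_period:
  fixes p :: nat
  assumes y: "y \<in> carrier G" "prime p" "y [^] (p ^ e) = \<one>"
    and x: "x \<in> E" "act y x \<noteq> x" "card (orb x) < p * p"
  shows "act (y [^] (i::nat)) x = act (y [^] (j::nat)) x \<longleftrightarrow> i mod p = j mod p"
    "card (range (\<lambda>i::nat. act (y [^] i) x)) = p"
proof -
  obtain d :: nat where d: "0 < d" "\<And>i j. act (y [^] i) x = act (y [^] j) x \<longleftrightarrow> i mod d = j mod d"
    "card (range (\<lambda>i::nat. act (y [^] i) x)) = d" "d dvd ord y"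
    by (rule period[OF y(1) x(1)]) (rule that)
  have "range (\<lambda>i::nat. act (y [^] i) x) \<subseteq> orb x" using y by (auto simp: orb_def)
  then have le: "d \<le> card (orb x)" using d(3) card_mono[OF finite_orb] by metis
  have "d dvd p ^ e"
    using d(4) pow_eq_id[OF y(1), of "p ^ e"] y(3) dvd_trans by blast
  then obtain k where k: "d = p ^ k" using divides_primepow_nat[OF y(2)] by blast
  have "d \<noteq> 1" using d(2)[of 1 0] y x by auto
  then have "k \<noteq> 0" using k by (cases k) auto
  moreover have "\<not> k \<ge> 2"
  proof
    assume "k \<ge> 2"
    then have "p ^ 2 \<le> p ^ k" using prime_ge_1_nat[OF y(2)] \<open>k \<ge> 2\<close> by (intro power_increasing) auto
    then show False using k le x(3) by (simp add: power2_eq_square)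
  qed
  ultimately have "k = 1" by linarith
  then have "d = p" using k by simp
  then show "act (y [^] i) x = act (y [^] j) x \<longleftrightarrow> i mod p = j mod p"
    "card (range (\<lambda>i::nat. act (y [^] i) x)) = p"
    using d by auto
qed

lemma act_pow_Suc:
  "g \<in> carrier G \<Longrightarrow> x \<in> E \<Longrightarrow> act (g [^] Suc i) x = act g (act (g [^] i) x)"
  using nat_pow_Suc2[of g i] by (simp add: act_mult del: nat_pow_Suc)

lemma act_pow_add:
  "g \<in> carrier G \<Longrightarrow> x \<in> E \<Longrightarrow> act (g [^] (i + j :: nat)) x = act (g [^] i) (act (g [^] j) x)"
  by (simp add: act_mult[symmetric] nat_pow_mult)

lemma act_pow_fixed:
  assumes "g \<in> carrier G" "x \<in> E" "act g x = x"
  shows "act (g [^] (i::nat)) x = x"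
proof (induction i)
  case (Suc i)
  then show ?case using act_pow_Suc[OF assms(1,2), of i] assms(3) by metis
qed (use assms in simp)

lemma prime_cycle:
  fixes p :: nat
  assumes "y \<in> carrier G" "prime p" "y [^] (p ^ e) = \<one>"
    and x: "x \<in> E" "act y x \<noteq> x" "card (orb x) = p"
  shows "act (y [^] (i::nat)) x = act (y [^] (j::nat)) x \<longleftrightarrow> i mod p = j mod p"
    "orb x = range (\<lambda>i::nat. act (y [^] i) x)"
    "z \<in> orb x \<Longrightarrow> act y z \<noteq> z"
proof -
  have "card (orb x) < p * p" using x(3) prime_gt_1_nat[OF assms(2)] by simp
  note per = prime_period[OF assms(1-3) x(1,2) this]
  show eq: "act (y [^] i) x = act (y [^] j) x \<longleftrightarrow> i mod p = j mod p" for i j :: nat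
    by (rule per(1))
  show orb: "orb x = range (\<lambda>i::nat. act (y [^] i) x)"
    by (rule card_seteq[symmetric]) (use per(2) x(3) assms(1) finite_carrier in \<open>auto simp: orb_def\<close>)
  assume "z \<in> orb x"
  then obtain i :: nat where "z = act (y [^] i) x" using orb by auto
  moreover have "Suc i mod p \<noteq> i mod p"
    using prime_gt_1_nat[OF assms(2)] by (metis One_nat_def add_cancel_right_left mod_Suc n_not_Suc_n not_less_eq  mod_less_divisor less_numeral_extra(4) nat.distinct(1) zero_less_Suc)
  ultimately show "act y z \<noteq> z"
    using eq[of "Suc i" i] act_pow_Suc[OF assms(1) x(1), of i] by simp
qed

end

section \<open>Excluding orbits of size 4 and pairs of orbits of size 3\<close>

context six_max_cyclic
begin

text \<open>Some \<open>y\<close> of 3-power order acts on the orbit as a 3-cycle with one fixed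
  point \<open>u\<close>, and some \<open>cyc c\<close> outside the orbit has a generator
  \<open>c\<close> without fixed points on it. As \<open>y\<close> normalises \<open>cyc c\<close>
  and fixes \<open>u\<close>, \<open>c\<close> turns out to be a 4-cycle and \<open>y\<close> to act
  on its exponents as multiplication by \<open>r\<close> modulo 4. Units modulo 4 have square 1, so
  this cannot be a 3-cycle.\<close>

lemma card_orb_neq_4:
  assumes w: "w \<in> max_cyclic"
  shows "card (orb w) \<noteq> 4"
proof
  assume four: "card (orb w) = 4"
  have small: "card (orb D) \<le> 2" if "D \<in> max_cyclic" "D \<notin> orb w" for D
    using card_disjoint_orbits[OF w that] four by simp
  obtain p e y z where y: "prime (p::nat)" "p \<noteq> 2" "y \<in> carrier G" "y [^] (p ^ e) = \<one>"
    and z: "z \<in> max_cyclic" "act y z \<noteq> z"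
    using ex_odd_moving by blast
  have "\<not> card (orb z) < p"
    using prime_power_elt_fixes_small_orb[OF y(3,1,4) z(1)] z(2) by blast
  moreover have "p \<ge> 3" using y(1,2) prime_ge_2_nat[OF y(1)] by linarith
  ultimately have zw: "z \<in> orb w" using small[OF z(1)] by linarith
  then have orbz: "orb z = orb w" using action.orb_eq[OF w] by blast
  have "p \<noteq> 4"
  proof
    assume "p = 4"
    then have "2 dvd p" by simp
    then show False using y(1,2) primes_dvd_imp_eq[OF two_is_prime_nat] by blast
  qed
  then have p3: "p = 3" using \<open>\<not> card (orb z) < p\<close> \<open>p \<ge> 3\<close> four orbz by simp
  have yfix: "act y D = D" if "D \<in> max_cyclic" "D \<notin> orb w" for D
    using prime_power_elt_fixes_small_orb[OF y(3,1,4) that(1)] small[OF that] p3 by simp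
  have inE: "v \<in> max_cyclic" if "v \<in> orb w" for v
    using that action.orb_subset[OF w] by blast
  have per: "act (y [^] (i::nat)) v = act (y [^] (j::nat)) v \<longleftrightarrow> i mod 3 = j mod 3"
    and percard: "card (range (\<lambda>i::nat. act (y [^] i) v)) = 3"
    if "v \<in> orb w" "act y v \<noteq> v" for v i j
    using action.prime_period[OF y(3,1,4) inE[OF that(1)] that(2)] p3 four action.orb_eq[OF w that(1)] by auto
  define Y where "Y = range (\<lambda>i::nat. act (y [^] i) z)"
  have YI: "act (y [^] n) z \<in> Y" for n :: nat by (simp add: Y_def)
  have Y: "card Y = 3" "Y \<subseteq> orb w"
    using percard[OF zw z(2)] y(3) zw action.orb_act[OF w] by (auto simp: Y_def)
  have Ymove: "act y v \<noteq> v" if v: "v \<in> Y" for v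
  proof -
    obtain i :: nat where i: "v = act (y [^] i) z" using v by (auto simp: Y_def)
    have "Suc i mod 3 \<noteq> i mod 3" by presburger
    then show ?thesis
      using per[OF zw z(2), of "Suc i" i] action.act_pow_Suc[OF y(3) z(1), of i] i by simp
  qed
  have "card (orb w - Y) = 1"
    using Y four by (subst card_Diff_subset) (auto intro: finite_subset)
  then obtain u where u: "orb w - Y = {u}" by (metis card_1_singletonE)
  then have uw: "u \<in> orb w" "u \<notin> Y" by auto
  have yu: "act y u = u"
  proof (rule ccontr)
    assume move: "act y u \<noteq> u"
    have "act y u \<notin> Y"
    proof
      assume "act y u \<in> Y"
      then obtain i :: nat where i: "act y u = act (y [^] i) z" by (auto simp: Y_def)
      \<comment> \<open>The exponent \<open>i + 2\<close> stands for \<open>i - 1\<close> modulo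
        3.\<close>
      have "act (y [^] i) z = act (y [^] Suc (i + 2)) z"
      proof (rule per[OF zw z(2), THEN iffD2])
        show "i mod 3 = Suc (i + 2) mod 3" by presburger
      qed
      also have "\<dots> = act y (act (y [^] (i + 2)) z)"
        by (rule action.act_pow_Suc[OF y(3) z(1)])
      finally have "u = act (y [^] (i + 2)) z"
        using i action.act_inj[OF y(3), of u] inE[OF uw(1)] y(3) z(1) by simp
      then show False using uw(2) YI[of "i + 2"] by simp
    qed
    then show False using action.orb_act[OF w y(3) uw(1)] u move by blast
  qed
  \<comment> \<open>Jordan's argument gives \<open>f\<close>. The maximal cyclic subgroup containing
    \<open>f\<close> is fixed by it and so lies outside the orbit; its generator \<open>c\<close>
    inherits the absence of fixed points.\<close>
  obtain f where f: "f \<in> carrier G" "\<And>v. v \<in> orb w \<Longrightarrow> act f v \<noteq> v"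
    using action.ex_fixed_point_free[OF w] four by auto
  obtain D where D: "D \<in> max_cyclic" "f \<in> D" "act f D = D" using f(1) by (rule fixes_some)
  then have Dw: "D \<notin> orb w" using f(2) by blast
  obtain c where c: "c \<in> carrier G" "D = cyc c" using D(1) by (rule max_cyclicE)
  have cmove: "act c v \<noteq> v" if v: "v \<in> orb w" for v
  proof
    assume "act c v = v"
    moreover obtain k :: nat where "f = c [^] k" using D(2) c by (auto elim: cycE)
    ultimately have "act f v = v" using action.act_pow_fixed[OF c(1) inE[OF v]] by simp
    then show False using f(2)[OF v] by simp
  qed
  define v where "v = act c u"
  have v: "v \<in> orb w" "v \<noteq> u" using action.orb_act[OF w c(1) uw(1)] cmove[OF uw(1)] by (auto simp: v_def)
  then have "v \<in> Y" using u by blast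
  note yv = Ymove[OF this]
  have "y \<otimes> c \<otimes> inv y \<in> cyc c"
    using yfix[OF D(1) Dw] conj_set_cyc[OF y(3) c(1)] c y(3) cyc_self[of "y \<otimes> c \<otimes> inv y"] by simp
  then obtain r :: nat where r: "y \<otimes> c \<otimes> inv y = c [^] r" by (rule cycE)
  have uE: "u \<in> max_cyclic" using inE uw by blast
  \<comment> \<open>Because \<open>y\<close> fixes \<open>u\<close>, it acts on the
    \<open>c\<close>-cycle of \<open>u\<close> by multiplying exponents with
    \<open>r\<close>.\<close>
  have yc: "act y (act (c [^] i) u) = act (c [^] (r * i)) u" for i :: nat
  proof -
    have "y \<otimes> c [^] i = c [^] (r * i) \<otimes> y"
      using conj_pow[OF y(3) c(1), of i] r c(1) y(3) by (simp add: nat_pow_pow) (metis inv_solve_right' m_closed nat_pow_closed)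
    then have "act y (act (c [^] i) u) = act (c [^] (r * i)) (act y u)"
      using action.act_mult[OF y(3) _ uE, of "c [^] i"] action.act_mult[OF _ y(3) uE, of "c [^] (r * i)"] c(1) by simp
    then show ?thesis using yu by simp
  qed
  have v1: "act (c [^] (1::nat)) u = v" using c(1) by (simp add: v_def)
  have yv1: "act y v = act (c [^] r) u" using yc[of 1] v1 by simp
  have yv2: "act y (act y v) = act (c [^] (r * r)) u" using yc[of r] yv1 by simp
  have vE: "v \<in> max_cyclic" using inE v by blast
  have y2: "act (y [^] (2::nat)) v = act y (act y v)"
    using action.act_pow_Suc[OF y(3) vE, of 1] y(3) by (simp add: numeral_2_eq_2)
  have d1: "act y (act y v) \<noteq> v" using per[OF v(1) yv, of 2 0] y2 vE by auto
  have d2: "act y (act y v) \<noteq> act y v"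
    using action.act_inj[OF y(3), of "act y v" v] yv vE y(3) by simp
  have d3: "act y v \<noteq> u" using action.act_inj[OF y(3), of v u] yu vE uE v(2) by auto
  have d4: "act y (act y v) \<noteq> u" using action.act_inj[OF y(3), of "act y v" u] yu vE uE d3 y(3) by auto
  obtain d :: nat where d: "0 < d" "\<And>i j. act (c [^] i) u = act (c [^] j) u \<longleftrightarrow> i mod d = j mod d"
    "card (range (\<lambda>i::nat. act (c [^] i) u)) = d"
    by (rule action.period[OF c(1) uE]) (rule that)
  have u0: "act (c [^] (0::nat)) u = u" using uE by simp
  have "{u, v, act y v, act y (act y v)} \<subseteq> range (\<lambda>i::nat. act (c [^] i) u)"
    using u0 v1 yv1 yv2 by (metis empty_subsetI insert_subset rangeI)
  moreover have "card {u, v, act y v, act y (act y v)} = 4"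
    using d1 d2 d3 d4 v(2) yv by (simp add: eq_commute)
  moreover have rsub: "range (\<lambda>i::nat. act (c [^] i) u) \<subseteq> orb w"
    using action.orb_act[OF w _ uw(1)] c(1) by auto
  ultimately have "4 \<le> d" "d \<le> 4"
    using d(3) four card_mono[OF _ rsub] card_mono[of "range (\<lambda>i::nat. act (c [^] i) u)" "{u, v, act y v, act y (act y v)}"]
      finite_subset[OF rsub] by auto
  then have "d = 4" by simp
  note eq = d(2)[unfolded this]
  \<comment> \<open>The distinct points \<open>u\<close>, \<open>v\<close>, \<open>act y v\<close>,
    \<open>act y (act y v)\<close> have exponents 0, 1, \<open>r\<close>, \<open>r * r\<close>. No
    residue modulo 4 avoids 0 and 1 together with its square.\<close>
  have "r mod 4 \<noteq> 0" using eq[of r 0] u0 yv1 d3 by auto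
  moreover have "r mod 4 \<noteq> 1" using eq[of r 1] v1 yv1 yv by auto
  moreover have "(r * r) mod 4 \<noteq> 0" using eq[of "r * r" 0] u0 yv2 d4 by auto
  moreover have "(r * r) mod 4 \<noteq> 1" using eq[of "r * r" 1] v1 yv2 d1 by auto
  moreover have "r mod 4 < 4" by simp
  then have "r mod 4 = 0 \<or> r mod 4 = 1 \<or> r mod 4 = 2 \<or> r mod 4 = 3" by linarith
  moreover have "(r * r) mod 4 = (r mod 4) * (r mod 4) mod 4" by (simp add: mod_mult_eq)
  ultimately show False by auto
qed

text \<open>There would be elements \<open>y\<close> and \<open>y'\<close>, each rotating one orbit
  and fixing the other pointwise. Their product would have no fixed point, contrary to
  \<open>fixes_some\<close>.\<close>

lemma not_two_orbits_3:
  assumes w: "w \<in> max_cyclic" "card (orb w) = 3" and w': "w' \<in> max_cyclic" "w' \<notin> orb w"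
  shows "card (orb w') \<noteq> 3"
proof
  assume three: "card (orb w') = 3"
  have p3: "prime (3::nat)" by simp
  have disj: "orb w \<inter> orb w' = {}"
    using action.orb_disjoint[OF w(1) w'(1)] w' action.orb_refl by blast
  then have "card (orb w \<union> orb w') = 6"
    using w(2) three by (simp add: card_Un_disjoint)
  then have all: "max_cyclic = orb w \<union> orb w'"
    using card_seteq[OF finite_max_cyclic, of "orb w \<union> orb w'"] action.orb_subset w w' card_six by simp
  \<comment> \<open>An element of 3-power order that rotates one orbit lies in a point of the other.
    It fixes that point, and then also the two remaining ones. The orbits are variables so that
    their roles can be exchanged.\<close>
  have key: "act y z = z"
    if v: "v \<in> max_cyclic" "card (orb v) = 3" and all: "max_cyclic = orb v \<union> orb v'" "v' \<in> max_cyclic"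
      "card (orb v') = 3" and y: "y \<in> carrier G" "y [^] ((3::nat) ^ e) = \<one>" "act y v \<noteq> v"
      and z: "z \<in> orb v'" for v v' y e z
  proof -
    obtain D where D: "D \<in> max_cyclic" "y \<in> D" "act y D = D" using y(1) by (rule fixes_some)
    have "D \<notin> orb v" using action.prime_cycle(3)[OF y(1) p3 y(2) v(1) y(3) v(2)] D(3) by blast
    then have Dv: "D \<in> orb v'" using D(1) all by blast
    have sub: "orb v' \<subseteq> max_cyclic" using action.orb_subset all by blast
    show ?thesis
    proof (cases "z = D")
      case False
      show ?thesis
      proof (rule action.prime_power_elt_fixes_small[OF y(1) p3 y(2), of "orb v' - {D}"])
        fix x assume x: "x \<in> orb v' - {D}"
        then have "act y x \<noteq> D"
          using action.act_inj[OF y(1), of x D] D sub by auto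
        then show "act y x \<in> orb v' - {D}" using action.orb_act[OF all(2) y(1)] x by blast
      qed (use sub Dv all z False in auto)
    qed (use D in simp)
  qed
  obtain y e where y: "y \<in> carrier G" "y [^] ((3::nat) ^ e) = \<one>" "act y w \<noteq> w"
    using action.ex_prime_power_moving[OF w(1) p3 w(2)] by blast
  obtain y' e' where y': "y' \<in> carrier G" "y' [^] ((3::nat) ^ e') = \<one>" "act y' w' \<noteq> w'"
    using action.ex_prime_power_moving[OF w'(1) p3 three] by blast
  obtain D where D: "D \<in> max_cyclic" "act (y \<otimes> y') D = D"
    using fixes_some[of "y \<otimes> y'"] y y' by blast
  then have yD: "act y (act y' D) = D" using action.act_mult y y' by simp
  consider "D \<in> orb w" | "D \<in> orb w'" using D all by blast
  then show False
  proof cases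
    case 1
    have "act y' D = D"
      using key[of w' w y' e' D] w w' three all y' 1 by (simp add: Un_commute)
    then show False
      using action.prime_cycle(3)[OF y(1) p3 y(2) w(1) y(3) w(2) 1] yD by simp
  next
    case 2
    then have "act y' D \<in> orb w'" using action.orb_act[OF w'(1) y'(1)] by blast
    then have "act y' D = D"
      using key[OF w all w'(1) three y] yD by simp
    then show False
      using action.prime_cycle(3)[OF y'(1) p3 y'(2) w'(1) y'(3) three 2] by simp
  qed
qed

lemma ex_prime_orbit:
  obtains w where "w \<in> max_cyclic" "card (orb w) = 3 \<or> card (orb w) = 5"
    "\<And>D. D \<in> max_cyclic \<Longrightarrow> D \<notin> orb w \<Longrightarrow> card (orb D) \<le> 2"
proof -
  obtain p e y w where y: "prime (p::nat)" "p \<noteq> 2" "y \<in> carrier G" "y [^] (p ^ e) = \<one>"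
    and w: "w \<in> max_cyclic" "act y w \<noteq> w"
    using ex_odd_moving by blast
  have "\<not> card (orb w) < p"
    using prime_power_elt_fixes_small_orb[OF y(3,1,4) w(1)] w(2) by blast
  moreover have "p \<ge> 3" using y(1,2) prime_ge_2_nat[OF y(1)] by linarith
  ultimately have c: "card (orb w) = 3 \<or> card (orb w) = 5"
    using card_orb_le_5[OF w(1)] card_orb_neq_4[OF w(1)] by linarith
  have "card (orb D) \<le> 2" if D: "D \<in> max_cyclic" "D \<notin> orb w" for D
    using card_disjoint_orbits[OF w(1) D] not_two_orbits_3[OF w(1) _ D] c by linarith
  then show ?thesis using that w(1) c by blast
qed

end

section \<open>The Frobenius action on an orbit of prime size\<close>

text \<open>The solution is \<open>n / (1 - r)\<close> modulo \<open>p\<close>, computed in the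
  integers because \<open>1 - r\<close> may be negative.\<close>

lemma ex_affine_fixed_point:
  fixes p r n :: nat
  assumes p: "prime p" and r: "\<not> [r = 1] (mod p)"
  shows "\<exists>k. [r * k + n = k] (mod p)"
proof -
  have "\<not> int p dvd 1 - int r"
    using r by (metis cong_iff_dvd_diff cong_int_iff cong_sym of_nat_1)
  then have "coprime (1 - int r) (int p)"
    using p by (metis coprime_commute prime_imp_coprime prime_nat_int_transfer)
  then obtain x where x: "[(1 - int r) * x = 1] (mod int p)"
    using cong_solve_coprime_int by blast
  define k where "k = nat ((int n * x) mod int p)"
  have pos: "int p > 0" using p prime_gt_0_nat by simp
  then have "[int k = int n * x] (mod int p)"
    by (simp add: k_def cong_def)
  then have "[(1 - int r) * int k = (1 - int r) * (int n * x)] (mod int p)"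
    by (rule cong_scalar_left)
  also have "(1 - int r) * (int n * x) = int n * ((1 - int r) * x)" by simp
  also have "[int n * ((1 - int r) * x) = int n * 1] (mod int p)"
    by (rule cong_scalar_left[OF x])
  finally have "[int n = int k - int r * int k] (mod int p)"
    by (simp add: cong_sym left_diff_distrib)
  then have "[int r * int k + int n = int r * int k + (int k - int r * int k)] (mod int p)"
    by (rule cong_add[OF cong_refl])
  then have "[int (r * k + n) = int k] (mod int p)" by simp
  then show ?thesis using cong_int_iff by blast
qed

locale frobenius_orbit = six_max_cyclic +
  fixes p e :: nat and w :: "'a set" and y :: 'a
  assumes p35: "p = 3 \<or> p = 5"
    and w: "w \<in> max_cyclic" and card_orb: "card (orb w) = p"
    and others: "\<And>D. D \<in> max_cyclic \<Longrightarrow> D \<notin> orb w \<Longrightarrow> card (orb D) \<le> 2"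
    and y: "y \<in> carrier G" and y_pow: "y [^] (p ^ e) = \<one>" and y_moves: "act y w \<noteq> w"
begin

lemma prime_p: "prime p"
proof -
  have "prime (3::nat)" "prime (5::nat)" by simp_all
  then show ?thesis using p35 by auto
qed

text \<open>Identifies the orbit with the residues modulo \<open>p\<close>: \<open>w\<close> becomes
  0 and \<open>y\<close> the translation by 1.\<close>

definition pt :: "nat \<Rightarrow> 'a set" where
  "pt i = act (y [^] i) w"

lemma pt_eq: "pt i = pt j \<longleftrightarrow> [i = j] (mod p)"
  unfolding pt_def cong_def
  by (rule action.prime_cycle(1)[OF y prime_p y_pow w y_moves card_orb])

lemma orb_eq_range: "orb w = range pt"
  unfolding pt_def[abs_def]
  by (rule action.prime_cycle(2)[OF y prime_p y_pow w y_moves card_orb])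

lemma pt_orb [simp]: "pt i \<in> orb w"
  by (simp add: orb_eq_range)

lemma ptE: "z \<in> orb w \<Longrightarrow> (\<And>i. z = pt i \<Longrightarrow> thesis) \<Longrightarrow> thesis"
  by (auto simp: orb_eq_range)

lemma orbw_sub: "orb w \<subseteq> max_cyclic"
  by (rule action.orb_subset[OF w])

lemma pt_max_cyclic [simp]: "pt i \<in> max_cyclic"
  using orbw_sub pt_orb by blast

lemma pt_0: "pt 0 = w"
  using w by (simp add: pt_def)

lemma act_pow_pt: "act (y [^] n) (pt i) = pt (n + i)"
  unfolding pt_def by (rule action.act_pow_add[OF y w, symmetric])

lemma act_y_pt: "act y (pt i) = pt (Suc i)"
  using act_pow_pt[of 1 i] y by simp

lemma act_pt_orb: "g \<in> carrier G \<Longrightarrow> act g (pt i) \<in> orb w"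
  by (rule action.orb_act[OF w]) auto

lemma act_y_others: "D \<in> max_cyclic \<Longrightarrow> D \<notin> orb w \<Longrightarrow> act y D = D"
  by (rule prime_power_elt_fixes_small_orb[OF y prime_p y_pow]) (use others p35 in fastforce)+

text \<open>For \<open>p = 3\<close> every permutation of the residues fixing 0 is a multiplication.
  For \<open>p = 5\<close> this fails in general, and the position of \<open>y\<close> outside the
  orbit has to be used.\<close>

lemma act_stab_pt:
  assumes s: "s \<in> carrier G" "act s w = w"
  obtains r where "\<And>i. act s (pt i) = pt (r * i)"
proof -
  obtain r where r: "act s (pt 1) = pt r" using act_pt_orb[OF s(1)] by (rule ptE)
  show ?thesis
  proof (cases "p = 3")
    case True
    obtain k where k: "act s (pt 2) = pt k" using act_pt_orb[OF s(1)] by (rule ptE)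
    have s0: "act s (pt 0) = pt 0" using s pt_0 by simp
    have ne: "act s (pt i) \<noteq> act s (pt j)" if "\<not> [i = j] (mod p)" for i j
      using action.act_inj[OF s(1), of "pt i" "pt j"] that pt_eq by simp
    have "r mod 3 \<noteq> 0" "k mod 3 \<noteq> 0" "k mod 3 \<noteq> r mod 3"
      using ne[of 1 0] ne[of 2 0] ne[of 2 1] r k s0 pt_eq[of r 0] pt_eq[of k 0] pt_eq[of k r] True
      by (auto simp: cong_def)
    moreover have "r mod 3 < 3" "k mod 3 < 3" by simp_all
    ultimately have "r mod 3 = 1 \<and> k mod 3 = 2 \<or> r mod 3 = 2 \<and> k mod 3 = 1" by linarith
    moreover have "(r * 2) mod 3 = (r mod 3 * 2) mod 3" by (simp add: mod_mult_left_eq)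
    ultimately have kr: "k mod 3 = (r * 2) mod 3" by auto
    have "act s (pt i) = pt (r * i)" for i
    proof -
      have *: "pt i = pt j \<and> pt (r * i) = pt (r * j)" if "i mod 3 = j mod 3" for j
      proof -
        have "[i = j] (mod p)" using that True by (simp add: cong_def)
        then show ?thesis using pt_eq cong_scalar_left[of i j p r] by blast
      qed
      consider "i mod 3 = 0" | "i mod 3 = 1" | "i mod 3 = 2" by linarith
      then show ?thesis
      proof cases
        case 1
        then show ?thesis using *[of 0] s0 by simp
      next
        case 2
        then show ?thesis using *[of 1] r by simp
      next
        case 3
        moreover have "pt (r * 2) = pt k" using pt_eq kr True by (simp add: cong_def)
        ultimately show ?thesis using *[of 2] k by simp
      qed
    qed
    then show ?thesis by (rule that)
  next
    case False
    \<comment> \<open>Only one of the six points lies outside an orbit of size 5, so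
      \<open>s\<close> fixes the \<open>D\<close> containing \<open>y\<close>. Hence the conjugate
      \<open>z\<close> of \<open>y\<close> lies in \<open>D\<close> and commutes with the 5-cycle
      \<open>y\<close>, which makes \<open>z\<close> the translation by some \<open>q\<close> and
      \<open>s\<close> the multiplication by \<open>q\<close>.\<close>
    obtain D where D: "D \<in> max_cyclic" "y \<in> D" "act y D = D" using y by (rule fixes_some)
    have "D \<notin> orb w"
      using action.prime_cycle(3)[OF y prime_p y_pow w y_moves card_orb] D(3) by blast
    then have "card (orb D) \<le> 1"
      using card_disjoint_orbits[OF w D(1)] card_orb p35 False by simp
    moreover have "D \<in> orb D" "act s D \<in> orb D"
      using D(1) s(1) action.orb_act[OF D(1)] by auto
    ultimately have sD: "act s D = D"
      by (metis action.finite_orb card_le_Suc0_iff_eq One_nat_def)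
    define z where "z = s \<otimes> y \<otimes> inv s"
    have zG: "z \<in> carrier G" using s y by (simp add: z_def)
    have "z \<in> D" using sD D(2) unfolding z_def conj_set_def by blast
    then have zy: "z \<otimes> y = y \<otimes> z" using max_cyclic_commute D by blast
    have "act z w \<in> orb w" using action.orb_act[OF w zG] w by simp
    then obtain q where q: "act z w = pt q" by (rule ptE)
    have zi: "act (z [^] i) w = pt (q * i)" for i :: nat
    proof (induction i)
      case (Suc i)
      have "act (z [^] Suc i) w = act z (act (z [^] i) w)"
        by (rule action.act_pow_Suc[OF zG w])
      also have "\<dots> = act (z \<otimes> y [^] (q * i)) w"
        unfolding Suc pt_def using action.act_mult[OF zG _ w] y by simp
      also have "z \<otimes> y [^] (q * i) = y [^] (q * i) \<otimes> z"
        by (rule commute_pow[OF zG y zy])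
      also have "act (y [^] (q * i) \<otimes> z) w = pt (q * i + q)"
        using action.act_mult[OF _ zG w] y q act_pow_pt by simp
      finally show ?case by (simp add: add.commute)
    qed (use w pt_0 in simp)
    have "act s (pt i) = pt (q * i)" for i
    proof -
      have "s \<otimes> y [^] i = z [^] i \<otimes> s"
        unfolding z_def conj_pow[OF s(1) y] using s y by (simp add: m_assoc)
      then have "act s (pt i) = act (z [^] i) (act s w)"
        unfolding pt_def
        using action.act_mult[OF s(1) _ w, of "y [^] i"] action.act_mult[OF _ s(1) w, of "z [^] i"] y zG by simp
      then show ?thesis using s zi by simp
    qed
    then show ?thesis by (rule that)
  qed
qed

definition ker :: "'a set" where
  "ker = {g \<in> carrier G. \<forall>z\<in>orb w. act g z = z}"

lemma ker_subgroup: "subgroup ker G"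
proof -
  have "ker = \<Inter> (action.stab ` orb w)"
    using action.orb_refl[OF w] by (auto simp: ker_def action.stab_def)
  then show ?thesis
    using action.stab_subgroup orbw_sub action.orb_refl[OF w] subgroups_Inter[of "action.stab ` orb w"] by auto
qed

lemma kerI:
  assumes "g \<in> carrier G" "\<And>i. act g (pt i) = pt i"
  shows "g \<in> ker"
  using assms by (auto simp: ker_def orb_eq_range)

lemma ker_act: "t \<in> ker \<Longrightarrow> act t (pt i) = pt i"
  by (simp add: ker_def)

lemma ker_closed: "t \<in> ker \<Longrightarrow> t \<in> carrier G"
  by (simp add: ker_def)

lemma fixed_pt_unique:
  assumes s: "\<And>i. act s (pt i) = pt (r * i)" and r: "\<not> [r = 1] (mod p)" and "act s (pt i) = pt i"
  shows "pt i = w"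
proof -
  have "[r * i = i] (mod p)" using assms pt_eq by metis
  then have "[r * i = 1 * i] (mod p)" by simp
  then have "\<not> coprime i p" using r cong_mult_rcancel_nat by blast
  then have "p dvd i" using prime_p by (metis coprime_commute prime_imp_coprime)
  then show ?thesis using pt_eq[of i 0] pt_0 by (simp add: cong_0_iff)
qed

lemma in_ker_if_multiplier_1:
  assumes "s \<in> carrier G" "\<And>i. act s (pt i) = pt (r * i)" "[r = 1] (mod p)"
  shows "s \<in> ker"
proof (rule kerI[OF assms(1)])
  fix i
  have "[r * i = 1 * i] (mod p)" using assms(3) by (rule cong_scalar_right)
  then show "act s (pt i) = pt i" using assms(2) pt_eq by simp
qed

text \<open>Such an \<open>s\<close> has \<open>w\<close> as its only fixed point on the orbit. If
  \<open>s\<close> lay in a point \<open>D\<close> outside the orbit, all of \<open>D\<close> would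
  commute with \<open>s\<close> and hence fix \<open>w\<close>. As \<open>y\<close> normalises
  \<open>D\<close>, \<open>s\<close> would be the \<open>y\<close>-conjugate of an element fixing
  \<open>w\<close> and would fix \<open>pt 1\<close> as well.\<close>

lemma stab_not_ker_in_w:
  assumes s: "s \<in> carrier G" "act s w = w" and nk: "s \<notin> ker"
  shows "s \<in> w"
proof -
  obtain r where r: "\<And>i. act s (pt i) = pt (r * i)" by (rule act_stab_pt[OF s]) (rule that)
  then have r1: "\<not> [r = 1] (mod p)" using nk in_ker_if_multiplier_1 s by blast
  obtain D where D: "D \<in> max_cyclic" "s \<in> D" "act s D = D" using s(1) by (rule fixes_some)
  show ?thesis
  proof (cases "D \<in> orb w")
    case True
    then obtain i where i: "D = pt i" by (rule ptE)
    have "pt i = w" by (rule fixed_pt_unique[OF r r1]) (use D i in simp)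
    then show ?thesis using D i by simp
  next
    case False
    obtain c where c: "c \<in> carrier G" "D = cyc c" using D(1) by (rule max_cyclicE)
    have "s \<otimes> c = c \<otimes> s" using max_cyclic_commute[OF D(1)] D(2) c by simp
    then have "act s (act c w) = act c w"
      using action.act_mult[OF s(1) c(1) w] action.act_mult[OF c(1) s(1) w] s(2) by simp
    moreover have "act c w \<in> orb w" using action.orb_act[OF w c(1)] w by simp
    ultimately have "act c w = w" using fixed_pt_unique[OF r r1] by (metis ptE)
    then have Dw: "act h w = w" if "h \<in> D" for h
      using that c action.act_pow_fixed[OF c(1) w] by (auto elim: cycE)
    have "act y D = D" using act_y_others D(1) False by blast
    then obtain h where h: "h \<in> D" "s = y \<otimes> h \<otimes> inv y"
      using D(2) unfolding conj_set_def by blast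
    have hG: "h \<in> carrier G" using h(1) c cyc_closed by blast
    have "s \<otimes> y = y \<otimes> h" using h(2) hG y by (simp add: m_assoc)
    then have "act s (act y w) = act y (act h w)"
      using action.act_mult[OF s(1) y w] action.act_mult[OF y hG w] by simp
    then have "act s (pt 1) = pt 1" using Dw[OF h(1)] act_y_pt[of 0] pt_0 by simp
    then have "pt 1 = w" by (rule fixed_pt_unique[OF r r1])
    then have "[1 = 0] (mod p)" using pt_eq[of 1 0] pt_0 by simp
    then show ?thesis using p35 by (auto simp: cong_def)
  qed
qed

lemma commutator_fixes:
  assumes C: "C \<in> max_cyclic" and g: "g \<in> carrier G" and h: "h \<in> carrier G"
    and comm: "\<And>z. z \<in> orb C \<Longrightarrow> act g (act h z) = act h (act g z)"
  shows "act (commutator G g h) C = C"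
proof -
  define u where "u = act (inv g \<otimes> inv h) C"
  have u: "u \<in> orb C" "u \<in> max_cyclic"
    using action.orb_act[OF C _ action.orb_refl[OF C]] C g h by (auto simp: u_def)
  have "act (commutator G g h) C = act (g \<otimes> h) u"
    using action.act_mult[of "g \<otimes> h" "inv g \<otimes> inv h" C] C g h by (simp add: u_def m_assoc)
  also have "\<dots> = act (h \<otimes> g) u"
    using comm[OF u(1)] action.act_mult[OF g h u(2)] action.act_mult[OF h g u(2)] by simp
  also have "\<dots> = act ((h \<otimes> g) \<otimes> (inv g \<otimes> inv h)) C"
    using action.act_mult[of "h \<otimes> g" "inv g \<otimes> inv h" C] C g h by (simp add: u_def)
  also have "(h \<otimes> g) \<otimes> (inv g \<otimes> inv h) = \<one>" using g h by (simp add: group_normalize)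
  finally show ?thesis using C by simp
qed

text \<open>The symmetric group on at most two letters is abelian.\<close>

lemma commute_on_small_orbit:
  assumes C: "C \<in> max_cyclic" "card (orb C) \<le> 2" and z: "z \<in> orb C"
    and g: "g \<in> carrier G" and h: "h \<in> carrier G"
  shows "act g (act h z) = act h (act g z)"
proof -
  have in_orb: "act k x \<in> orb C" if "k \<in> carrier G" "x \<in> orb C" for k x
    using action.orb_act[OF C(1)] that by blast
  have sub: "x \<in> max_cyclic" if "x \<in> orb C" for x using action.orb_subset[OF C(1)] that by blast
  have two: "x3 = x1 \<or> x3 = x2" if "x1 \<in> orb C" "x2 \<in> orb C" "x1 \<noteq> x2" "x3 \<in> orb C" for x1 x2 x3
  proof (rule ccontr)
    assume "\<not> ?thesis"
    then have "x1 \<notin> {x2, x3}" "x2 \<notin> {x3}" using that by auto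
    then have "card {x1, x2, x3} = 3" by simp
    moreover have "card {x1, x2, x3} \<le> card (orb C)" using that by (intro card_mono) auto
    ultimately show False using C(2) by simp
  qed
  have inj: "act k x1 = act k x2 \<longleftrightarrow> x1 = x2" if "k \<in> carrier G" "x1 \<in> orb C" "x2 \<in> orb C" for k x1 x2
    using action.act_inj that sub by blast
  have gz: "act g z \<in> orb C" and hz: "act h z \<in> orb C" using in_orb g h z by auto
  show ?thesis
  proof (cases "act g z = z")
    case True
    then have "act g (act h z) = act h z" if "act h z \<noteq> z"
      using two[OF z hz that[symmetric] in_orb[OF g hz]] inj[OF g hz z] that by auto
    then show ?thesis using True by metis
  next
    case False
    have ggz: "act g (act g z) = z"
      using two[OF z gz False[symmetric] in_orb[OF g gz]] inj[OF g gz z] False by auto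
    show ?thesis
    proof (cases "act h z = z")
      case True
      then have "act h (act g z) = act g z"
        using two[OF z gz False[symmetric] in_orb[OF h gz]] inj[OF h gz z] False by auto
      then show ?thesis using True by simp
    next
      case F2: False
      then have "act h z = act g z" using two[OF z gz False[symmetric] hz] by blast
      then have "act h (act g z) = z"
        using two[OF z gz False[symmetric] in_orb[OF h gz]] inj[OF h gz z] False by auto
      then show ?thesis using ggz \<open>act h z = act g z\<close> by simp
    qed
  qed
qed

text \<open>Otherwise \<open>G\<close> acts on the orbit by translations, and on the small orbits
  through abelian groups as well. All commutators would then fix every point and lie in the norm,
  which contradicts \<open>not_commute\<close>.\<close>

lemma ex_stab_not_ker: "\<exists>s\<in>carrier G. act s w = w \<and> s \<notin> ker"
proof (rule ccontr)
  assume "\<not> ?thesis"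
  then have stab: "s \<in> ker" if "s \<in> carrier G" "act s w = w" for s using that by blast
  have shift: "\<exists>n. \<forall>i. act g (pt i) = pt (n + i)" if g: "g \<in> carrier G" for g
  proof -
    have "act g w \<in> orb w" using action.orb_act[OF w g] w by simp
    then obtain n where n: "act g w = pt n" by (rule ptE)
    have "act (inv (y [^] n) \<otimes> g) w = w"
      using action.act_mult[of "inv (y [^] n)" g w] n g w y by (simp add: pt_def)
    then have "inv (y [^] n) \<otimes> g \<in> ker" using stab g y by simp
    then have *: "act (inv (y [^] n) \<otimes> g) (pt i) = pt i" for i by (rule ker_act)
    have "act g (pt i) = act (y [^] n) (act (inv (y [^] n) \<otimes> g) (pt i))" for i
      using action.act_mult[of "y [^] n" "inv (y [^] n) \<otimes> g" "pt i"] g y by (simp add: inv_cancel)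
    then show ?thesis using * act_pow_pt by auto
  qed
  have "commutator G g h \<in> norm" if g: "g \<in> carrier G" and h: "h \<in> carrier G" for g h
  proof (rule norm_if_fixes_max_cyclic)
    fix C assume C: "C \<in> max_cyclic"
    show "act (commutator G g h) C = C"
    proof (rule commutator_fixes[OF C g h])
      fix z assume z: "z \<in> orb C"
      show "act g (act h z) = act h (act g z)"
      proof (cases "C \<in> orb w")
        case True
        then have "z \<in> orb w" using z action.orb_eq[OF w] by blast
        then obtain i where i: "z = pt i" by (rule ptE)
        obtain m n where "\<forall>i. act g (pt i) = pt (m + i)" "\<forall>i. act h (pt i) = pt (n + i)"
          using shift g h by metis
        then show ?thesis using i by (simp add: ac_simps)
      next
        case False
        then show ?thesis using commute_on_small_orbit[OF C others[OF C] z g h] by blast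
      qed
    qed
  qed (use g h in simp)
  then show False using coprime_elements_commute_if_commutators_in_norm not_commute by blast
qed

text \<open>Elements of the kernel are out of reach of \<open>stab_not_ker_in_w\<close>, but their
  products with a stabilising \<open>s\<close> outside the kernel are not.\<close>

lemma stab_w: "g \<in> carrier G \<Longrightarrow> act g w = w \<longleftrightarrow> g \<in> w"
proof
  assume g: "g \<in> carrier G" "act g w = w"
  interpret K: subgroup ker G by (rule ker_subgroup)
  interpret W: subgroup w G by (rule max_cyclic_subgroup[OF w])
  obtain s where s: "s \<in> carrier G" "act s w = w" "s \<notin> ker" using ex_stab_not_ker by blast
  have sw: "s \<in> w" by (rule stab_not_ker_in_w[OF s])
  show "g \<in> w"
  proof (cases "g \<in> ker")
    case True
    have "g \<otimes> s \<notin> ker"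
    proof
      assume "g \<otimes> s \<in> ker"
      then have "inv g \<otimes> (g \<otimes> s) \<in> ker" using True by blast
      then show False using s(1,3) g by (simp add: inv_cancel)
    qed
    then have "g \<otimes> s \<in> w"
      using stab_not_ker_in_w[of "g \<otimes> s"] action.act_mult[OF g(1) s(1) w] s g by simp
    then have "(g \<otimes> s) \<otimes> inv s \<in> w" using sw by blast
    then show ?thesis using g s by (simp add: m_assoc)
  qed (use stab_not_ker_in_w g in blast)
qed (use conj_set_self w in blast)

lemma stab_pt:
  assumes g: "g \<in> carrier G" and fixes_pt: "act g (pt k) = pt k"
  shows "g \<in> pt k"
proof -
  have yk: "y [^] k \<in> carrier G" using y by simp
  define h where "h = inv (y [^] k) \<otimes> g \<otimes> y [^] k"
  have h: "h \<in> carrier G" using g yk by (simp add: h_def)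
  have gk: "g \<otimes> y [^] k = y [^] k \<otimes> h" using g yk by (simp add: h_def m_assoc inv_cancel)
  then have "act (y [^] k) (act h w) = act (y [^] k) w"
    using action.act_mult[OF g yk w] action.act_mult[OF yk h w] fixes_pt unfolding pt_def by simp
  then have "act h w = w" using action.act_inj[OF yk _ w, of "act h w"] w h by simp
  then have "h \<in> w" using stab_w h by blast
  moreover have "g = y [^] k \<otimes> h \<otimes> inv (y [^] k)" using gk g yk by (metis inv_solve_right m_closed h)
  ultimately show ?thesis unfolding pt_def conj_set_def by blast
qed

text \<open>A kernel element \<open>t\<close> lies in every point of the orbit and so commutes with
  all of them. With \<open>s\<close> in \<open>w\<close> outside the kernel,
  \<open>y \<otimes> s\<close> acts as a non-translation, has a fixed point and lies in it; so
  \<open>t\<close> commutes with \<open>y \<otimes> s\<close> and with \<open>s\<close>, hence with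
  \<open>y\<close>. Finally \<open>y\<close> and \<open>w\<close> generate \<open>G\<close>, as
  \<open>y\<close> reaches every point from \<open>w\<close>.\<close>

lemma ker_central:
  assumes t: "t \<in> ker" and g: "g \<in> carrier G"
  shows "t \<otimes> g = g \<otimes> t"
proof -
  have tG: "t \<in> carrier G" using t by (rule ker_closed)
  have tw: "t \<in> w" using stab_pt[OF tG ker_act[OF t], of 0] pt_0 by simp
  obtain s where s: "s \<in> carrier G" "act s w = w" "s \<notin> ker" using ex_stab_not_ker by blast
  obtain r where r: "\<And>i. act s (pt i) = pt (r * i)" by (rule act_stab_pt[OF s(1,2)]) (rule that)
  then have "\<not> [r = 1] (mod p)" using s in_ker_if_multiplier_1 by blast
  then obtain k where k: "[r * k + 1 = k] (mod p)" using ex_affine_fixed_point[OF prime_p] by blast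
  have "act (y \<otimes> s) (pt k) = pt k"
    using action.act_mult[OF y s(1), of "pt k"] r act_y_pt k pt_eq by simp
  then have "y \<otimes> s \<in> pt k" using stab_pt y s by simp
  moreover have "t \<in> pt k" using stab_pt[OF tG ker_act[OF t]] .
  ultimately have 1: "t \<otimes> (y \<otimes> s) = (y \<otimes> s) \<otimes> t" using max_cyclic_commute[OF pt_max_cyclic] by blast
  have "s \<in> w" using stab_w s by blast
  then have "s \<otimes> t = t \<otimes> s" using max_cyclic_commute[OF w] tw by blast
  then have "(t \<otimes> y) \<otimes> s = (y \<otimes> t) \<otimes> s"
    using 1 tG y s by (simp add: m_assoc)
  then have ty: "t \<otimes> y = y \<otimes> t" using tG y s by simp
  have "act g w \<in> orb w" using action.orb_act[OF w g] w by simp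
  then obtain n where n: "act g w = pt n" by (rule ptE)
  define h where "h = inv (y [^] n) \<otimes> g"
  have hG: "h \<in> carrier G" using g y by (simp add: h_def)
  have "act h w = w"
    using action.act_mult[of "inv (y [^] n)" g w] n g w y by (simp add: pt_def h_def)
  then have "h \<in> w" using stab_w hG by blast
  then have th: "t \<otimes> h = h \<otimes> t" using max_cyclic_commute[OF w] tw by blast
  have tyn: "t \<otimes> y [^] n = y [^] n \<otimes> t" by (rule commute_pow[OF tG y ty])
  have gh: "g = y [^] n \<otimes> h" using g y by (simp add: h_def inv_cancel)
  have "t \<otimes> (y [^] n \<otimes> h) = (t \<otimes> y [^] n) \<otimes> h" using tG y hG by (simp add: m_assoc)
  also have "\<dots> = y [^] n \<otimes> (t \<otimes> h)" unfolding tyn using tG y hG by (simp add: m_assoc)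
  also have "\<dots> = (y [^] n \<otimes> h) \<otimes> t" unfolding th using tG y hG by (simp add: m_assoc)
  finally show ?thesis using gh by simp
qed

end

section \<open>Splitting off a normal subgroup of order p\<close>

context frobenius_orbit
begin

text \<open>Conjugation by \<open>b\<close> sends \<open>y\<close> to \<open>y^r t\<close> with
  \<open>t\<close> in the kernel, hence central. Passing to \<open>a' = y^(r-1) t\<close>, the
  quotient of this conjugate by \<open>y\<close>, absorbs \<open>t\<close>: now \<open>b\<close>
  sends \<open>a'\<close> exactly to its \<open>r\<close>-th power. Since \<open>a'^p\<close> is
  central, \<open>a'^((r-1) p)\<close> is trivial, and \<open>a = a'^(r-1)\<close> has trivial
  \<open>p\<close>-th power. The set \<open>R\<close> consists of the points outside the orbit; for
  elements of \<open>cyc b\<close>, commuting with \<open>a\<close> characterises the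
  kernel.\<close>

lemma frobenius_structure:
  obtains a b r R where "a \<in> carrier G" "b \<in> carrier G" "a [^] p = \<one>"
    "inv b \<otimes> a \<otimes> b = a [^] r" "2 \<le> r" "r < p"
    "\<And>g. g \<in> carrier G \<Longrightarrow> \<exists>i. \<exists>z\<in>cyc b. g = a [^] (i::nat) \<otimes> z"
    "\<And>i. a [^] (i::nat) \<in> cyc b \<Longrightarrow> p dvd i"
    "card R = 6 - p"
    "\<And>i z. z \<in> cyc b \<Longrightarrow> z \<otimes> a = a \<otimes> z \<Longrightarrow> \<not> p dvd i \<Longrightarrow> \<exists>D\<in>R. a [^] (i::nat) \<otimes> z \<in> D"
    "\<And>D. D \<in> R \<Longrightarrow> \<exists>i. \<exists>z\<in>cyc b. z \<otimes> a = a \<otimes> z \<and> D = cyc (a [^] (i::nat) \<otimes> z)"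
    "R \<subseteq> max_cyclic"
proof -
  obtain b where b: "b \<in> carrier G" "cyc b = w" using max_cyclicE[OF w] by metis
  interpret K: subgroup ker G by (rule ker_subgroup)
  have bw: "act b w = w" "act (inv b) w = w"
    using stab_w b subgroup.m_inv_closed[OF max_cyclic_subgroup[OF w]] by auto
  have bnk: "inv b \<notin> ker"
  proof
    assume "inv b \<in> ker"
    then have "b \<in> ker" using K.m_inv_closed[of "inv b"] b by simp
    then have "w \<subseteq> ker" using cyc_subset[OF ker_subgroup, of b] b by simp
    then show False using ex_stab_not_ker stab_w by blast
  qed
  obtain q where q: "\<And>i. act (inv b) (pt i) = pt (q * i)"
    by (rule act_stab_pt[of "inv b"]) (use b bw in auto)
  define r where "r = q mod p"
  have r: "act (inv b) (pt i) = pt (r * i)" for i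
  proof -
    have "[q * i = r * i] (mod p)" unfolding r_def by (rule cong_scalar_right) (simp add: cong_def)
    then show ?thesis using q pt_eq by simp
  qed
  have rp: "r < p" using prime_gt_0_nat[OF prime_p] by (simp add: r_def)
  have "r \<noteq> 1" using bnk in_ker_if_multiplier_1[of "inv b" 1] r b by auto
  moreover have "r \<noteq> 0"
  proof
    assume "r = 0"
    then have "act (inv b) (pt 1) = act (inv b) (pt 0)" using r by simp
    then have "pt 1 = pt 0" using action.act_inj[of "inv b" "pt 1" "pt 0"] b(1) by simp
    then show False using pt_eq prime_gt_1_nat[OF prime_p] by (simp add: cong_def)
  qed
  ultimately have r2: "2 \<le> r" by linarith
  define c where "c = inv b \<otimes> y \<otimes> b"
  have c: "c \<in> carrier G" using b y by (simp add: c_def)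
  have cpt: "act c (pt i) = pt (r + i)" for i
  proof -
    obtain j where j: "act b (pt i) = pt j" using act_pt_orb[OF b(1)] by (rule ptE)
    have "pt i = act (inv b) (pt j)" using j b by (metis action.act_inv(1) pt_max_cyclic)
    then have "pt i = pt (r * j)" using r by simp
    then have ij: "[i = r * j] (mod p)" using pt_eq by simp
    have "act c (pt i) = act (inv b) (act y (pt j))"
      using action.act_mult[of "inv b" "y \<otimes> b" "pt i"] action.act_mult[OF y b(1), of "pt i"] j b y
      by (simp add: c_def m_assoc)
    also have "\<dots> = pt (r + r * j)" using act_y_pt r by simp
    also have "\<dots> = pt (r + i)" using ij pt_eq by (simp add: cong_sym cong_add_lcancel_nat)
    finally show ?thesis .
  qed
  define t where "t = inv (y [^] r) \<otimes> c"
  have ct: "c = y [^] r \<otimes> t" using c y by (simp add: t_def inv_cancel)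
  have "act t (pt i) = pt i" for i
  proof -
    have "act t (pt i) = act (inv (y [^] r)) (pt (r + i))"
      using action.act_mult[of "inv (y [^] r)" c "pt i"] cpt c y by (simp add: t_def)
    also have "\<dots> = pt i"
      using action.act_inv(1)[of "y [^] r" "pt i"] act_pow_pt[of r i] y by simp
    finally show ?thesis .
  qed
  then have t: "t \<in> ker" using c y by (intro kerI) (auto simp: t_def)
  then have tG: "t \<in> carrier G" by (rule ker_closed)
  define s where "s = r - 1"
  have s: "r = Suc s" "0 < s" "s < p" using r2 rp by (auto simp: s_def)
  define a' where "a' = y [^] s \<otimes> t"
  have a'G: "a' \<in> carrier G" using y tG by (simp add: a'_def)
  have ty: "y [^] n \<otimes> t = t \<otimes> y [^] n" for n :: nat
    using ker_central[OF t, of "y [^] n"] y by simp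
  have tb: "inv b \<otimes> t \<otimes> b = t"
    using ker_central[OF t b(1)] b(1) tG by (simp add: m_assoc inv_cancel)
  have cpow: "inv b \<otimes> g [^] n \<otimes> b = (inv b \<otimes> g \<otimes> b) [^] n" if "g \<in> carrier G" for g and n :: nat
    using conj_pow[of "inv b" g n] b that by simp
  have cmult: "inv b \<otimes> (g \<otimes> h) \<otimes> b = (inv b \<otimes> g \<otimes> b) \<otimes> (inv b \<otimes> h \<otimes> b)"
    if "g \<in> carrier G" "h \<in> carrier G" for g h
    using that b by (simp add: group_normalize)
  have tpow: "t [^] (n::nat) \<in> ker" for n
    using cyc_subset[OF ker_subgroup t] by auto
  have a'b: "inv b \<otimes> a' \<otimes> b = a' [^] r"
  proof -
    have "inv b \<otimes> a' \<otimes> b = (y [^] r \<otimes> t) [^] s \<otimes> t"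
      unfolding a'_def using cmult[of "y [^] s" t] cpow[OF y, of s] tb tG y c_def ct by simp
    also have "(y [^] r \<otimes> t) [^] s = (y [^] r) [^] s \<otimes> t [^] s"
      by (rule pow_mult_distrib) (use ty y tG in auto)
    also have "(y [^] r) [^] s = (y [^] s) [^] r"
      using y by (simp add: nat_pow_pow mult.commute)
    also have "(y [^] s) [^] r \<otimes> t [^] s \<otimes> t = (y [^] s) [^] r \<otimes> t [^] r"
      using y tG s(1) by (simp add: m_assoc)
    also have "\<dots> = a' [^] r"
      unfolding a'_def by (rule pow_mult_distrib[symmetric]) (use ty y tG in auto)
    finally show ?thesis .
  qed
  have "y [^] p \<in> ker"
  proof (rule kerI)
    show "act (y [^] p) (pt i) = pt i" for i
      using act_pow_pt[of p i] pt_eq[of "p + i" i] by (simp add: cong_def)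
  qed (use y in simp)
  then have "(y [^] p) [^] s \<otimes> t [^] p \<in> ker"
    using cyc_subset[OF ker_subgroup] tpow by (intro K.m_closed) auto
  moreover have "a' [^] p = (y [^] p) [^] s \<otimes> t [^] p"
    unfolding a'_def using pow_mult_distrib[OF ty[of s], of p] y tG
    by (simp add: nat_pow_pow mult.commute)
  ultimately have "a' [^] p \<in> ker" by simp
  then have "a' [^] p \<otimes> b = b \<otimes> a' [^] p" using ker_central b by blast
  then have "inv b \<otimes> a' [^] p \<otimes> b = a' [^] p"
    using a'G b by (simp add: m_assoc inv_cancel)
  then have "a' [^] (s * p) \<otimes> a' [^] p = \<one> \<otimes> a' [^] p"
    using cpow[OF a'G, of p, unfolded a'b] nat_pow_pow[OF a'G, of r p] nat_pow_mult[OF a'G, of "s * p" p] a'G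
    by (simp add: s(1) add.commute del: nat_pow_Suc)
  then have a'p: "a' [^] (s * p) = \<one>" using a'G by simp
  define a where "a = a' [^] s"
  have aG: "a \<in> carrier G" using a'G by (simp add: a_def)
  have ap: "a [^] p = \<one>" using a'p a'G by (simp add: a_def nat_pow_pow)
  have ab: "inv b \<otimes> a \<otimes> b = a [^] r"
    unfolding a_def using cpow[OF a'G, of s] a'b a'G by (simp add: nat_pow_pow mult.commute)
  have a'pt: "act a' (pt i) = pt (s + i)" for i
    unfolding a'_def using action.act_mult[OF _ tG, of "y [^] s" "pt i"] y ker_act[OF t] act_pow_pt by simp
  have shift: "act (g [^] n) (pt i) = pt (m * n + i)" if "g \<in> carrier G" "\<And>i. act g (pt i) = pt (m + i)"
    for g m and n i :: nat
  proof (induction n)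
    case (Suc n)
    then show ?case using action.act_pow_Suc[OF that(1), of "pt i" n] that(2) by (simp add: ac_simps)
  qed simp
  \<comment> \<open>\<open>a'\<close> translates by \<open>s\<close>, so \<open>a\<close> translates
    by \<open>s * s\<close>, a unit modulo \<open>p\<close> because
    \<open>0 < s < p\<close>.\<close>
  define m where "m = s * s"
  have apt: "act a (pt i) = pt (m + i)" for i
    unfolding a_def m_def by (rule shift[OF a'G a'pt])
  have anpt: "act (a [^] n) (pt i) = pt (m * n + i)" for n i :: nat
    by (rule shift[OF aG apt])
  have "\<not> p dvd s" using s nat_dvd_not_less by blast
  then have pm: "\<not> p dvd m" using prime_p by (simp add: m_def prime_dvd_mult_iff)
  then have copm: "coprime m p" using prime_p by (metis coprime_commute prime_imp_coprime)
  have reach: "\<exists>i. pt (m * i) = pt k" for k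
  proof -
    obtain x where "[m * x = 1] (mod p)" using cong_solve_coprime_nat[OF copm] by auto
    then have "[m * x * k = 1 * k] (mod p)" by (rule cong_scalar_right)
    then have "pt (m * (x * k)) = pt k" using pt_eq by (simp add: mult.assoc)
    then show ?thesis by blast
  qed
  have decomp: "\<exists>i. \<exists>z\<in>cyc b. g = a [^] (i::nat) \<otimes> z" if g: "g \<in> carrier G" for g
  proof -
    have "act g w \<in> orb w" using action.orb_act[OF w g] w by simp
    then obtain k where k: "act g w = pt k" by (rule ptE)
    obtain i where i: "pt (m * i) = pt k" using reach by blast
    have "act (a [^] i) w = act g w" using anpt[of i 0] pt_0 i k by simp
    then have "act (inv (a [^] i) \<otimes> g) w = w"
      using action.act_mult[of "inv (a [^] i)" g w] action.act_inv(1)[of "a [^] i" w] aG g w by simp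
    then have "inv (a [^] i) \<otimes> g \<in> cyc b" using stab_w[of "inv (a [^] i) \<otimes> g"] aG g b by simp
    moreover have "g = a [^] i \<otimes> (inv (a [^] i) \<otimes> g)" using aG g by (simp add: inv_cancel)
    ultimately show ?thesis by blast
  qed
  have int: "p dvd i" if "a [^] i \<in> cyc b" for i :: nat
  proof -
    have "act (a [^] i) w = w" using stab_w[of "a [^] i"] that aG b by simp
    then have "pt (m * i) = pt 0" using anpt[of i 0] pt_0 by simp
    then have "p dvd m * i" using pt_eq by (simp add: cong_0_iff)
    then show ?thesis using pm prime_p by (simp add: prime_dvd_mult_iff)
  qed
  define R where "R = max_cyclic - orb w"
  have cardR: "card R = 6 - p"
    unfolding R_def using card_Diff_subset[of "orb w" max_cyclic] orbw_sub card_six card_orb by simp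
  have cen_ker: "z \<in> ker" if z: "z \<in> cyc b" "z \<otimes> a = a \<otimes> z" for z
  proof (rule kerI)
    show zG: "z \<in> carrier G" using z cyc_closed b by blast
    have zw: "act z w = w" using stab_w zG z b by blast
    fix k
    obtain i where i: "pt (m * i) = pt k" using reach by blast
    have k: "pt k = act (a [^] i) w" using anpt[of i 0] pt_0 i by simp
    have "z \<otimes> a [^] i = a [^] i \<otimes> z" by (rule commute_pow[OF zG aG z(2)])
    then show "act z (pt k) = pt k"
      unfolding k using action.act_mult[OF zG _ w, of "a [^] i"] action.act_mult[OF _ zG w, of "a [^] i"] zw aG
      by simp
  qed
  have inR: "\<exists>D\<in>R. a [^] (i::nat) \<otimes> z \<in> D" if z: "z \<in> cyc b" "z \<otimes> a = a \<otimes> z" and i: "\<not> p dvd i" for i z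
  proof -
    have zk: "z \<in> ker" by (rule cen_ker[OF z])
    then have zG: "z \<in> carrier G" by (rule ker_closed)
    have azG: "a [^] i \<otimes> z \<in> carrier G" using aG zG by simp
    obtain D where D: "D \<in> max_cyclic" "a [^] i \<otimes> z \<in> D" "act (a [^] i \<otimes> z) D = D"
      using azG by (rule fixes_some)
    have "D \<notin> orb w"
    proof
      assume "D \<in> orb w"
      then obtain k where k: "D = pt k" by (rule ptE)
      then have "pt (m * i + k) = pt k"
        using D(3) action.act_mult[OF _ zG, of "a [^] i" "pt k"] ker_act[OF zk] anpt aG by simp
      then have "[m * i + k = 0 + k] (mod p)" using pt_eq by simp
      then have "p dvd m * i" using cong_add_rcancel_nat cong_0_iff by blast
      then show False using pm i prime_p by (simp add: prime_dvd_mult_iff)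
    qed
    then show ?thesis using D R_def by blast
  qed
  have Rform: "\<exists>i. \<exists>z\<in>cyc b. z \<otimes> a = a \<otimes> z \<and> D = cyc (a [^] (i::nat) \<otimes> z)" if D: "D \<in> R" for D
  proof -
    have DE: "D \<in> max_cyclic" "D \<notin> orb w" using D by (auto simp: R_def)
    obtain g where g: "g \<in> carrier G" "D = cyc g" using DE(1) by (rule max_cyclicE)
    obtain i z where iz: "z \<in> cyc b" "g = a [^] (i::nat) \<otimes> z" using decomp[OF g(1)] by blast
    have zG: "z \<in> carrier G" using iz(1) cyc_closed b by blast
    have zw: "act z w = w" using stab_w zG iz(1) b by blast
    obtain q where q: "\<And>i. act z (pt i) = pt (q * i)"
      by (rule act_stab_pt[OF zG zw]) (rule that)
    \<comment> \<open>With any other multiplier the generator \<open>g\<close> would fix a point of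
      the orbit and lie in it, and \<open>D\<close> would be that point.\<close>
    have "[q = 1] (mod p)"
    proof (rule ccontr)
      assume "\<not> [q = 1] (mod p)"
      then obtain k where k: "[q * k + m * i = k] (mod p)" using ex_affine_fixed_point[OF prime_p] by blast
      have "act g (pt k) = pt k"
        using action.act_mult[OF _ zG, of "a [^] i" "pt k"] q anpt aG iz(2) pt_eq k by (simp add: add.commute)
      then have "g \<in> pt k" using stab_pt g by blast
      then have "D \<subseteq> pt k" using cyc_subset[OF max_cyclic_subgroup[OF pt_max_cyclic], of g k] g by simp
      then have "D = pt k" using max_cyclic_eq DE(1) by simp
      then show False using DE(2) by simp
    qed
    then have "z \<in> ker" using in_ker_if_multiplier_1[OF zG q] by blast
    then have "z \<otimes> a = a \<otimes> z" using ker_central aG by blast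
    then show ?thesis using iz g by blast
  qed
  show ?thesis
    by (rule that[OF aG b(1) ap ab r2 rp decomp int cardR inR Rform]) (auto simp: R_def)
qed

end

section \<open>Generators and relations\<close>

context finite_group
begin

text \<open>A finite cyclic group has a single subgroup of order \<open>p\<close>; concretely, both
  exponents are multiples of \<open>M\<close>, the order of \<open>d\<close> divided by
  \<open>p\<close>.\<close>

lemma cyc_prime_order_unique:
  assumes d: "d \<in> carrier G" and x: "x \<in> cyc d" "x [^] p = \<one>" "x \<noteq> \<one>"
    and v: "v \<in> cyc d" "v [^] p = \<one>" and p: "prime (p::nat)"
  shows "v \<in> cyc x"
proof -
  obtain i j :: nat where ij: "x = d [^] i" "v = d [^] j" using x(1) v(1) by (auto elim!: cycE)
  have i: "ord d dvd i * p" and j: "ord d dvd j * p" and ni: "\<not> ord d dvd i"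
    using x v d unfolding ij by (simp_all add: nat_pow_pow pow_eq_id)
  have "\<not> coprime p (ord d)"
    using i ni by (metis coprime_commute coprime_dvd_mult_left_iff)
  then have "p dvd ord d" using p prime_imp_coprime by blast
  then obtain M where M: "ord d = p * M" by (auto elim: dvdE)
  have "M \<noteq> 0" using M ord_ge_1[OF fin d] by auto
  then obtain i' j' where i': "i = M * i'" and j': "j = M * j'"
    using i j M prime_gt_0_nat[OF p] by (auto elim!: dvdE simp: mult.commute)
  have "\<not> p dvd i'" using ni M i' by auto
  then have "coprime i' p" using p by (metis coprime_commute prime_imp_coprime)
  then obtain k where "[i' * k = 1] (mod p)" using cong_solve_coprime_nat[of i' p] by auto
  then have "[i' * k * j' = 1 * j'] (mod p)" by (rule cong_scalar_right)
  then have "[M * (i' * k * j') = M * (1 * j')] (mod (M * p))" by (rule cong_cmult_leftI)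
  then have "[i * (k * j') = j] (mod ord d)" by (simp add: i' j' M ac_simps)
  then have "x [^] (k * j') = v"
    using d pow_eq_iff_cong[OF d] by (simp add: ij nat_pow_pow)
  then show ?thesis by (metis cyc_pow)
qed

lemma conj_pow_iter:
  assumes a: "a \<in> carrier G" and b: "b \<in> carrier G" and ab: "inv b \<otimes> a \<otimes> b = a [^] (r::nat)"
  shows "inv (b [^] k) \<otimes> a \<otimes> b [^] k = a [^] (r ^ k)"
proof (induction k)
  case (Suc k)
  have "inv (b [^] Suc k) \<otimes> a \<otimes> b [^] Suc k = inv b \<otimes> (inv (b [^] k) \<otimes> a \<otimes> b [^] k) \<otimes> b"
    using a b by (simp add: group_normalize)
  also have "\<dots> = (inv b \<otimes> a \<otimes> b) [^] (r ^ k)"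
    using conj_pow[of "inv b" a "r ^ k"] a b by (simp add: Suc)
  also have "\<dots> = a [^] (r ^ Suc k)" using a by (simp add: ab nat_pow_pow)
  finally show ?case .
qed (use a in simp)

lemma commute_if_conj_eq:
  assumes "a \<in> carrier G" "b \<in> carrier G" "inv b \<otimes> a \<otimes> b = a"
  shows "b \<otimes> a = a \<otimes> b"
  using assms by (metis inv_cancel(2) inv_closed m_assoc m_closed)

end

text \<open>The semidirect product of \<open>cyc a\<close> by \<open>cyc b\<close>. The last
  assumption with \<open>i = 1\<close> also yields \<open>a \<noteq> \<one>\<close>, so
  \<open>a\<close> has order exactly \<open>p\<close>.\<close>

locale metacyclic_generators = finite_group +
  fixes p r :: nat and a b :: 'a
  assumes prime_p: "prime p"
    and a: "a \<in> carrier G" and b: "b \<in> carrier G"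
    and ap: "a [^] p = \<one>" and ab: "inv b \<otimes> a \<otimes> b = a [^] r"
    and decomp: "\<And>g. g \<in> carrier G \<Longrightarrow> \<exists>i. \<exists>z\<in>cyc b. g = a [^] (i::nat) \<otimes> z"
    and trivial_int: "\<And>i. a [^] (i::nat) \<in> cyc b \<Longrightarrow> p dvd i"
begin

lemma a_pow_eq: "a [^] i = a [^] j \<longleftrightarrow> [i = j] (mod p)" for i j :: nat
proof -
  have "a \<noteq> \<one>"
    using trivial_int[of 1] a cyc_pow[of b 0] prime_p by auto
  then have "ord a \<noteq> 1" using a ord_eq_1 by blast
  moreover have "ord a dvd p" using ap a pow_eq_id by blast
  ultimately have "ord a = p" using prime_p unfolding prime_nat_iff by blast
  then show ?thesis using pow_eq_iff_cong[OF a] by simp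
qed

lemma b_pow_commutes_iff: "b [^] k \<otimes> a = a \<otimes> b [^] k \<longleftrightarrow> [r ^ k = 1] (mod p)" for k :: nat
proof
  assume "b [^] k \<otimes> a = a \<otimes> b [^] k"
  then have "a [^] (r ^ k) = a [^] (1::nat)"
    using conj_pow_iter[OF a b ab, of k, symmetric] a b by (simp add: m_assoc inv_cancel flip: \<open>_ = a \<otimes> _\<close>)
  then show "[r ^ k = 1] (mod p)" using a_pow_eq by blast
next
  assume "[r ^ k = 1] (mod p)"
  then have "a [^] (r ^ k) = a [^] (1::nat)" using a_pow_eq by blast
  then have "inv (b [^] k) \<otimes> a \<otimes> b [^] k = a"
    using conj_pow_iter[OF a b ab, of k] a by simp
  then show "b [^] k \<otimes> a = a \<otimes> b [^] k"
    using commute_if_conj_eq[OF a, of "b [^] k"] b by blast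
qed

lemma r_pow_ord: "[r ^ ord b = 1] (mod p)"
  using b_pow_commutes_iff[of "ord b"] a b by simp

lemma ord_b_pos: "0 < ord b"
  using ord_ge_1[OF fin b] by simp

text \<open>The products \<open>a^i z\<close> with \<open>i < p\<close> and \<open>z\<close> in
  \<open>cyc b\<close> are distinct. This meets the upper bound of
  \<open>card_presented_group_le\<close>, so that a surjection from the presented group must be
  injective.\<close>

lemma p_times_ord_le_card: "p * ord b \<le> card (carrier G)"
proof -
  have *: "i = j" if "a [^] i \<otimes> u = a [^] j \<otimes> v" "u \<in> cyc b" "v \<in> cyc b" "j \<le> i" "i < p"
    for i j :: nat and u v
  proof -
    interpret B: subgroup "cyc b" G by (rule cyc_subgroup[OF b])
    have uv: "u \<in> carrier G" "v \<in> carrier G" using that by auto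
    have "a [^] i = a [^] j \<otimes> a [^] (i - j)" using a that by (simp add: nat_pow_mult)
    then have "a [^] j \<otimes> (a [^] (i - j) \<otimes> u) = a [^] j \<otimes> v"
      using that(1) a uv by (simp add: m_assoc)
    then have "a [^] (i - j) \<otimes> u = v" using a uv by simp
    then have "a [^] (i - j) = v \<otimes> inv u" using a uv by (metis inv_solve_right nat_pow_closed)
    then have "a [^] (i - j) \<in> cyc b" using that by auto
    then have "p dvd i - j" by (rule trivial_int)
    then show ?thesis using that(4,5) by (metis dvd_imp_le le_antisym less_imp_diff_less not_less zero_less_diff)
  qed
  have "inj_on (\<lambda>(i::nat, z). a [^] i \<otimes> z) ({..<p} \<times> cyc b)"
  proof (rule inj_onI, clarify)
    fix i j :: nat and u v
    assume i: "i < p" "j < p" and uv: "u \<in> cyc b" "v \<in> cyc b" and eq: "a [^] i \<otimes> u = a [^] j \<otimes> v"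
    then have "i = j" using *[of i u j v] *[of j v i u] by (metis nat_le_linear)
    moreover have "u \<in> carrier G" "v \<in> carrier G" using uv b cyc_closed by auto
    ultimately show "i = j \<and> u = v" using eq a by simp
  qed
  moreover have "(\<lambda>(i::nat, z). a [^] i \<otimes> z) ` ({..<p} \<times> cyc b) \<subseteq> carrier G"
    using a b cyc_closed by auto
  ultimately have "card ({..<p} \<times> cyc b) \<le> card (carrier G)"
    using fin card_inj_on_le by blast
  then show ?thesis using card_cyc[OF b] by (simp add: card_cartesian_product)
qed

lemma generators:
  assumes H: "subgroup H G" "a \<in> H" "b \<in> H"
  shows "H = carrier G"
proof
  show "carrier G \<subseteq> H"
  proof
    fix g assume "g \<in> carrier G"
    then obtain i z where "z \<in> cyc b" "g = a [^] (i::nat) \<otimes> z" using decomp by blast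
    moreover have "cyc b \<subseteq> H" "a [^] i \<in> H" using cyc_subset[OF H(1)] H cyc_pow by blast+
    ultimately show "g \<in> H" using subgroup.m_closed[OF H(1)] by blast
  qed
qed (use H subgroup.subset in blast)

end

section \<open>The power of p dividing the order of b\<close>

context six_max_cyclic
begin

text \<open>For \<open>p = 5\<close>, an element \<open>v\<close> of order 5 of \<open>\<langle>b\<rangle>\<close> would be central, and \<open>a\<close> and \<open>a v\<close> could not both
  lie in the single maximal cyclic subgroup outside the orbit. For \<open>p = 3\<close>, the three maximal cyclic subgroups
  outside the orbit all equal \<open>\<langle>a b\<^sup>2\<rangle>\<close> if 3 does not divide the order of \<open>b\<close>, whereas if 9 divides it, there
  is \<open>v\<close> of order 3 in \<open>\<langle>b\<^sup>2\<rangle>\<close> and no two of \<open>a\<close>, \<open>a v\<close>, \<open>a v\<^sup>2\<close>, \<open>a b\<^sup>2\<close> lie in a common cyclic subgroup.\<close>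
lemma structure_dichotomy:
  "(\<exists>r a b. metacyclic_generators G 5 r a b \<and> 2 \<le> r \<and> r < 5 \<and> \<not> 5 dvd ord b) \<or>
   (\<exists>a b n. metacyclic_generators G 3 2 a b \<and> ord b = 6 * n \<and> \<not> 3 dvd n)"
proof -
  obtain w where w: "w \<in> max_cyclic" "card (orb w) = 3 \<or> card (orb w) = 5"
    "\<And>D. D \<in> max_cyclic \<Longrightarrow> D \<notin> orb w \<Longrightarrow> card (orb D) \<le> 2"
    using ex_prime_orbit by blast
  define p where "p = card (orb w)"
  have p35: "p = 3 \<or> p = 5" using w(2) by (simp add: p_def)
  have "prime (3::nat)" "prime (5::nat)" by simp_all
  then have pp: "prime p" using p35 by auto
  obtain y e where y: "y \<in> carrier G" "y [^] (p ^ e) = \<one>" "act y w \<noteq> w"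
    using action.ex_prime_power_moving[OF w(1) pp] p_def by auto
  interpret F: frobenius_orbit G p e w y
    by unfold_locales (use p35 w y p_def in auto)
  obtain a b r R where fr: "a \<in> carrier G" "b \<in> carrier G" "a [^] p = \<one>"
    "inv b \<otimes> a \<otimes> b = a [^] r" "2 \<le> r" "r < p"
    "\<And>g. g \<in> carrier G \<Longrightarrow> \<exists>i. \<exists>z\<in>cyc b. g = a [^] (i::nat) \<otimes> z"
    "\<And>i. a [^] (i::nat) \<in> cyc b \<Longrightarrow> p dvd i"
    and R: "card R = 6 - p"
    "\<And>i z. z \<in> cyc b \<Longrightarrow> z \<otimes> a = a \<otimes> z \<Longrightarrow> \<not> p dvd i \<Longrightarrow> \<exists>D\<in>R. a [^] (i::nat) \<otimes> z \<in> D"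
    "\<And>D. D \<in> R \<Longrightarrow> \<exists>i. \<exists>z\<in>cyc b. z \<otimes> a = a \<otimes> z \<and> D = cyc (a [^] (i::nat) \<otimes> z)"
    "R \<subseteq> max_cyclic"
    by (rule F.frobenius_structure) (rule that)
  interpret M: metacyclic_generators G p r a b
    by unfold_locales (use pp fr in auto)
  let ?N = "ord b"
  have aD: "\<exists>D\<in>R. a \<otimes> z \<in> D" if "z \<in> cyc b" "z \<otimes> a = a \<otimes> z" for z
    using R(2)[OF that, of 1] fr(1) prime_gt_1_nat[OF pp] by auto
  \<comment> \<open>A cyclic \<open>D\<close> has one subgroup of order \<open>p\<close>. Here
    \<open>v\<close> generates it inside \<open>cyc b\<close>, so \<open>a \<otimes> u\<close> and
    with it \<open>a\<close> would lie in \<open>cyc b\<close>.\<close>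
  have clash: False
    if D: "D \<in> max_cyclic" and v: "v \<in> D" "v \<in> cyc b" "v [^] p = \<one>" "v \<noteq> \<one>"
      and u: "u \<in> cyc b" "u \<otimes> a = a \<otimes> u" "u [^] p = \<one>" "a \<otimes> u \<in> D" for D u v
  proof -
    interpret B: subgroup "cyc b" G by (rule cyc_subgroup[OF fr(2)])
    have uG: "u \<in> carrier G" using u by auto
    obtain d where d: "d \<in> carrier G" "D = cyc d" using D by (rule max_cyclicE)
    have "(a \<otimes> u) [^] p = \<one>"
      using pow_mult_distrib[OF u(2)[symmetric] fr(1) uG, of p] u(3) fr(3) by simp
    then have "a \<otimes> u \<in> cyc v"
      using cyc_prime_order_unique[of d v p "a \<otimes> u"] d v u pp by simp
    then have "a \<otimes> u \<in> cyc b" using cyc_subset[OF B.subgroup_axioms v(2)] by blast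
    then have "(a \<otimes> u) \<otimes> inv u \<in> cyc b" using u(1) by blast
    then have "a [^] (1::nat) \<in> cyc b" using uG fr(1) by (simp add: m_assoc)
    then show False using fr(8)[of 1] prime_gt_1_nat[OF pp] by simp
  qed
  have aD1: "\<exists>D\<in>R. a \<in> D"
    using aD[of \<one>] cyc_pow[of b 0] fr(1) by simp
  show ?thesis
  proof (cases "p = 5")
    case p5: True
    have "\<not> 5 dvd ?N"
    proof
      assume "5 dvd ?N"
      then obtain k where k: "?N = 5 * k" by (auto elim: dvdE)
      define v where "v = b [^] k"
      have vb: "v \<in> cyc b" by (simp add: v_def)
      have vG: "v \<in> carrier G" using fr(2) by (simp add: v_def)
      have v5: "v [^] p = \<one>"
        using k p5 fr(2) pow_ord_eq_1[OF fr(2)] by (simp add: v_def nat_pow_pow mult.commute)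
      have vn: "v \<noteq> \<one>"
        using pow_eq_id[OF fr(2), of k] k M.ord_b_pos by (auto simp: v_def dest: dvd_imp_le)
      \<comment> \<open>By Fermat, \<open>r ^ k\<close> is congruent to its fifth power
        \<open>r ^ ord b\<close>, hence to 1, so \<open>v\<close> commutes with
        \<open>a\<close>.\<close>
      have "[(r ^ k) ^ 5 = 1] (mod 5)"
        using M.r_pow_ord k p5 by (simp add: power_mult[symmetric] mult.commute)
      moreover have "[s ^ 5 = s] (mod 5)" for s :: nat
      proof -
        have "s mod 5 < 5" by simp
        then have "s mod 5 \<in> {0, 1, 2, 3, 4}" by auto
        then have "(s mod 5) ^ 5 mod 5 = s mod 5" by auto
        then show ?thesis by (simp add: cong_def power_mod)
      qed
      ultimately have "[r ^ k = 1] (mod p)" using p5 cong_trans cong_sym by blast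
      then have va: "v \<otimes> a = a \<otimes> v" using M.b_pow_commutes_iff by (simp add: v_def)
      obtain D where D: "D \<in> R" "a \<in> D" using aD1 by blast
      obtain D' where D': "D' \<in> R" "a \<otimes> v \<in> D'" using aD[OF vb va] by blast
      have "card R = 1" using R(1) p5 by simp
      then have "D' = D" using D(1) D'(1) by (metis card_1_singletonE singletonD)
      have DE: "D \<in> max_cyclic" using D(1) R(4) by blast
      interpret D: subgroup D G by (rule max_cyclic_subgroup[OF DE])
      have "inv a \<otimes> (a \<otimes> v) \<in> D" using D D' \<open>D' = D\<close> by blast
      then have "v \<in> D" using fr(1) vG by (simp add: inv_cancel)
      then show False
        using clash[OF DE _ vb v5 vn, of \<one>] D(2) fr(1) cyc_pow[of b 0] by simp
    qed
    then show ?thesis using M.metacyclic_generators_axioms fr(5,6) p5 by blast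
  next
    case False
    then have p3: "p = 3" using p35 by simp
    then have r2: "r = 2" using fr(5,6) by simp
    have pow2: "[2 ^ k = 1] (mod (3::nat)) \<longleftrightarrow> even k" for k :: nat
    proof -
      have "(2::nat) ^ k mod 3 = (if even k then 1 else 2)"
        by (induction k) (simp_all, presburger)
      then show ?thesis by (simp add: cong_def)
    qed
    have evN: "even ?N" using M.r_pow_ord pow2 r2 p3 by simp
    then obtain N' where N': "?N = 2 * N'" by (auto elim: dvdE)
    have comm: "b [^] k \<otimes> a = a \<otimes> b [^] k \<longleftrightarrow> even k" for k :: nat
      using M.b_pow_commutes_iff[of k] pow2 r2 p3 by simp
    have "3 dvd ?N"
    proof (rule ccontr)
      assume "\<not> 3 dvd ?N"
      then have "\<not> 3 dvd N'" using N' by (auto intro: dvd_mult)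
      then have cop: "coprime 3 N'" using prime_imp_coprime[of 3 N'] by simp
      have all: "D = cyc (a \<otimes> b [^] (2::nat))" if D: "D \<in> R" for D
      proof -
        obtain i z where iz: "z \<in> cyc b" "z \<otimes> a = a \<otimes> z" "D = cyc (a [^] (i::nat) \<otimes> z)"
          using R(3)[OF D] by blast
        obtain j where j: "z = b [^] (j::nat)" using iz(1) by (rule cycE)
        then have "even j" using iz(2) comm by simp
        then obtain j' where j': "j = 2 * j'" by (auto elim: dvdE)
        \<comment> \<open>As 3 is prime to the order \<open>N'\<close> of \<open>b^2\<close>, one
          power of \<open>a b^2\<close> attains the prescribed powers of \<open>a\<close> and of
          \<open>b^2\<close> simultaneously.\<close>
        obtain k where k: "[k = i] (mod 3)" "[k = j'] (mod N')"
          using binary_chinese_remainder_nat[OF cop] by blast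
        have "(a \<otimes> b [^] (2::nat)) [^] k = a [^] k \<otimes> (b [^] (2::nat)) [^] k"
          by (rule pow_mult_distrib) (use comm[of 2] fr in auto)
        also have "a [^] k = a [^] i" using M.a_pow_eq k(1) p3 by simp
        also have "(b [^] (2::nat)) [^] k = b [^] j"
        proof -
          have "[2 * k = 2 * j'] (mod (2 * N'))" using k(2) by (rule cong_cmult_leftI)
          then show ?thesis using pow_eq_iff_cong[OF fr(2)] N' fr(2) j' by (simp add: nat_pow_pow)
        qed
        finally have "a [^] i \<otimes> z \<in> cyc (a \<otimes> b [^] (2::nat))" using j by (metis cyc_pow)
        then have "D \<subseteq> cyc (a \<otimes> b [^] (2::nat))"
          unfolding iz(3) by (intro cyc_subset cyc_subgroup) (use fr in auto)
        then show ?thesis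
          using max_cyclic_maximal[of D "a \<otimes> b [^] (2::nat)"] D R(4) fr by auto
      qed
      then have "R \<subseteq> {cyc (a \<otimes> b [^] (2::nat))}" by blast
      then have "card R \<le> 1" using card_mono[of "{cyc (a \<otimes> b [^] (2::nat))}" R] by simp
      then show False using R(1) p3 by simp
    qed
    then have "6 dvd ?N" using evN by presburger
    then obtain n where n: "?N = 6 * n" by (auto elim: dvdE)
    have "\<not> 3 dvd n"
    proof
      assume "3 dvd n"
      then obtain k where k: "n = 3 * k" by (auto elim: dvdE)
      \<comment> \<open>Now \<open>ord b = 18 * k\<close>, so \<open>v\<close> has order 3, and the
        even exponent makes it commute with \<open>a\<close>.\<close>
      define v where "v = b [^] (6 * k)"
      have vG: "v \<in> carrier G" using fr(2) by (simp add: v_def)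
      have vpow: "v [^] i = b [^] (6 * k * i)" for i :: nat
        using fr(2) by (simp add: v_def nat_pow_pow)
      have vb: "v [^] i \<in> cyc b" for i :: nat using vpow by simp
      have va: "v [^] i \<otimes> a = a \<otimes> v [^] i" for i :: nat using vpow comm by simp
      have veq: "v [^] i = \<one> \<longleftrightarrow> 3 dvd i" for i :: nat
        using pow_eq_id[OF fr(2), of "6 * k * i"] n k M.ord_b_pos by (simp add: vpow)
      have v3: "(v [^] i) [^] p = \<one>" for i :: nat
        using veq[of "i * 3"] p3 vG by (simp add: nat_pow_pow)
      have clash': False if "D \<in> R" "v [^] i \<in> D" "a \<otimes> v [^] j \<in> D" "\<not> 3 dvd i" for D and i j :: nat
        using clash[of D "v [^] i" "v [^] j"] that R(4) vb va v3 veq by blast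
      obtain f where f: "\<And>i. f i \<in> R \<and> a \<otimes> v [^] (i::nat) \<in> f i"
        using aD[OF vb va] by metis
      have subg: "subgroup (f i) G" for i using f R(4) max_cyclic_subgroup by blast
      \<comment> \<open>Two of the \<open>a v^i\<close> in one cyclic subgroup would put a generator
        of \<open>cyc v\<close> there as well, against \<open>clash'\<close>.\<close>
      have f_ne: "f i \<noteq> f j" if "i < j" "j < 3" for i j
      proof
        assume eq: "f i = f j"
        have "inv (a \<otimes> v [^] i) \<otimes> (a \<otimes> v [^] j) \<in> f j"
          using f[of i] f[of j] eq subgroup.m_closed[OF subg] subgroup.m_inv_closed[OF subg] by metis
        moreover have "v [^] j = v [^] i \<otimes> v [^] (j - i)" using vG that by (simp add: nat_pow_mult)
        ultimately have "v [^] (j - i) \<in> f j" using fr(1) vG by (simp add: group_normalize)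
        moreover have "\<not> 3 dvd (j - i)" using that by (auto dest: dvd_imp_le)
        ultimately show False using clash' f by blast
      qed
      have b2: "b [^] (2::nat) \<otimes> a = a \<otimes> b [^] (2::nat)" using comm by simp
      obtain D where D: "D \<in> R" "a \<otimes> b [^] (2::nat) \<in> D" using aD[OF _ b2] by auto
      \<comment> \<open>The exponent \<open>3 * k\<close> annihilates \<open>a\<close> and turns
        \<open>b^2\<close> into \<open>v\<close>. So the \<open>D\<close> containing
        \<open>a b^2\<close> contains \<open>v\<close> and none of the \<open>a v^i\<close>; it is a
        fourth member of \<open>R\<close>, which has three.\<close>
      have "(a \<otimes> b [^] (2::nat)) [^] (3 * k) = a [^] (3 * k) \<otimes> (b [^] (2::nat)) [^] (3 * k)"
        by (rule pow_mult_distrib) (use b2 fr in auto)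
      also have "a [^] (3 * k) = \<one>" using pow_mult_eq_one[OF fr(1), of 3 k] fr(3) p3 by simp
      also have "(b [^] (2::nat)) [^] (3 * k) = v [^] (1::nat)" using fr(2) by (simp add: v_def nat_pow_pow)
      finally have "(a \<otimes> b [^] (2::nat)) [^] (3 * k) = v [^] (1::nat)" using vG by simp
      then have vD: "v [^] (1::nat) \<in> D"
        using cyc_subset[OF max_cyclic_subgroup D(2)] D(1) R(4) cyc_pow by (metis subsetD)
      have "D \<noteq> f i" "f i \<noteq> D" for i using clash'[OF D(1) vD, of i] f by auto
      then have "card {f 0, f 1, f 2, D} = 4"
        using f_ne[of 0 1] f_ne[of 0 2] f_ne[of 1 2] by simp
      moreover have "finite R" using R(4) finite_max_cyclic finite_subset by blast
      then have "card {f 0, f 1, f 2, D} \<le> card R"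
        using f D(1) by (intro card_mono) auto
      ultimately show False using R(1) p3 by simp
    qed
    then show ?thesis using M.metacyclic_generators_axioms p3 r2 n by blast
  qed
qed

end

section \<open>Classes and values of words, and orders of presented groups\<close>

lemma gword_class_power:
  "gword_class R (u \<up> n) = gword_class R u [^]\<^bsub>presented_group R\<^esub> n"
proof (induction n)
  case 0
  show ?case by (simp add: gword_pow_def presented_group_one)
next
  case (Suc n)
  have "u \<up> Suc n = u \<up> n @ u" by (simp add: gword_pow_def replicate_append_same[symmetric])
  then show ?case using Suc by (simp add: presented_group_mult[symmetric])
qed

lemma gword_class_inv:
  "gword_class R (gword_inv u) = inv\<^bsub>presented_group R\<^esub> gword_class R u"
proof -
  interpret P: group "presented_group R" by (rule group_presented_group)
  have "gword_class R (gword_inv u) \<otimes>\<^bsub>presented_group R\<^esub> gword_class R u = \<one>\<^bsub>presented_group R\<^esub>"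
    by (simp add: presented_group_simps gword_class_eq_iff gword_equiv_inv_left)
  then show ?thesis by (metis P.inv_equality presented_group_carrier rangeI)
qed

lemma gword_class_conj:
  "gword_class R (gword_conj u v) =
    inv\<^bsub>presented_group R\<^esub> gword_class R v \<otimes>\<^bsub>presented_group R\<^esub> gword_class R u
      \<otimes>\<^bsub>presented_group R\<^esub> gword_class R v"
  by (simp add: gword_conj_def gword_class_inv[symmetric] presented_group_mult)

lemma (in group) gword_eval_power:
  "range f \<subseteq> carrier G \<Longrightarrow> gword_eval G f (u \<up> n) = gword_eval G f u [^] n"
proof (induction n)
  case (Suc n)
  have "u \<up> Suc n = u \<up> n @ u" by (simp add: gword_pow_def replicate_append_same[symmetric])
  then show ?case using Suc by (simp add: gword_eval_append)
qed (simp add: gword_pow_def)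

lemma (in group) gword_eval_inv:
  assumes f: "range f \<subseteq> carrier G"
  shows "gword_eval G f (gword_inv u) = inv (gword_eval G f u)"
proof (induction u)
  case (Cons l u)
  obtain x s where l: "l = (x, s)" by (cases l)
  have "f x \<in> carrier G" using f by blast
  moreover have "gword_inv (l # u) = gword_inv u @ [(x, \<not> s)]" by (simp add: gword_inv_def l)
  ultimately show ?case
    using Cons gword_eval_closed[OF f, of u] by (simp add: gword_eval_append[OF f] l inv_mult_group)
qed (simp add: gword_inv_def)

lemma (in group) gword_eval_conj:
  "range f \<subseteq> carrier G \<Longrightarrow>
    gword_eval G f (gword_conj u v) = inv (gword_eval G f v) \<otimes> gword_eval G f u \<otimes> gword_eval G f v"
  by (simp add: gword_conj_def gword_eval_append gword_eval_inv gword_eval_closed m_assoc)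

text \<open>Every element has the normal form \<open>b\<^sup>j a\<^sup>i\<close> with \<open>i < p\<close> and \<open>j < M\<close>.\<close>
lemma card_presented_group_le:
  assumes rels: "(wa \<up> N, []) \<in> R" "(wb \<up> M, []) \<in> R" "(gword_conj wa wb, wa \<up> k) \<in> R"
    and eq: "gword_equiv R (wa \<up> p) (wb \<up> q)" and pos: "0 < N" "0 < M" "0 < p"
  shows "finite (carrier (presented_group R))" "card (carrier (presented_group R)) \<le> p * M"
proof -
  interpret P: group "presented_group R" by (rule group_presented_group)
  let ?P = "presented_group R"
  let ?A = "gword_class R wa" and ?B = "gword_class R wb"
  have cl [simp]: "gword_class R u \<in> carrier ?P" for u by (simp add: presented_group_carrier)
  have AN: "?A [^]\<^bsub>?P\<^esub> N = \<one>\<^bsub>?P\<^esub>" and BM: "?B [^]\<^bsub>?P\<^esub> M = \<one>\<^bsub>?P\<^esub>"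
    and conj: "inv\<^bsub>?P\<^esub> ?B \<otimes>\<^bsub>?P\<^esub> ?A \<otimes>\<^bsub>?P\<^esub> ?B = ?A [^]\<^bsub>?P\<^esub> k"
    using rels[THEN presented_group_relation]
    by (simp_all add: gword_class_power gword_class_conj presented_group_one)
  have Ap: "?A [^]\<^bsub>?P\<^esub> p = ?B [^]\<^bsub>?P\<^esub> q"
    using eq by (simp add: gword_class_power[symmetric] gword_class_eq_iff)
  \<comment> \<open>The rewriting rule that moves \<open>b\<close> to the left across powers of
    \<open>a\<close>.\<close>
  have AB: "?A [^]\<^bsub>?P\<^esub> i \<otimes>\<^bsub>?P\<^esub> ?B = ?B \<otimes>\<^bsub>?P\<^esub> ?A [^]\<^bsub>?P\<^esub> (k * i)" for i
  proof (induction i)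
    case (Suc i)
    have "?A \<otimes>\<^bsub>?P\<^esub> ?B = ?B \<otimes>\<^bsub>?P\<^esub> ?A [^]\<^bsub>?P\<^esub> k"
      unfolding conj[symmetric] by (simp add: P.group_normalize)
    then have "?A [^]\<^bsub>?P\<^esub> Suc i \<otimes>\<^bsub>?P\<^esub> ?B = (?A [^]\<^bsub>?P\<^esub> i \<otimes>\<^bsub>?P\<^esub> ?B) \<otimes>\<^bsub>?P\<^esub> ?A [^]\<^bsub>?P\<^esub> k"
      by (simp add: P.m_assoc)
    then show ?case unfolding Suc by (simp add: P.m_assoc P.nat_pow_mult add.commute)
  qed simp
  define f where "f = (\<lambda>(j::nat, i::nat). ?B [^]\<^bsub>?P\<^esub> j \<otimes>\<^bsub>?P\<^esub> ?A [^]\<^bsub>?P\<^esub> i)"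
  have fA: "f (j, i) \<otimes>\<^bsub>?P\<^esub> ?A = f (j, Suc i)" for j i
    by (simp add: f_def P.m_assoc)
  have fB: "f (j, i) \<otimes>\<^bsub>?P\<^esub> ?B = f (Suc j, k * i)" for j i
    using AB[of i] by (simp add: f_def P.m_assoc)
  have fAn: "f (j, i) \<otimes>\<^bsub>?P\<^esub> ?A [^]\<^bsub>?P\<^esub> n \<in> range f" for j i n :: nat
  proof (induction n)
    case 0
    then show ?case by (simp add: f_def) (metis (mono_tags) case_prod_conv f_def rangeI)
  next
    case (Suc n)
    then obtain j' i' where "f (j, i) \<otimes>\<^bsub>?P\<^esub> ?A [^]\<^bsub>?P\<^esub> n = f (j', i')" by auto
    moreover have "f (j, i) \<in> carrier ?P" by (simp add: f_def)
    ultimately have "f (j, i) \<otimes>\<^bsub>?P\<^esub> ?A [^]\<^bsub>?P\<^esub> Suc n = f (j', Suc i')"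
      using fA by (simp add: P.m_assoc[symmetric])
    then show ?case by (metis rangeI)
  qed
  have fBn: "f (j, i) \<otimes>\<^bsub>?P\<^esub> ?B [^]\<^bsub>?P\<^esub> n \<in> range f" for j i n :: nat
  proof (induction n)
    case 0
    then show ?case by (simp add: f_def) (metis (mono_tags) case_prod_conv f_def rangeI)
  next
    case (Suc n)
    then obtain j' i' where "f (j, i) \<otimes>\<^bsub>?P\<^esub> ?B [^]\<^bsub>?P\<^esub> n = f (j', i')" by auto
    moreover have "f (j, i) \<in> carrier ?P" by (simp add: f_def)
    ultimately have "f (j, i) \<otimes>\<^bsub>?P\<^esub> ?B [^]\<^bsub>?P\<^esub> Suc n = f (Suc j', k * i')"
      using fB by (simp add: P.m_assoc[symmetric])
    then show ?case by (metis rangeI)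
  qed
  \<comment> \<open>Inverse letters become positive powers, so closure under right multiplication by
    powers of \<open>a\<close> and \<open>b\<close> covers all words.\<close>
  have inv_pow: "inv\<^bsub>?P\<^esub> x = x [^]\<^bsub>?P\<^esub> (n - 1)"
    if "x \<in> carrier ?P" "x [^]\<^bsub>?P\<^esub> n = \<one>\<^bsub>?P\<^esub>" "0 < n" for x and n :: nat
  proof (rule P.inv_equality)
    show "x [^]\<^bsub>?P\<^esub> (n - 1) \<otimes>\<^bsub>?P\<^esub> x = \<one>\<^bsub>?P\<^esub>" using that by (cases n) auto
  qed (use that in auto)
  have words: "gword_class R u \<in> range f" for u
  proof (induction u rule: rev_induct)
    case Nil
    have "gword_class R [] = f (0, 0)" by (simp add: f_def presented_group_one)
    then show ?case by simp
  next
    case (snoc l u)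
    then obtain j i where u: "gword_class R u = f (j, i)" by auto
    obtain x s where l: "l = (x, s)" by (cases l)
    have inv_letter: "[(x, True)] = gword_inv [(x, False)]" by (simp add: gword_inv_def)
    have "\<exists>n. gword_class R [l] = ?A [^]\<^bsub>?P\<^esub> n \<or> gword_class R [l] = ?B [^]\<^bsub>?P\<^esub> (n::nat)"
    proof (cases s)
      case False
      then have "gword_class R [l] = ?A [^]\<^bsub>?P\<^esub> (1::nat) \<or> gword_class R [l] = ?B [^]\<^bsub>?P\<^esub> (1::nat)"
        by (cases x) (simp_all add: l wa_def wb_def)
      then show ?thesis by blast
    next
      case True
      then have "gword_class R [l] = inv\<^bsub>?P\<^esub> ?A \<or> gword_class R [l] = inv\<^bsub>?P\<^esub> ?B"
        using inv_letter by (cases x) (simp_all add: l wa_def wb_def gword_class_inv[symmetric])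
      then show ?thesis
        using inv_pow[OF cl AN pos(1)] inv_pow[OF cl BM pos(2)] by metis
    qed
    then have "f (j, i) \<otimes>\<^bsub>?P\<^esub> gword_class R [l] \<in> range f"
      using fAn fBn by metis
    then show ?case using u by (simp add: presented_group_mult[symmetric])
  qed
  \<comment> \<open>The surplus power of \<open>a^p\<close> stands next to the power of
    \<open>b\<close> and is exchanged for a power of \<open>b^q\<close>; then the exponent of
    \<open>b\<close> is reduced modulo \<open>M\<close>.\<close>
  have red: "f (j, i) \<in> f ` ({..<M} \<times> {..<p})" for j i
  proof -
    have Bmod: "?B [^]\<^bsub>?P\<^esub> j = ?B [^]\<^bsub>?P\<^esub> (j mod M)" for j :: nat
    proof -
      have "?B [^]\<^bsub>?P\<^esub> j = ?B [^]\<^bsub>?P\<^esub> (M * (j div M)) \<otimes>\<^bsub>?P\<^esub> ?B [^]\<^bsub>?P\<^esub> (j mod M)"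
        by (simp add: P.nat_pow_mult)
      then show ?thesis by (simp add: P.nat_pow_pow[symmetric] BM)
    qed
    have "?A [^]\<^bsub>?P\<^esub> i = ?A [^]\<^bsub>?P\<^esub> (p * (i div p)) \<otimes>\<^bsub>?P\<^esub> ?A [^]\<^bsub>?P\<^esub> (i mod p)"
      by (simp add: P.nat_pow_mult)
    also have "?A [^]\<^bsub>?P\<^esub> (p * (i div p)) = ?B [^]\<^bsub>?P\<^esub> (q * (i div p))"
      by (simp add: P.nat_pow_pow[symmetric] Ap)
    finally have "f (j, i) = ?B [^]\<^bsub>?P\<^esub> (j + q * (i div p)) \<otimes>\<^bsub>?P\<^esub> ?A [^]\<^bsub>?P\<^esub> (i mod p)"
      by (simp add: f_def P.m_assoc[symmetric] P.nat_pow_mult)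
    then have "f (j, i) = f ((j + q * (i div p)) mod M, i mod p)"
      using Bmod[of "j + q * (i div p)"] by (simp add: f_def)
    then show ?thesis using pos by (auto simp del: f_def)
  qed
  have sub: "carrier ?P \<subseteq> f ` ({..<M} \<times> {..<p})"
  proof
    fix z assume "z \<in> carrier ?P"
    then obtain u where "z = gword_class R u" by (auto simp: presented_group_carrier)
    then obtain j i where "z = f (j, i)" using words[of u] by auto
    then show "z \<in> f ` ({..<M} \<times> {..<p})" using red by simp
  qed
  then show "finite (carrier ?P)" by (rule finite_subset) simp
  have "card (carrier ?P) \<le> card (f ` ({..<M} \<times> {..<p}))"
    by (rule card_mono[OF _ sub]) simp
  also have "\<dots> \<le> card ({..<M} \<times> {..<p})" by (rule card_image_le) simp
  finally show "card (carrier ?P) \<le> p * M" by (simp add: card_cartesian_product mult.commute)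
qed

text \<open>Von Dyck's homomorphism is onto because its image contains the generators, and the
  comparison of orders makes it injective.\<close>

lemma (in group) iso_presented_group:
  assumes a: "a \<in> carrier G" and b: "b \<in> carrier G"
    and gen: "\<And>H. subgroup H G \<Longrightarrow> a \<in> H \<Longrightarrow> b \<in> H \<Longrightarrow> H = carrier G"
    and eval: "\<And>u v. (u, v) \<in> R \<Longrightarrow> gword_eval G (case_gens_ab a b) u = gword_eval G (case_gens_ab a b) v"
    and finP: "finite (carrier (presented_group R))"
    and card: "card (carrier (presented_group R)) \<le> card (carrier G)"
  shows "G \<cong> presented_group R"
proof -
  let ?f = "case_gens_ab a b"
  have f: "range ?f \<subseteq> carrier G" using a b by (auto split: gens_ab.split)
  obtain h where h: "h \<in> hom (presented_group R) G" "\<And>u. h (gword_class R u) = gword_eval G ?f u"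
    using presented_group_universal[OF f eval] by blast
  interpret h: group_hom "presented_group R" G h
    by (intro group_hom.intro group_hom_axioms.intro group_presented_group is_group h(1))
  have "h ` carrier (presented_group R) = carrier G"
  proof (rule gen)
    show "subgroup (h ` carrier (presented_group R)) G"
      by (rule h.img_is_subgroup)
    have "h (gword_class R wa) = a" "h (gword_class R wb) = b"
      using a b by (simp_all add: h(2) wa_def wb_def)
    then show "a \<in> h ` carrier (presented_group R)" "b \<in> h ` carrier (presented_group R)"
      unfolding presented_group_carrier by (metis rangeI image_eqI)+
  qed
  moreover from this have "card (h ` carrier (presented_group R)) = card (carrier (presented_group R))"
    using card card_image_le[OF finP, of h] by simp
  then have "inj_on h (carrier (presented_group R))"
    by (rule eq_card_imp_inj_on[OF finP])
  ultimately have "h \<in> iso (presented_group R) G"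
    using h(1) by (auto simp: iso_def bij_betw_def)
  then show ?thesis
    using group.iso_sym[OF group_presented_group] is_isoI by blast
qed

lemma (in metacyclic_generators) iso_presented_semidirect:
  assumes n: "n = ord b" and k: "[r = k] (mod p)"
  shows "G \<cong> presented_group {(wa \<up> p, []), (wb \<up> n, []), (gword_conj wa wb, wa \<up> k)}"
    (is "_ \<cong> presented_group ?R")
proof (rule iso_presented_group[OF a b generators])
  \<comment> \<open>The empty word is \<open>wb \<up> 0\<close>, so \<open>a^p = 1\<close> takes the
    form \<open>a^p = b^q\<close> required by \<open>card_presented_group_le\<close>.\<close>
  have "gword_equiv ?R (wa \<up> p) (wb \<up> 0)"
    using presented_group_relation[of "wa \<up> p" "[]" ?R]
    by (simp add: gword_class_eq_iff) (simp add: gword_pow_def)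
  note P = card_presented_group_le[OF _ _ _ this, of p n k]
  have pos: "0 < p" "0 < n" using prime_p prime_gt_0_nat ord_b_pos n by auto
  then show "finite (carrier (presented_group ?R))" by (intro P) auto
  have "card (carrier (presented_group ?R)) \<le> p * n" using pos by (intro P) auto
  then show "card (carrier (presented_group ?R)) \<le> card (carrier G)"
    using p_times_ord_le_card n by simp
  have f: "range (case_gens_ab a b) \<subseteq> carrier G" using a b by (auto split: gens_ab.split)
  have "a [^] r = a [^] k" using a_pow_eq k by simp
  then show "gword_eval G (case_gens_ab a b) u = gword_eval G (case_gens_ab a b) v"
    if "(u, v) \<in> ?R" for u v
    using that ap ab a b n pow_ord_eq_1[OF b]
    by (auto simp: gword_eval_power[OF f] gword_eval_conj[OF f]) (simp_all add: wa_def wb_def)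
qed

text \<open>Replacing \<open>a\<close> by its product with the central element \<open>b\<^bsup>2k\<^esup>\<close> turns \<open>a\<^sup>3 = 1\<close> into
  \<open>a\<^sup>3 = b\<^sup>6\<close>.\<close>
lemma (in metacyclic_generators) iso_presented_order_18n:
  assumes p: "p = 3" and r: "r = 2" and n: "ord b = 6 * n"
    and k: "3 dvd k" "[k = 1] (mod n)" and m: "m mod 3 = 2" "6 * n dvd 2 * k * (m - 1)"
    and R: "R = {(wa \<up> (3 * n), []), (wb \<up> (6 * n), []), (gword_conj wa wb, wa \<up> m), (wa \<up> 3, wb \<up> 6)}"
  shows "G \<cong> presented_group R"
proof -
  define z where "z = b [^] (2 * k)"
  have z: "z \<in> carrier G" using b by (simp add: z_def)
  \<comment> \<open>\<open>b\<close> inverts \<open>a\<close>, so even powers of \<open>b\<close>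
    centralise it.\<close>
  have "[2 ^ (2 * k) = 1] (mod (3::nat))"
    using cong_pow[of 4 1 "3::nat" k] by (simp add: power_mult cong_def)
  then have za: "z \<otimes> a = a \<otimes> z"
    using b_pow_commutes_iff[of "2 * k"] p r by (simp add: z_def)
  define c where "c = a \<otimes> z"
  have c: "c \<in> carrier G" using a z by (simp add: c_def)
  have cpow: "c [^] i = a [^] i \<otimes> b [^] (2 * k * i)" for i :: nat
    unfolding c_def using pow_mult_distrib[OF za[symmetric] a z, of i] b by (simp add: z_def nat_pow_pow)
  have b1: "b [^] (6 * n) = \<one>" using pow_ord_eq_1[OF b] n by simp
  \<comment> \<open>This gives \<open>c^3 = b^(6k) = b^6\<close>: the condition
    \<open>k \<equiv> 1\<close> modulo \<open>n\<close> is exactly what the new relation asks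
    for.\<close>
  have "[6 * k = 6 * 1] (mod (6 * n))" using k(2) by (rule cong_cmult_leftI)
  then have "b [^] (6 * k) = b [^] (6::nat)" using pow_eq_iff_cong[OF b] n by simp
  then have c3: "c [^] (3::nat) = b [^] (6::nat)"
    using cpow[of 3] ap p b by (simp add: mult.commute)
  have c3n: "c [^] (3 * n) = \<one>"
    using nat_pow_pow[OF c, of 3 n] nat_pow_pow[OF b, of 6 n] c3 b1 by simp
  have "m \<noteq> 0" using m(1) by (cases "m = 0") auto
  then have "2 * k * m = 2 * k + 2 * k * (m - 1)" by (cases m) simp_all
  \<comment> \<open>Conjugation by \<open>b\<close> sends \<open>c = a z\<close> to
    \<open>a^2 z\<close>. To be \<open>c^m\<close>, this needs \<open>a^m = a^2\<close> and
    \<open>z^m = z\<close>; the two conditions on \<open>m\<close> supply them.\<close>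
  then have "[2 * k * m = 2 * k] (mod ord b)"
    using m(2) n by (simp add: cong_def mod_add_right_eq[symmetric, of _ "_ * _ * _"]) 
  then have "b [^] (2 * k * m) = z" using pow_eq_iff_cong[OF b] by (simp add: z_def)
  moreover have "a [^] m = a [^] r" using a_pow_eq m(1) p r by (simp add: cong_def)
  ultimately have cm: "c [^] m = a [^] r \<otimes> z" using cpow by simp
  have bz: "b \<otimes> z = z \<otimes> b" using commute_pow[OF b b, of "2 * k"] by (simp add: z_def)
  have "inv b \<otimes> c \<otimes> b = inv b \<otimes> a \<otimes> (z \<otimes> b)" unfolding c_def using a b z by (simp add: m_assoc)
  also have "\<dots> = (inv b \<otimes> a \<otimes> b) \<otimes> z" unfolding bz[symmetric] using a b z by (simp add: m_assoc)
  finally have conj: "inv b \<otimes> c \<otimes> b = c [^] m" by (simp add: ab cm)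
  have npos: "0 < n" using ord_b_pos n by simp
  have eqv: "gword_equiv R (wa \<up> 3) (wb \<up> 6)"
    using presented_group_relation[of "wa \<up> 3" "wb \<up> 6" R] R by (simp add: gword_class_eq_iff)
  note P = card_presented_group_le[OF _ _ _ eqv, of "3 * n" "6 * n" m]
  show ?thesis
  proof (rule iso_presented_group[OF c b])
    show "finite (carrier (presented_group R))" by (rule P(1)) (use R npos in auto)
    have "card (carrier (presented_group R)) \<le> 3 * (6 * n)" by (rule P(2)) (use R npos in auto)
    then show "card (carrier (presented_group R)) \<le> card (carrier G)"
      using p_times_ord_le_card n p by simp
    have f: "range (case_gens_ab c b) \<subseteq> carrier G" using c b by (auto split: gens_ab.split)
    show "gword_eval G (case_gens_ab c b) u = gword_eval G (case_gens_ab c b) v" if "(u, v) \<in> R" for u v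
    proof -
      have 1: "gword_eval G (case_gens_ab c b) wa = c" "gword_eval G (case_gens_ab c b) wb = b"
        using c b by (simp_all add: wa_def wb_def)
      show ?thesis
        using that unfolding R
        by (auto simp: gword_eval_power[OF f] gword_eval_conj[OF f] 1 c3 c3n b1 conj)
    qed
    fix H assume H: "subgroup H G" "c \<in> H" "b \<in> H"
    have "z \<in> H" using cyc_subset[OF H(1,3)] by (auto simp: z_def)
    then have "c \<otimes> inv z \<in> H" using H subgroup.m_closed subgroup.m_inv_closed by metis
    then have "a \<in> H" using a z by (simp add: c_def m_assoc)
    then show "H = carrier G" using generators H by blast
  qed
qed

theorem theoremC:
  fixes G :: "('a, 'b) monoid_scheme"
  assumes "group G" and "finite (carrier G)" and "\<not> nilpotent_group G"
    and "covering_number G = 6"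
  shows "\<exists>n::nat. 0 < n \<and>
    (([4 ^ n = 1] (mod 5::nat) \<and> \<not> 5 dvd n \<and>
        G \<cong> presented_group {(wa \<up> 5, []), (wb \<up> n, []), (gword_conj wa wb, wa \<up> 4)})
   \<or> ([2 ^ n = 1] (mod 5::nat) \<and> \<not> 5 dvd n \<and> 4 dvd n \<and>
        G \<cong> presented_group {(wa \<up> 5, []), (wb \<up> n, []), (gword_conj wa wb, wa \<up> 2)})
   \<or> ([3 ^ n = 1] (mod 5::nat) \<and> \<not> 5 dvd n \<and> 4 dvd n \<and>
        G \<cong> presented_group {(wa \<up> 5, []), (wb \<up> n, []), (gword_conj wa wb, wa \<up> 3)})
   \<or> ((3 dvd n \<or> 3 dvd (n + 2)) \<and>
        G \<cong> presented_group {(wa \<up> (3 * n), []), (wb \<up> (6 * n), []),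
              (gword_conj wa wb, wa \<up> (n + 1)), (wa \<up> 3, wb \<up> 6)})
   \<or> ((3 dvd n \<or> 3 dvd (n + 1)) \<and>
        G \<cong> presented_group {(wa \<up> (3 * n), []), (wb \<up> (6 * n), []),
              (gword_conj wa wb, wa \<up> (2 * n + 1)), (wa \<up> 3, wb \<up> 6)})
   \<or> (2 dvd n \<and> (3 dvd n \<or> 3 dvd (n + 2)) \<and>
        G \<cong> presented_group {(wa \<up> (3 * n), []), (wb \<up> (6 * n), []),
              (wa \<up> 3, wb \<up> 6), (gword_conj wa wb, wa \<up> (n + 1))})
   \<or> (2 dvd n \<and> \<not> 3 dvd (n + 2) \<and>
        G \<cong> presented_group {(wa \<up> (3 * n), []), (wb \<up> (6 * n), []),
              (wa \<up> 3, wb \<up> 6), (gword_conj wa wb, wa \<up> (2 * n + 1))}))"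
proof -
  interpret finite_group G
    using assms(1,2) by (intro finite_group.intro finite_group_axioms.intro)
  have "\<not> cyclic_group G" using assms(4) by (auto simp: covering_number_def)
  then interpret six_max_cyclic G
    using covering_number_eq_card_max_cyclic assms(3,4) nilpotent_if_coprime_elements_commute[OF fin]
    by unfold_locales auto
  from structure_dichotomy show ?thesis
  proof (elim disjE exE conjE)
    fix r a b
    assume M: "metacyclic_generators G 5 r a b" and r: "2 \<le> r" "r < 5" and n5: "\<not> 5 dvd ord b"
    interpret M: metacyclic_generators G 5 r a b by (rule M)
    define n where "n = ord b"
    have rn: "[r ^ n = 1] (mod 5)" using M.r_pow_ord by (simp add: n_def)
    note iso = M.iso_presented_semidirect[OF n_def, of r]
    \<comment> \<open>Both 2 and 3 have order 4 modulo 5, so for \<open>r = 2\<close> and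
      \<open>r = 3\<close> the congruence \<open>rn\<close> forces \<open>4 dvd n\<close>.\<close>
    have "(x::nat) ^ n mod 5 = x ^ (n mod 4) mod 5" if "x ^ 4 mod 5 = 1" for x
    proof -
      have "x ^ n = (x ^ 4) ^ (n div 4) * x ^ (n mod 4)"
        by (simp flip: power_mult power_add)
      moreover have "((x ^ 4) ^ (n div 4)) mod 5 = 1"
        using power_mod[of "x ^ 4" 5 "n div 4"] that by simp
      ultimately show ?thesis by (metis mod_mult_left_eq mult_1)
    qed
    from this[of 2] this[of 3] have pows: "2 ^ n mod (5::nat) = 2 ^ (n mod 4) mod 5"
      "3 ^ n mod (5::nat) = 3 ^ (n mod 4) mod 5" by simp_all
    have "n mod 4 < 4" by simp
    then have n4: "n mod 4 \<in> {0, 1, 2, 3}" by auto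
    consider "r = 2" | "r = 3" | "r = 4" using r by linarith
    then show ?thesis
    proof cases
      case 1
      then have "4 dvd n" using rn pows(1) n4 by (auto simp: cong_def)
      then show ?thesis
        using iso rn n5 M.ord_b_pos 1 n_def by (intro exI[of _ n]) simp
    next
      case 2
      then have "4 dvd n" using rn pows(2) n4 by (auto simp: cong_def)
      then show ?thesis
        using iso rn n5 M.ord_b_pos 2 n_def by (intro exI[of _ n]) simp
    next
      case 3
      then show ?thesis
        using iso rn n5 M.ord_b_pos n_def by (intro exI[of _ n]) simp
    qed
  next
    fix a b n
    assume M: "metacyclic_generators G 3 2 a b" and n: "ord b = 6 * n" and n3: "\<not> 3 dvd n"
    interpret M: metacyclic_generators G 3 2 a b by (rule M)
    have pos: "0 < n" using M.ord_b_pos n by simp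
    have "n mod 3 = 1 \<or> n mod 3 = 2" using n3 by presburger
    then show ?thesis
    proof
      assume n1: "n mod 3 = 1"
      \<comment> \<open>Here \<open>k = 1 + 2 * n\<close> and \<open>m = n + 1\<close>. Divisibility
        of \<open>k\<close> by 3 makes \<open>2 * k * (m - 1) = 2 * k * n\<close> a multiple of
        \<open>6 * n\<close>.\<close>
      then have d: "3 dvd 1 + 2 * n" "3 dvd n + 2" "(n + 1) mod 3 = 2" by presburger+
      then obtain l where l: "1 + 2 * n = 3 * l" by (auto elim: dvdE)
      have "6 * n dvd 2 * (1 + 2 * n) * (n + 1 - 1)" unfolding l by simp
      moreover have "[1 + 2 * n = 1] (mod n)" unfolding cong_def by (rule mod_mult_self1)
      ultimately have "G \<cong> presented_group {(wa \<up> (3 * n), []), (wb \<up> (6 * n), []),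
              (gword_conj wa wb, wa \<up> (n + 1)), (wa \<up> 3, wb \<up> 6)}"
        using M.iso_presented_order_18n[OF HOL.refl HOL.refl n d(1) _ d(3) _ HOL.refl] by blast
      then show ?thesis using d(2) pos by blast
    next
      assume n2: "n mod 3 = 2"
      \<comment> \<open>Here \<open>k = 1 + n\<close> and \<open>m = 2 * n + 1\<close>: for this
        residue of \<open>n\<close> it is \<open>2 * n + 1\<close>, not \<open>n + 1\<close>, that
        is congruent to 2 modulo 3.\<close>
      then have d: "3 dvd 1 + n" "3 dvd n + 1" "(2 * n + 1) mod 3 = 2" by presburger+
      then obtain l where l: "1 + n = 3 * l" by (auto elim: dvdE)
      have "6 * n dvd 2 * (1 + n) * (2 * n + 1 - 1)" unfolding l by simp
      moreover have "[1 + n = 1] (mod n)" unfolding cong_def by (rule mod_add_self2)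
      ultimately have "G \<cong> presented_group {(wa \<up> (3 * n), []), (wb \<up> (6 * n), []),
              (gword_conj wa wb, wa \<up> (2 * n + 1)), (wa \<up> 3, wb \<up> 6)}"
        using M.iso_presented_order_18n[OF HOL.refl HOL.refl n d(1) _ d(3) _ HOL.refl] by blast
      then show ?thesis using d(2) pos by blast
    qed
  qed
qed

end
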